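(* Let $\Delta_1,\Delta_2$ be graphs sharing exactly one link $e$ and its endpoints, and let $\Delta$ be either their edge amalgamation $\Delta_1\cup_e\Delta_2$ or their edge sum $\Delta_1\oplus_e\Delta_2$. Let $\Omega_1,\Omega_2$ be biased expansions of $\Delta_1,\Delta_2$ with $|p_1^{-1}(e)|=|p_2^{-1}(e)|$. Then any expanded edge amalgamation $\Omega_1\cup_e\Omega_2$, respectively expanded edge sum $\Omega_1\oplus_e\Omega_2$, is a biased expansion of $\Delta$. In the amalgamation case, $\Omega_1$ and $\Omega_2$ are subgraphs of $\Omega_1\cup_e\Omega_2$. In the sum case, if $\Delta_1$ and $\Delta_2$ are $2$-connected with at least $3$ nodes each, then $\Omega_1$ and $\Omega_2$ are (isomorphic to) expansion minors of $\Omega_1\oplus_e\Omega_2$.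
   Context: A biased graph is a graph with a set of circles, called balanced, such that no theta subgraph contains exactly two balanced circles. A biased expansion of $\Delta$ is a biased graph $\Omega$ with surjective $p:\|\Omega\|\to\Delta$, identity on nodes, no balanced digon in any fiber, and the circle lifting property (for every circle $e_1\cdots e_l$ of $\Delta$ and any $\tilde e_i\in p^{-1}(e_i)$, $i<l$, exactly one $\tilde e_l\in p^{-1}(e_l)$ makes $\tilde e_1\cdots\tilde e_l$ balanced). Edge amalgamation: $\Delta_1\cup\Delta_2$; edge sum: $(\Delta_1\cup\Delta_2)\setminus e$. For a bijection $\beta:p_1^{-1}(e)\to p_2^{-1}(e)$, the expanded edge amalgamation $\Omega_1\cup_{e,\beta}\Omega_2$ is the union with each $\tilde e$ identified with $\beta(\tilde e)$; its balanced circles are those of $\Omega_1$, those of $\Omega_2$, and all $(\tilde C_1\cup\tilde C_2)\setminus\{\tilde e\}$ where $\tilde C_i$ is balanced in $\Omega_i$ and both contain the same identified edge $\tilde e$ over $e$. The expanded edge sum is the amalgamation with the fiber over $e$ deleted. Expansion minor of a biased expansion $\Omega\downarrow_p\Delta$: choose a partition $E(\Delta)=S\cup T\cup D$ and a balanced lift $\tilde T$ of $T$ (one edge over each edge of $T$, no unbalanced circle); delete $p^{-1}(D)$, contract $\tilde T$, delete the remaining edges of $p^{-1}(T)$, and optionally delete isolated nodes; a circle $\tilde C$ of the result is balanced iff some balanced circle $\tilde D$ of $\Omega$ satisfies $\tilde D\subseteq\tilde C\cup\tilde T$ and $\tilde D\setminus\tilde T=\tilde C$. *)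

theory Defs
  imports Main "HOL-Library.Equipollence"
begin

section \<open>Graphs\<close>

text \<open>
  Graphs may be infinite and may have loops and multiple edges. The set of endpoints of an edge
  has one element for a loop and two for a link; values of \<open>ends\<close> outside \<open>edges\<close> are irrelevant.
\<close>

record ('v, 'e) mgraph =
  nodes :: "'v set"
  edges :: "'e set"
  ends :: "'e \<Rightarrow> 'v set"

definition is_graph :: "('v, 'e, 'm) mgraph_scheme \<Rightarrow> bool" where
  "is_graph G \<longleftrightarrow>
     (\<forall>f\<in>edges G. ends G f \<subseteq> nodes G \<and> (card (ends G f) = 1 \<or> card (ends G f) = 2))"

definition is_link :: "('v, 'e, 'm) mgraph_scheme \<Rightarrow> 'e \<Rightarrow> bool" where
  "is_link G f \<longleftrightarrow> f \<in> edges G \<and> card (ends G f) = 2"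

definition is_path :: "('v, 'e, 'm) mgraph_scheme \<Rightarrow> 'v list \<Rightarrow> 'e list \<Rightarrow> bool" where
  "is_path G vs es \<longleftrightarrow>
     length vs = Suc (length es) \<and> distinct vs \<and> set vs \<subseteq> nodes G \<and> set es \<subseteq> edges G \<and>
     (\<forall>i<length es. ends G (es ! i) = {vs ! i, vs ! Suc i})"

text \<open>
  The word \<open>e\<^sub>1 \<dots> e\<^sub>l\<close> of edges, in cyclic order, of a circle of length \<open>l \<ge> 1\<close>;
  a loop is a circle of length 1, a pair of parallel links (a digon) one of length 2.
\<close>

definition circle_word :: "('v, 'e, 'm) mgraph_scheme \<Rightarrow> 'e list \<Rightarrow> bool" where
  "circle_word G es \<longleftrightarrow>
     es \<noteq> [] \<and> distinct es \<and> set es \<subseteq> edges G \<and>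
     (\<exists>vs. length vs = length es \<and> distinct vs \<and> set vs \<subseteq> nodes G \<and>
        (\<forall>i<length es. ends G (es ! i) = {vs ! i, vs ! (Suc i mod length es)}))"

definition is_circle :: "('v, 'e, 'm) mgraph_scheme \<Rightarrow> 'e set \<Rightarrow> bool" where
  "is_circle G C \<longleftrightarrow> (\<exists>es. circle_word G es \<and> set es = C)"

text \<open>Edge sets of theta subgraphs: three internally disjoint paths joining two distinct nodes.\<close>

definition is_theta :: "('v, 'e, 'm) mgraph_scheme \<Rightarrow> 'e set \<Rightarrow> bool" where
  "is_theta G \<Theta> \<longleftrightarrow>
     (\<exists>u v (vs :: nat \<Rightarrow> 'v list) (es :: nat \<Rightarrow> 'e list). u \<noteq> v \<and>
        (\<forall>i<3. is_path G (vs i) (es i) \<and> hd (vs i) = u \<and> last (vs i) = v) \<and>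
        (\<forall>i<3. \<forall>j<3. i \<noteq> j \<longrightarrow>
           set (vs i) \<inter> set (vs j) = {u, v} \<and> set (es i) \<inter> set (es j) = {}) \<and>
        \<Theta> = (\<Union>i<3. set (es i)))"

definition joined :: "('v, 'e, 'm) mgraph_scheme \<Rightarrow> 'e set \<Rightarrow> 'v \<Rightarrow> 'v \<Rightarrow> bool" where
  "joined G T u v \<longleftrightarrow> (u, v) \<in> {(x, y). \<exists>t\<in>T. ends G t = {x, y}}\<^sup>*"

definition connected_graph :: "('v, 'e, 'm) mgraph_scheme \<Rightarrow> bool" where
  "connected_graph G \<longleftrightarrow>
     nodes G \<noteq> {} \<and> (\<forall>u\<in>nodes G. \<forall>v\<in>nodes G. joined G (edges G) u v)"

definition delete_node :: "('v, 'e, 'm) mgraph_scheme \<Rightarrow> 'v \<Rightarrow> ('v, 'e) mgraph" where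
  "delete_node G x =
     \<lparr>nodes = nodes G - {x}, edges = {f \<in> edges G. x \<notin> ends G f}, ends = ends G\<rparr>"

definition two_connected :: "('v, 'e, 'm) mgraph_scheme \<Rightarrow> bool" where
  "two_connected G \<longleftrightarrow>
     connected_graph G \<and> (\<forall>x\<in>nodes G. connected_graph (delete_node G x))"

definition at_least_three_nodes :: "('v, 'e, 'm) mgraph_scheme \<Rightarrow> bool" where
  "at_least_three_nodes G \<longleftrightarrow> infinite (nodes G) \<or> 3 \<le> card (nodes G)"

section \<open>Edge amalgamations and edge sums of graphs\<close>

definition share_exactly_link ::
  "('v, 'e) mgraph \<Rightarrow> ('v, 'e) mgraph \<Rightarrow> 'e \<Rightarrow> bool" where
  "share_exactly_link \<Delta>1 \<Delta>2 e \<longleftrightarrow>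
     is_link \<Delta>1 e \<and> is_link \<Delta>2 e \<and> ends \<Delta>1 e = ends \<Delta>2 e \<and>
     edges \<Delta>1 \<inter> edges \<Delta>2 = {e} \<and> nodes \<Delta>1 \<inter> nodes \<Delta>2 = ends \<Delta>1 e"

definition edge_amalgamation ::
  "('v, 'e) mgraph \<Rightarrow> ('v, 'e) mgraph \<Rightarrow> ('v, 'e) mgraph" where
  "edge_amalgamation \<Delta>1 \<Delta>2 =
     \<lparr>nodes = nodes \<Delta>1 \<union> nodes \<Delta>2, edges = edges \<Delta>1 \<union> edges \<Delta>2,
      ends = (\<lambda>f. if f \<in> edges \<Delta>1 then ends \<Delta>1 f else ends \<Delta>2 f)\<rparr>"

definition edge_sum ::
  "('v, 'e) mgraph \<Rightarrow> ('v, 'e) mgraph \<Rightarrow> 'e \<Rightarrow> ('v, 'e) mgraph" where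
  "edge_sum \<Delta>1 \<Delta>2 e =
     (edge_amalgamation \<Delta>1 \<Delta>2)\<lparr>edges := (edges \<Delta>1 \<union> edges \<Delta>2) - {e}\<rparr>"

section \<open>Biased graphs and biased expansions\<close>

record ('v, 'e) biased_graph = "('v, 'e) mgraph" +
  balanced :: "'e set set"

definition is_biased_graph :: "('v, 'e) biased_graph \<Rightarrow> bool" where
  "is_biased_graph \<Omega> \<longleftrightarrow>
     is_graph \<Omega> \<and> (\<forall>C\<in>balanced \<Omega>. is_circle \<Omega> C) \<and>
     (\<forall>\<Theta>. is_theta \<Omega> \<Theta> \<longrightarrow> card {C \<in> balanced \<Omega>. C \<subseteq> \<Theta>} \<noteq> 2)"

definition fiber :: "('v, 'f) biased_graph \<Rightarrow> ('f \<Rightarrow> 'e) \<Rightarrow> 'e \<Rightarrow> 'f set" where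
  "fiber \<Omega> p e = {f \<in> edges \<Omega>. p f = e}"

definition circle_lifting ::
  "('v, 'f) biased_graph \<Rightarrow> ('f \<Rightarrow> 'e) \<Rightarrow> ('v, 'e) mgraph \<Rightarrow> bool" where
  "circle_lifting \<Omega> p \<Delta> \<longleftrightarrow>
     (\<forall>es e fs. circle_word \<Delta> (es @ [e]) \<longrightarrow> list_all2 (\<lambda>f e'. f \<in> fiber \<Omega> p e') fs es \<longrightarrow>
        (\<exists>!f. f \<in> fiber \<Omega> p e \<and> insert f (set fs) \<in> balanced \<Omega>))"

text \<open>The projection is the identity on nodes, so only its edge part \<open>p\<close> is recorded.\<close>

definition biased_expansion ::
  "('v, 'f) biased_graph \<Rightarrow> ('f \<Rightarrow> 'e) \<Rightarrow> ('v, 'e) mgraph \<Rightarrow> bool" where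
  "biased_expansion \<Omega> p \<Delta> \<longleftrightarrow>
     is_biased_graph \<Omega> \<and> is_graph \<Delta> \<and>
     nodes \<Omega> = nodes \<Delta> \<and> p ` edges \<Omega> = edges \<Delta> \<and>
     (\<forall>f\<in>edges \<Omega>. ends \<Omega> f = ends \<Delta> (p f)) \<and>
     (\<forall>f\<in>edges \<Omega>. \<forall>g\<in>edges \<Omega>. f \<noteq> g \<and> p f = p g \<longrightarrow> {f, g} \<notin> balanced \<Omega>) \<and>
     circle_lifting \<Omega> p \<Delta>"

section \<open>Expanded edge amalgamations and expanded edge sums\<close>

text \<open>
  The union of \<open>\<Omega>\<^sub>1\<close> and \<open>\<Omega>\<^sub>2\<close> is taken over the disjoint union of their edge sets, where a pair
  of identified edges \<open>f\<close> and \<open>\<beta> f\<close> is represented by \<open>Inl f\<close>. Thus \<open>Inl\<close> is the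
  canonical map on edges of \<open>\<Omega>\<^sub>1\<close> and the following one is the canonical map on edges of \<open>\<Omega>\<^sub>2\<close>.
\<close>

definition glue2 ::
  "('v, 'f) biased_graph \<Rightarrow> ('f \<Rightarrow> 'e) \<Rightarrow> ('v, 'g) biased_graph \<Rightarrow> ('g \<Rightarrow> 'e) \<Rightarrow> 'e \<Rightarrow> ('f \<Rightarrow> 'g) \<Rightarrow>
   'g \<Rightarrow> 'f + 'g" where
  "glue2 \<Omega>1 p1 \<Omega>2 p2 e \<beta> g =
     (if g \<in> fiber \<Omega>2 p2 e then Inl (inv_into (fiber \<Omega>1 p1 e) \<beta> g) else Inr g)"

definition expanded_edge_amalgamation ::
  "('v, 'f) biased_graph \<Rightarrow> ('f \<Rightarrow> 'e) \<Rightarrow> ('v, 'g) biased_graph \<Rightarrow> ('g \<Rightarrow> 'e) \<Rightarrow> 'e \<Rightarrow> ('f \<Rightarrow> 'g) \<Rightarrow>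
   ('v, 'f + 'g) biased_graph" where
  "expanded_edge_amalgamation \<Omega>1 p1 \<Omega>2 p2 e \<beta> =
     (let j = glue2 \<Omega>1 p1 \<Omega>2 p2 e \<beta> in
      \<lparr>nodes = nodes \<Omega>1 \<union> nodes \<Omega>2,
       edges = Inl ` edges \<Omega>1 \<union> j ` edges \<Omega>2,
       ends = case_sum (ends \<Omega>1) (ends \<Omega>2),
       balanced =
         (\<lambda>C. Inl ` C) ` balanced \<Omega>1 \<union> (\<lambda>C. j ` C) ` balanced \<Omega>2 \<union>
         {(Inl ` C1 \<union> j ` C2) - {Inl f} | C1 C2 f.
            C1 \<in> balanced \<Omega>1 \<and> C2 \<in> balanced \<Omega>2 \<and>
            f \<in> fiber \<Omega>1 p1 e \<and> f \<in> C1 \<and> \<beta> f \<in> C2}\<rparr>)"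

definition delete_edges ::
  "('v, 'f) biased_graph \<Rightarrow> 'f set \<Rightarrow> ('v, 'f) biased_graph" where
  "delete_edges \<Omega> D =
     \<Omega>\<lparr>edges := edges \<Omega> - D, balanced := {C \<in> balanced \<Omega>. C \<inter> D = {}}\<rparr>"

definition expanded_edge_sum ::
  "('v, 'f) biased_graph \<Rightarrow> ('f \<Rightarrow> 'e) \<Rightarrow> ('v, 'g) biased_graph \<Rightarrow> ('g \<Rightarrow> 'e) \<Rightarrow> 'e \<Rightarrow> ('f \<Rightarrow> 'g) \<Rightarrow>
   ('v, 'f + 'g) biased_graph" where
  "expanded_edge_sum \<Omega>1 p1 \<Omega>2 p2 e \<beta> =
     (let \<Omega> = expanded_edge_amalgamation \<Omega>1 p1 \<Omega>2 p2 e \<beta>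
      in delete_edges \<Omega> (fiber \<Omega> (case_sum p1 p2) e))"

text \<open>\<open>\<Omega>'\<close> is a subgraph of \<open>\<Omega>\<close> (as a biased graph) when its edges are identified with edges of \<open>\<Omega>\<close>
  along \<open>j\<close>.\<close>

definition biased_subgraph_via ::
  "('f \<Rightarrow> 'h) \<Rightarrow> ('v, 'f) biased_graph \<Rightarrow> ('v, 'h) biased_graph \<Rightarrow> bool" where
  "biased_subgraph_via j \<Omega>' \<Omega> \<longleftrightarrow>
     nodes \<Omega>' \<subseteq> nodes \<Omega> \<and> inj_on j (edges \<Omega>') \<and> j ` edges \<Omega>' \<subseteq> edges \<Omega> \<and>
     (\<forall>f\<in>edges \<Omega>'. ends \<Omega> (j f) = ends \<Omega>' f) \<and>
     (\<forall>C. C \<subseteq> edges \<Omega>' \<longrightarrow> (C \<in> balanced \<Omega>' \<longleftrightarrow> j ` C \<in> balanced \<Omega>))"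

section \<open>Expansion minors\<close>

definition balanced_lift ::
  "('v, 'f) biased_graph \<Rightarrow> ('f \<Rightarrow> 'e) \<Rightarrow> 'e set \<Rightarrow> 'f set \<Rightarrow> bool" where
  "balanced_lift \<Omega> p T T' \<longleftrightarrow>
     T' \<subseteq> edges \<Omega> \<and> bij_betw p T' T \<and> (\<forall>C. is_circle \<Omega> C \<and> C \<subseteq> T' \<longrightarrow> C \<in> balanced \<Omega>)"

definition node_class :: "('v, 'e, 'm) mgraph_scheme \<Rightarrow> 'e set \<Rightarrow> 'v \<Rightarrow> 'v set" where
  "node_class G T v = {w \<in> nodes G. joined G T v w}"

text \<open>The graph with edge set \<open>F\<close> obtained by contracting \<open>T\<close> and deleting all other edges.
  Its nodes are the node sets of the components of the spanning subgraph with edge set \<open>T\<close>.\<close>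

definition contract_onto ::
  "('v, 'e, 'm) mgraph_scheme \<Rightarrow> 'e set \<Rightarrow> 'e set \<Rightarrow> ('v set, 'e) mgraph" where
  "contract_onto G T F =
     \<lparr>nodes = node_class G T ` nodes G, edges = F, ends = (\<lambda>f. node_class G T ` ends G f)\<rparr>"

definition isolated_nodes :: "('v, 'e, 'm) mgraph_scheme \<Rightarrow> 'v set" where
  "isolated_nodes G = {x \<in> nodes G. \<forall>f\<in>edges G. x \<notin> ends G f}"

definition expansion_minor ::
  "('v, 'f) biased_graph \<Rightarrow> ('f \<Rightarrow> 'e) \<Rightarrow> ('v, 'e) mgraph \<Rightarrow> ('v set, 'f) biased_graph \<Rightarrow> bool" where
  "expansion_minor \<Omega> p \<Delta> M \<longleftrightarrow>
     (\<exists>S T D T' W. edges \<Delta> = S \<union> T \<union> D \<and> S \<inter> T = {} \<and> S \<inter> D = {} \<and> T \<inter> D = {} \<and>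
        balanced_lift \<Omega> p T T' \<and>
        (let G = contract_onto \<Omega> T' {f \<in> edges \<Omega>. p f \<in> S} in
           W \<subseteq> isolated_nodes G \<and>
           M = \<lparr>nodes = nodes G - W, edges = edges G, ends = ends G,
                balanced = {C. is_circle G C \<and>
                  (\<exists>B\<in>balanced \<Omega>. B \<subseteq> C \<union> T' \<and> B - T' = C)}\<rparr>))"

text \<open>
  Isomorphism of biased expansions: an isomorphism of biased graphs mapping fibers to fibers.
  It descends to an isomorphism of the base graphs.
\<close>

definition expansion_isomorphic ::
  "('v, 'f) biased_graph \<Rightarrow> ('f \<Rightarrow> 'e) \<Rightarrow> ('w, 'h) biased_graph \<Rightarrow> ('h \<Rightarrow> 'e') \<Rightarrow> bool" where
  "expansion_isomorphic \<Omega> p \<Omega>' p' \<longleftrightarrow>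
     (\<exists>\<phi> \<psi>. bij_betw \<phi> (nodes \<Omega>) (nodes \<Omega>') \<and> bij_betw \<psi> (edges \<Omega>) (edges \<Omega>') \<and>
        (\<forall>f\<in>edges \<Omega>. ends \<Omega>' (\<psi> f) = \<phi> ` ends \<Omega> f) \<and>
        (\<forall>C. C \<subseteq> edges \<Omega> \<longrightarrow> (C \<in> balanced \<Omega> \<longleftrightarrow> \<psi> ` C \<in> balanced \<Omega>')) \<and>
        (\<forall>f\<in>edges \<Omega>. \<forall>g\<in>edges \<Omega>. p f = p g \<longleftrightarrow> p' (\<psi> f) = p' (\<psi> g)))"

end

theory Submission imports Defs begin

text \<open>
  A circle of the amalgamation that is not contained in one side consists of a path \<open>A\<close> in
  \<open>\<Omega>\<^sub>1\<close> and a path \<open>R\<close> in \<open>\<Omega>\<^sub>2\<close> between the ends \<open>u, v\<close> of \<open>e\<close>.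
  By circle lifting each of the two paths is closed to a balanced circle by exactly one edge over
  \<open>e\<close>, and \<open>A \<union> R\<close> is balanced iff these two edges coincide. Hence in a theta graph a
  segment from \<open>u\<close> to \<open>v\<close> on one side can be traded for its closing edge, which moves the
  theta graph to the other side; if the trivalent nodes are \<open>u, v\<close> themselves, balance of two of
  the three paths is equality of their closing edges, which is transitive. The closing edge also
  reduces circle lifting to the two sides. To recover \<open>\<Omega>\<^sub>1\<close> from the edge sum,
  take a path from \<open>u\<close> to \<open>v\<close> in \<open>\<Delta>\<^sub>2\<close> avoiding \<open>e\<close> and contract a
  lift of all of it but one edge \<open>e\<^sub>0\<close>: circle lifting identifies the fiber over
  \<open>e\<^sub>0\<close> with the fiber over \<open>e\<close>.
\<close>

section \<open>Paths and circles as sets\<close>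

text \<open>A theta graph of the union can wind through the cut \<open>{u, v}\<close> in many ways.
  The case analysis stays small because the cut never separates the two trivalent nodes, and
  because, unless \<open>u\<close> and \<open>v\<close> are themselves the trivalent nodes, at most
  one of the three paths contains both of them; only that path can have a part on the other side.
  The gluing is symmetric, so each argument is made for side 1 and carried over by
  \<open>swap\<close>. A shared edge belongs to both sides and is itself a path from
  \<open>u\<close> to \<open>v\<close>, which is why it keeps appearing as a degenerate case.
  Balance is a property of edge sets and circles can be rotated, so paths and circles are treated as
  sets; indexed words would have to be renumbered at each cut or concatenation. In the edge sum,
  contracting the rest of the path merges its nodes into \<open>v\<close>, so that \<open>e0\<close>
  becomes parallel to the deleted \<open>e\<close>; 2-connectedness and a third node provide such a
  path.\<close>

text \<open>
  \<open>pth en x N P y\<close>: a path from \<open>x\<close> to \<open>y\<close> with node set \<open>N\<close> and edge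
  set \<open>P\<close>.
  In \<open>circ\<close> the case \<open>x = y\<close> is a loop.
\<close>

inductive pth :: "('a \<Rightarrow> 'v set) \<Rightarrow> 'v \<Rightarrow> 'v set \<Rightarrow> 'a set \<Rightarrow> 'v \<Rightarrow> bool" for en where
  Nil: "pth en x {x} {} x"
| Cons: "en f = {x, y} \<Longrightarrow> pth en y N P z \<Longrightarrow> x \<notin> N \<Longrightarrow> pth en x (insert x N) (insert f P) z"

definition circ :: "('a \<Rightarrow> 'v set) \<Rightarrow> 'a set \<Rightarrow> bool" where
  "circ en C \<longleftrightarrow> (\<exists>f x y N P. en f = {x, y} \<and> f \<notin> P \<and> pth en x N P y \<and> C = insert f P)"

lemma pth_endpoints: "pth en x N P y \<Longrightarrow> x \<in> N \<and> y \<in> N"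
  by (induction rule: pth.induct) auto

lemma pth_ends: "pth en x N P y \<Longrightarrow> f \<in> P \<Longrightarrow> en f \<subseteq> N"
  by (induction rule: pth.induct) (auto dest: pth_endpoints)

lemma pth_link: "pth en x N P y \<Longrightarrow> f \<in> P \<Longrightarrow> \<exists>a b. a \<noteq> b \<and> en f = {a, b}"
proof (induction rule: pth.induct)
  case (Cons g x y N P z)
  then have "x \<noteq> y" using pth_endpoints by metis
  with Cons show ?case by blast
qed simp

lemma pth_nodes: "pth en x N P y \<Longrightarrow> N \<subseteq> insert x (\<Union> (en ` P))"
  by (induction rule: pth.induct) auto

lemma pth_closed: "pth en x N P y \<Longrightarrow> x = y \<longleftrightarrow> P = {}"
  by (induction rule: pth.induct) (auto dest: pth_endpoints)

lemma pth_trivial: "pth en x N P x \<Longrightarrow> N = {x} \<and> P = {}"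
  by (erule pth.cases) (auto dest: pth_endpoints)

lemma pth_append:
  "pth en x N P y \<Longrightarrow> pth en y M Q z \<Longrightarrow> N \<inter> M = {y} \<Longrightarrow> pth en x (N \<union> M) (P \<union> Q) z"
proof (induction rule: pth.induct)
  case (Nil x)
  then have "{x} \<union> M = M" using pth_endpoints by fastforce
  then show ?case using Nil by simp
next
  case (Cons f x y N P w)
  have "w \<in> N" "x \<notin> M" using Cons.hyps Cons.prems by (auto dest: pth_endpoints)
  then have "N \<inter> M = {w}" using Cons.prems by blast
  with Cons have "pth en y (N \<union> M) (P \<union> Q) z" by blast
  then show ?case using Cons.hyps \<open>x \<notin> M\<close> pth.Cons[of en f x y "N \<union> M" "P \<union> Q" z] by simp
qed

lemma pth_edge: "en f = {x, y} \<Longrightarrow> x \<noteq> y \<Longrightarrow> pth en x {x, y} {f} y"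
  using pth.Cons[OF _ pth.Nil, of en f x y] by simp

lemma pth_rev: "pth en x N P y \<Longrightarrow> pth en y N P x"
proof (induction rule: pth.induct)
  case (Nil x)
  then show ?case by (rule pth.Nil)
next
  case (Cons f x y N P z)
  have "y \<in> N" using Cons.hyps by (auto dest: pth_endpoints)
  have "pth en y {y, x} {f} x" using Cons.hyps \<open>y \<in> N\<close> by (intro pth_edge) auto
  from pth_append[OF Cons.IH this] \<open>y \<in> N\<close> Cons.hyps show ?case
    by (simp add: insert_absorb Un_commute insert_commute)
qed

lemma pth_split_ex:
  "pth en x N P y \<Longrightarrow> w \<in> N \<Longrightarrow> \<exists>N1 P1 N2 P2. pth en x N1 P1 w \<and> pth en w N2 P2 y \<and>
     N = N1 \<union> N2 \<and> N1 \<inter> N2 = {w} \<and> P = P1 \<union> P2"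
proof (induction rule: pth.induct)
  case (Nil x)
  then show ?case using pth.Nil[of en x] by (intro exI[of _ "{x}"] exI[of _ "{}"]) auto
next
  case (Cons f x y N P z)
  show ?case
  proof (cases "w = x")
    case True
    have "pth en x (insert x N) (insert f P) z" using Cons by (meson pth.Cons)
    moreover have "pth en x {x} {} x" by (rule pth.Nil)
    ultimately show ?thesis unfolding True
      by (intro exI[of _ "{x}"] exI[of _ "{}"] exI[of _ "insert x N"] exI[of _ "insert f P"]) auto
  next
    case False
    then have "w \<in> N" using Cons by simp
    then obtain N1 P1 N2 P2 where *: "pth en y N1 P1 w" "pth en w N2 P2 z" "N = N1 \<union> N2"
      "N1 \<inter> N2 = {w}" "P = P1 \<union> P2" using Cons.IH by blast
    have "pth en x (insert x N1) (insert f P1) w" using Cons * by (auto intro: pth.Cons)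
    moreover have "insert x N1 \<inter> N2 = {w}" using * Cons.hyps by auto
    moreover have "insert x N = insert x N1 \<union> N2" "insert f P = insert f P1 \<union> P2" using * by auto
    ultimately show ?thesis using *(2) by (intro exI conjI)
  qed
qed

lemma pth_split:
  assumes "pth en x N P y" "w \<in> N"
  obtains N1 P1 N2 P2 where "pth en x N1 P1 w" "pth en w N2 P2 y"
    "N = N1 \<union> N2" "N1 \<inter> N2 = {w}" "P = P1 \<union> P2"
  using pth_split_ex[OF assms] by (elim exE conjE) (rule that)

lemma pth_edge_split:
  "pth en x N P y \<Longrightarrow> f \<in> P \<Longrightarrow> \<exists>a b N1 P1 N2 P2. pth en x N1 P1 a \<and> en f = {a, b} \<and> pth en b N2 P2 y \<and>
     N = N1 \<union> N2 \<and> N1 \<inter> N2 = {} \<and> P = insert f (P1 \<union> P2) \<and> f \<notin> P1 \<union> P2"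
proof (induction rule: pth.induct)
  case (Nil x)
  then show ?case by simp
next
  case (Cons g x y N P z)
  have gP: "g \<notin> P" using Cons.hyps pth_ends[of en y N P z g] by auto
  show ?case
  proof (cases "f = g")
    case True
    have "pth en x {x} {} x" by (rule pth.Nil)
    moreover have "{x} \<inter> N = {}" using Cons by simp
    ultimately show ?thesis using Cons.hyps gP unfolding True
      by (intro exI[of _ x] exI[of _ y] exI[of _ "{x}"] exI[of _ "{}"] exI[of _ N] exI[of _ P]) auto
  next
    case False
    then obtain a b N1 P1 N2 P2 where *: "pth en y N1 P1 a" "en f = {a, b}" "pth en b N2 P2 z"
      "N = N1 \<union> N2" "N1 \<inter> N2 = {}" "P = insert f (P1 \<union> P2)" "f \<notin> P1 \<union> P2"
      using Cons by (metis insertE)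
    have "pth en x (insert x N1) (insert g P1) a" using Cons * by (auto intro: pth.Cons)
    moreover have "insert x N1 \<inter> N2 = {}" using * Cons.hyps by auto
    moreover have "insert x N = insert x N1 \<union> N2" "insert g P = insert f (insert g P1 \<union> P2)"
      "f \<notin> insert g P1 \<union> P2"
      using * False by auto
    ultimately show ?thesis using *(2,3) by (intro exI conjI)
  qed
qed

text \<open>The first edge has the end \<open>x\<close>, which no later edge has. Edges of one fiber
  are parallel, so this makes the projection injective on paths of a biased expansion.\<close>

lemma pth_inj_ends: "pth en x N P y \<Longrightarrow> inj_on en P"
proof (induction rule: pth.induct)
  case (Cons f x y N P z)
  have "en f \<noteq> en g" if "g \<in> P" for g
    using pth_ends[OF Cons.hyps(2) that] Cons.hyps(1,3) by auto
  then have "en f \<notin> en ` P" by blast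
  then show ?case using Cons.IH by auto
qed simp

lemma pth_start_edge:
  assumes "pth en x N P y" "x \<noteq> y"
  obtains f where "f \<in> P" "x \<in> en f" "\<And>g. g \<in> P \<Longrightarrow> x \<in> en g \<Longrightarrow> g = f"
  using assms(1)
proof cases
  case (Cons f w N' P')
  show thesis
  proof (rule that[of f])
    show "g = f" if "g \<in> P" "x \<in> en g" for g
      using that Cons(2,5) pth_ends[OF Cons(4), of g] by blast
  qed (use Cons in auto)
qed (use assms in simp)

text \<open>Nodes do not repeat, so an edge joining the ends of a path leaves no room for a second
  edge. Applied to a shared edge, whose ends are \<open>u\<close> and \<open>v\<close>, it shows
  that an arc containing one consists of it alone.\<close>

lemma pth_edge_between:
  assumes "pth en x N P y" "g \<in> P" "en g = {x, y}"
  shows "P = {g}"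
  using assms(1)
proof cases
  case (Cons f w N' P')
  have "g \<notin> P'" using assms(3) Cons(5) pth_ends[OF Cons(4), of g] by auto
  then have "g = f" using assms(2) Cons by simp
  then have "w = y" using Cons assms(3) by (auto simp: doubleton_eq_iff)
  then show ?thesis using Cons \<open>g = f\<close> pth_trivial[of en y N' P'] by simp
qed (use assms in simp)

text \<open>Nodes are relabelled as well as edges, because contraction replaces nodes by classes;
  this is harmless as long as no two nodes of the path are merged.\<close>

lemma pth_image:
  "pth en x N P y \<Longrightarrow> (\<And>f. f \<in> P \<Longrightarrow> en' (h f) = \<phi> ` en f) \<Longrightarrow> inj_on \<phi> N \<Longrightarrow>
     pth en' (\<phi> x) (\<phi> ` N) (h ` P) (\<phi> y)"
proof (induction rule: pth.induct)
  case (Nil x)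
  then show ?case by (simp add: pth.Nil)
next
  case (Cons f x y N P z)
  then have "pth en' (\<phi> y) (\<phi> ` N) (h ` P) (\<phi> z)" by (auto simp: inj_on_def)
  moreover have "\<phi> x \<notin> \<phi> ` N" using Cons by (auto simp: inj_on_def)
  ultimately show ?case using pth.Cons[of en' "h f" "\<phi> x" "\<phi> y"] Cons by simp
qed

lemma pth_map:
  "pth en x N P y \<Longrightarrow> (\<And>f. f \<in> P \<Longrightarrow> en' (h f) = en f) \<Longrightarrow> pth en' x N (h ` P) y"
  using pth_image[of en x N P y en' h id] by simp

lemma pth_cong:
  "pth en x N P y \<Longrightarrow> (\<And>f. f \<in> P \<Longrightarrow> en' f = en f) \<Longrightarrow> pth en' x N P y"
  using pth_map[of en x N P y en' id] by simp

lemma circI: "en f = {x, y} \<Longrightarrow> f \<notin> P \<Longrightarrow> pth en x N P y \<Longrightarrow> circ en (insert f P)"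
  unfolding circ_def by blast

lemma circ_nonempty: "circ en C \<Longrightarrow> C \<noteq> {}"
  by (auto simp: circ_def)

text \<open>The definition of \<open>circ\<close> singles out one edge \<open>f\<close>, but any
  edge \<open>g\<close> can take its place: deleting \<open>g\<close> cuts the path in two pieces,
  and \<open>f\<close> joins their outer ends.\<close>

lemma circ_rotate:
  assumes "circ en C" "g \<in> C"
  shows "\<exists>a b N. en g = {a, b} \<and> pth en a N (C - {g}) b"
proof -
  obtain f x y N P where *: "en f = {x, y}" "f \<notin> P" "pth en x N P y" "C = insert f P"
    using assms(1) by (auto simp: circ_def)
  show ?thesis
  proof (cases "g = f")
    case True
    then show ?thesis using * by auto
  next
    case False
    then have "g \<in> P" using * assms by simp
    then obtain a b N1 P1 N2 P2 where **: "pth en x N1 P1 a" "en g = {a, b}" "pth en b N2 P2 y"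
      "N = N1 \<union> N2" "N1 \<inter> N2 = {}" "P = insert g (P1 \<union> P2)" "g \<notin> P1 \<union> P2"
      using pth_edge_split[OF *(3)] by metis
    have "x \<notin> N2" using pth_endpoints[OF **(1)] ** by auto
    then have "pth en x (insert x N2) (insert f P2) b"
      using *(1) pth_rev[OF **(3)] by (auto intro: pth.Cons)
    with pth_rev[OF **(1)] have "pth en a (N1 \<union> insert x N2) (P1 \<union> insert f P2) b"
      by (rule pth_append) (use ** pth_endpoints[OF **(1)] in auto)
    moreover have "C - {g} = P1 \<union> insert f P2" using * ** False by auto
    ultimately show ?thesis using **(2) by auto
  qed
qed

text \<open>Disjointness of the edge sets has to be asked for separately: two paths with only
  \<open>x\<close> and \<open>y\<close> in common can still be one and the same edge.\<close>

lemma circ_join: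
  assumes "pth en x N P y" "pth en x M Q y" "N \<inter> M = {x, y}" "x \<noteq> y" "P \<inter> Q = {}"
  shows "circ en (P \<union> Q)"
  using assms(1)
proof cases
  case (Cons f w N' P')
  have "y \<in> N'" using Cons pth_endpoints by fastforce
  have "pth en w (N' \<union> M) (P' \<union> Q) x" using Cons(4) pth_rev[OF assms(2)]
    by (rule pth_append) (use Cons assms \<open>y \<in> N'\<close> in auto)
  moreover have "f \<notin> P'" using Cons pth_ends[OF Cons(4), of f] by auto
  ultimately have "circ en (insert f (P' \<union> Q))" 
    using Cons assms by (intro circI[of en f w x]) auto
  then show ?thesis using Cons by simp
qed (use assms in auto)

lemma circ_degree:
  assumes "circ en C" "f \<in> C" "x \<in> en f"
  shows "en f = {x} \<or> (\<exists>g\<in>C. g \<noteq> f \<and> x \<in> en g)"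
proof -
  obtain a b N where *: "en f = {a, b}" "pth en a N (C - {f}) b" using circ_rotate[OF assms(1,2)] by blast
  show ?thesis
  proof (cases "a = b")
    case True
    then show ?thesis using * assms by auto
  next
    case False
    obtain g h where "g \<in> C - {f}" "a \<in> en g" "h \<in> C - {f}" "b \<in> en h"
      using pth_start_edge[OF *(2) False] pth_start_edge[OF pth_rev[OF *(2)] False[symmetric]] by metis
    then show ?thesis using *(1) assms(3) by auto
  qed
qed

text \<open>At the start node \<open>x\<close> of a path there is only its first edge, a link, while
  a circle through that edge needs a second edge at \<open>x\<close>. So the first edge can be
  stripped off.\<close>

lemma circ_not_in_pth: "pth en x N P y \<Longrightarrow> circ en C \<Longrightarrow> \<not> C \<subseteq> P"
proof (induction rule: pth.induct)
  case (Nil x)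
  then show ?case using circ_nonempty by blast
next
  case (Cons f x y N P z)
  have "y \<in> N" using pth_endpoints[OF Cons.hyps(2)] by simp
  have "\<not> C \<subseteq> P" using Cons by blast
  moreover have False if "f \<in> C" "C \<subseteq> insert f P"
  proof -
    have "en f \<noteq> {x}" "x \<in> en f" using Cons.hyps \<open>y \<in> N\<close> by auto
    then obtain g where "g \<in> C" "g \<noteq> f" "x \<in> en g"
      using circ_degree[OF Cons.prems \<open>f \<in> C\<close>, of x] by blast
    then show False using that pth_ends[OF Cons.hyps(2), of g] Cons.hyps by auto
  qed
  ultimately show ?case by blast
qed

lemma circ_nested: "circ en C \<Longrightarrow> circ en C' \<Longrightarrow> C \<subseteq> C' \<Longrightarrow> C = C'"
proof (rule ccontr)
  assume "circ en C" "circ en C'" "C \<subseteq> C'" "C \<noteq> C'"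
  then obtain g where "g \<in> C'" "C \<subseteq> C' - {g}" by blast
  then show False
    using circ_rotate[OF \<open>circ en C'\<close>] circ_not_in_pth[OF _ \<open>circ en C\<close>] by blast
qed

lemma circ_image:
  assumes "circ en C" "\<And>f. f \<in> C \<Longrightarrow> en' (h f) = \<phi> ` en f" "inj_on \<phi> (\<Union> (en ` C))" "inj_on h C"
  shows "circ en' (h ` C)"
proof -
  obtain f x y N P where *: "en f = {x, y}" "f \<notin> P" "pth en x N P y" "C = insert f P"
    using assms(1) by (auto simp: circ_def)
  have "N \<subseteq> \<Union> (en ` C)" using pth_nodes[OF *(3)] * by auto
  then have "pth en' (\<phi> x) (\<phi> ` N) (h ` P) (\<phi> y)"
    using * assms by (intro pth_image) (auto intro: inj_on_subset)
  moreover have "h f \<notin> h ` P" using * assms(4) by auto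
  ultimately have "circ en' (insert (h f) (h ` P))"
    using assms(2)[of f] * by (intro circI[of _ _ "\<phi> x" "\<phi> y"]) auto
  then show ?thesis using * by simp
qed

lemma circ_map:
  assumes "circ en C" "\<And>f. f \<in> C \<Longrightarrow> en' (h f) = en f" "inj_on h C"
  shows "circ en' (h ` C)"
  using circ_image[of en C en' h id] assms by simp

section \<open>Circles of theta graphs\<close>

definition theta_paths ::
  "('a \<Rightarrow> 'v set) \<Rightarrow> 'v \<Rightarrow> 'v \<Rightarrow> 'v set \<Rightarrow> 'a set \<Rightarrow> 'v set \<Rightarrow> 'a set \<Rightarrow> 'v set \<Rightarrow> 'a set \<Rightarrow> bool" where
  "theta_paths en x y N1 P1 N2 P2 N3 P3 \<longleftrightarrow> x \<noteq> y \<and>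
     pth en x N1 P1 y \<and> pth en x N2 P2 y \<and> pth en x N3 P3 y \<and>
     N1 \<inter> N2 = {x, y} \<and> N1 \<inter> N3 = {x, y} \<and> N2 \<inter> N3 = {x, y} \<and>
     P1 \<inter> P2 = {} \<and> P1 \<inter> P3 = {} \<and> P2 \<inter> P3 = {}"

lemma theta_paths_rotate:
  "theta_paths en x y N1 P1 N2 P2 N3 P3 \<Longrightarrow> theta_paths en x y N2 P2 N3 P3 N1 P1"
  unfolding theta_paths_def by (auto simp: Int_commute)

lemma theta_paths_swap:
  "theta_paths en x y N1 P1 N2 P2 N3 P3 \<Longrightarrow> theta_paths en x y N2 P2 N1 P1 N3 P3"
  unfolding theta_paths_def by (auto simp: Int_commute)

lemma theta_paths_reverse:
  "theta_paths en x y N1 P1 N2 P2 N3 P3 \<Longrightarrow> theta_paths en y x N1 P1 N2 P2 N3 P3"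
  unfolding theta_paths_def by (auto simp: insert_commute intro: pth_rev)

lemma theta_paths_circ:
  "theta_paths en x y N1 P1 N2 P2 N3 P3 \<Longrightarrow> circ en (P1 \<union> P2)"
  unfolding theta_paths_def by (auto intro: circ_join)

text \<open>At an inner node of the path the circle has to use two edges, and only the two path
  edges there are available. Membership in \<open>C\<close> thus passes from each edge of the path
  to the next.\<close>

lemma circ_all_or_none:
  assumes "circ en C"
  shows "pth en x N P y \<Longrightarrow> (\<And>w g. w \<in> N - {x, y} \<Longrightarrow> g \<in> C \<Longrightarrow> w \<in> en g \<Longrightarrow> g \<in> P) \<Longrightarrow>
     P \<subseteq> C \<or> P \<inter> C = {}"
proof (induction rule: pth.induct)
  case (Cons f x w N P y)
  have f: "en f = {x, w}" and P: "pth en w N P y" and xN: "x \<notin> N" by (fact Cons.hyps)+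
  have fP: "f \<notin> P" using pth_ends[OF P] f xN by auto
  have wN: "w \<in> N" "y \<in> N" using pth_endpoints[OF P] by auto
  have "g \<in> P" if "z \<in> N - {w, y}" "g \<in> C" "z \<in> en g" for z g
  proof -
    have "g \<in> insert f P" using Cons.prems[of z g] that xN by auto
    moreover have "g \<noteq> f" using that f xN by auto
    ultimately show ?thesis by simp
  qed
  then have IH: "P \<subseteq> C \<or> P \<inter> C = {}" using Cons.IH by blast
  show ?case
  proof (cases "w = y")
    case True
    then show ?thesis using P pth_closed by fastforce
  next
    case False
    then obtain f' where f': "f' \<in> P" "w \<in> en f'" "\<And>g. g \<in> P \<Longrightarrow> w \<in> en g \<Longrightarrow> g = f'"
      using pth_start_edge[OF P False] by metis
    have w: "w \<in> insert x N - {x, y}" using wN xN False by auto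
    have "f' \<in> C" if fC: "f \<in> C"
    proof -
      have "en f \<noteq> {w}" "w \<in> en f" using f wN xN by auto
      then obtain g where g: "g \<in> C" "g \<noteq> f" "w \<in> en g"
        using circ_degree[OF assms fC, of w] by blast
      then have "g \<in> P" using Cons.prems[OF w g(1,3)] by simp
      then show ?thesis using f'(3)[of g] g by simp
    qed
    moreover have "f \<in> C" if fC: "f' \<in> C"
    proof -
      have "en f' \<noteq> {w}" using pth_link[OF P f'(1)] by auto
      then obtain g where g: "g \<in> C" "g \<noteq> f'" "w \<in> en g"
        using circ_degree[OF assms fC f'(2)] by blast
      then have "g \<in> insert f P" "g \<notin> P" using Cons.prems[OF w g(1,3)] f'(3)[of g] by auto
      then show ?thesis using g by simp
    qed
    ultimately show ?thesis using IH f'(1) by blast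
  qed
qed simp

text \<open>Each of the three paths is contained in \<open>C\<close> or disjoint from it. One path
  alone contains no circle, and all three together properly contain the circle
  \<open>P1 \<union> P2\<close>, so exactly two remain.\<close>

lemma circ_in_theta:
  assumes "theta_paths en x y N1 P1 N2 P2 N3 P3" "circ en C" "C \<subseteq> P1 \<union> P2 \<union> P3"
  shows "C = P1 \<union> P2 \<or> C = P1 \<union> P3 \<or> C = P2 \<union> P3"
proof -
  have all: "P1 \<subseteq> C \<or> P1 \<inter> C = {}"
    if th: "theta_paths en x y N1 P1 N2 P2 N3 P3" and sub: "C \<subseteq> P1 \<union> P2 \<union> P3"
    for N1 P1 N2 P2 N3 P3
  proof (rule circ_all_or_none[OF assms(2)])
    show "pth en x N1 P1 y" using th by (simp add: theta_paths_def)
    show "g \<in> P1" if "w \<in> N1 - {x, y}" "g \<in> C" "w \<in> en g" for w g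
      using that th sub pth_ends[of en x N2 P2 y g] pth_ends[of en x N3 P3 y g]
      unfolding theta_paths_def by blast
  qed
  note D = assms(1)[unfolded theta_paths_def]
  note th1 = assms(1) and th2 = theta_paths_rotate[OF assms(1)]
    and th3 = theta_paths_rotate[OF theta_paths_rotate[OF assms(1)]]
  have 1: "P1 \<subseteq> C \<or> P1 \<inter> C = {}" using all[OF th1] assms(3) by auto
  have 2: "P2 \<subseteq> C \<or> P2 \<inter> C = {}" using all[OF th2] assms(3) by auto
  have 3: "P3 \<subseteq> C \<or> P3 \<inter> C = {}" using all[OF th3] assms(3) by auto
  have not1: "\<not> C \<subseteq> P1" "\<not> C \<subseteq> P2" "\<not> C \<subseteq> P3"
    using D circ_not_in_pth[OF _ assms(2)] by blast+
  have "P3 \<noteq> {}" "P1 \<inter> P3 = {}" "P2 \<inter> P3 = {}"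
    using D pth_closed[of en x N3 P3 y] by auto
  then have "\<not> (P1 \<union> P2 \<union> P3 \<subseteq> C)"
    using circ_nested[OF theta_paths_circ[OF assms(1)] assms(2)] by blast
  then show ?thesis using 1 2 3 not1 assms(3) by blast
qed

section \<open>Biased expansions in terms of path sets\<close>

lemma is_path_single: "is_path G vs [] \<longleftrightarrow> (\<exists>x\<in>nodes G. vs = [x])"
  by (auto simp: is_path_def length_Suc_conv)

lemma is_path_Cons:
  "is_path G (a # vs) (f # es) \<longleftrightarrow> a \<in> nodes G \<and> a \<notin> set vs \<and> f \<in> edges G \<and>
     ends G f = {a, hd vs} \<and> is_path G vs es"
proof -
  have *: "(\<forall>i<length (f # es). ends G ((f # es) ! i) = {(a # vs) ! i, (a # vs) ! Suc i}) \<longleftrightarrow>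
    ends G f = {a, vs ! 0} \<and> (\<forall>i<length es. ends G (es ! i) = {vs ! i, vs ! Suc i})"
    by (simp add: All_less_Suc2)
  have "hd vs = vs ! 0" if "length vs = Suc (length es)"
    using that by (intro hd_conv_nth) auto
  then show ?thesis unfolding is_path_def * by auto
qed

lemma is_path_pth:
  "is_path G vs es \<Longrightarrow> pth (ends G) (hd vs) (set vs) (set es) (last vs) \<and> distinct es"
proof (induction es arbitrary: vs)
  case Nil
  then show ?case by (auto simp: is_path_single pth.Nil)
next
  case (Cons f es)
  then obtain a us where vs: "vs = a # us" by (cases vs) (auto simp: is_path_def)
  then have us: "is_path G us es" "ends G f = {a, hd us}" "a \<notin> set us"
    using Cons.prems by (auto simp: is_path_Cons)
  then have "us \<noteq> []" by (auto simp: is_path_def)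
  have "f \<notin> set es" using Cons.IH[OF us(1)] pth_ends[of "ends G" "hd us" "set us" "set es"] us by blast
  then show ?case using Cons.IH[OF us(1)] us \<open>us \<noteq> []\<close> vs
    by (auto intro: pth.Cons)
qed

lemma pth_is_path:
  "pth (ends G) x N P y \<Longrightarrow> N \<subseteq> nodes G \<Longrightarrow> P \<subseteq> edges G \<Longrightarrow>
     \<exists>vs es. is_path G vs es \<and> hd vs = x \<and> last vs = y \<and> set vs = N \<and> set es = P"
proof (induction rule: pth.induct)
  case (Nil x)
  then show ?case by (intro exI[of _ "[x]"] exI[of _ "[]"]) (auto simp: is_path_single)
next
  case (Cons f x w N P y)
  then obtain vs es where *: "is_path G vs es" "hd vs = w" "last vs = y" "set vs = N" "set es = P"
    by auto
  then have "vs \<noteq> []" by (auto simp: is_path_def)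
  then show ?case using * Cons
    by (intro exI[of _ "x # vs"] exI[of _ "f # es"]) (auto simp: is_path_Cons)
qed

text \<open>The modulus affects only the last edge, whose second end has index
  \<open>Suc (length es)\<close> and wraps to 0. Without that edge the cyclic condition is the
  linear one of \<open>is_path\<close>.\<close>

lemma circle_word_snoc:
  "circle_word G (es @ [f]) \<longleftrightarrow>
     (\<exists>vs. is_path G vs es \<and> f \<in> edges G \<and> f \<notin> set es \<and> ends G f = {hd vs, last vs})"
proof -
  have *: "(\<forall>i<length (es @ [f]). ends G ((es @ [f]) ! i) = {vs ! i, vs ! (Suc i mod length (es @ [f]))})
     \<longleftrightarrow> (\<forall>i<length es. ends G (es ! i) = {vs ! i, vs ! Suc i}) \<and> ends G f = {hd vs, last vs}"
    if "length vs = Suc (length es)" for vs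
  proof -
    have "vs \<noteq> []" using that by auto
    then have "hd vs = vs ! 0" "last vs = vs ! length es"
      using that by (auto simp: hd_conv_nth last_conv_nth)
    moreover have "Suc i mod Suc (length es) = Suc i" if "i < length es" for i using that by simp
    ultimately show ?thesis
      by (simp add: All_less_Suc nth_append insert_commute conj_commute cong: conj_cong imp_cong)
  qed
  show ?thesis
  proof
    assume "circle_word G (es @ [f])"
    then obtain vs where "length vs = Suc (length es)" "distinct vs" "set vs \<subseteq> nodes G"
       "(\<forall>i<length (es @ [f]). ends G ((es @ [f]) ! i) = {vs ! i, vs ! (Suc i mod length (es @ [f]))})"
       "distinct (es @ [f])" "set (es @ [f]) \<subseteq> edges G"
      by (auto simp: circle_word_def)
    moreover from this *[of vs] have "(\<forall>i<length es. ends G (es ! i) = {vs ! i, vs ! Suc i}) \<and> ends G f = {hd vs, last vs}"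
      by blast
    ultimately show "\<exists>vs. is_path G vs es \<and> f \<in> edges G \<and> f \<notin> set es \<and> ends G f = {hd vs, last vs}"
      by (intro exI[of _ vs]) (simp add: is_path_def)
  next
    assume "\<exists>vs. is_path G vs es \<and> f \<in> edges G \<and> f \<notin> set es \<and> ends G f = {hd vs, last vs}"
    then obtain vs where vs: "is_path G vs es" "f \<in> edges G" "f \<notin> set es" "ends G f = {hd vs, last vs}"
      by blast
    then have len: "length vs = Suc (length es)" by (simp add: is_path_def)
    have "distinct es" using is_path_pth[OF vs(1)] by simp
    then show "circle_word G (es @ [f])"
      unfolding circle_word_def using vs *[OF len] by (auto simp: is_path_def)
  qed
qed

lemma pth_nodes_graph:
  assumes "is_graph G" "pth (ends G) x N P y" "P \<subseteq> edges G" "x \<in> nodes G"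
  shows "N \<subseteq> nodes G"
  using pth_nodes[OF assms(2)] assms by (fastforce simp: is_graph_def)

lemma circle_word_imp_circ:
  assumes "circle_word G (es @ [f])"
  shows "circ (ends G) (set (es @ [f]))" "set (es @ [f]) \<subseteq> edges G" "f \<notin> set es" "distinct es"
proof -
  obtain vs where *: "is_path G vs es" "f \<in> edges G" "f \<notin> set es" "ends G f = {hd vs, last vs}"
    using assms unfolding circle_word_snoc by blast
  then show "circ (ends G) (set (es @ [f]))"
    using circI[OF *(4,3) conjunct1[OF is_path_pth[OF *(1)]]] by simp
  show "set (es @ [f]) \<subseteq> edges G" "f \<notin> set es" "distinct es"
    using * is_path_pth[OF *(1)] by (auto simp: is_path_def)
qed

text \<open>The edge \<open>c\<close> can be chosen freely because a circle can be rotated; circle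
  lifting in word form treats the last edge differently from the others.\<close>

lemma circ_imp_circle_word:
  assumes "is_graph G" "circ (ends G) C" "C \<subseteq> edges G" "c \<in> C"
  shows "\<exists>es. circle_word G (es @ [c]) \<and> set es = C - {c}"
proof -
  obtain a b N where *: "ends G c = {a, b}" "pth (ends G) a N (C - {c}) b"
    using circ_rotate[OF assms(2,4)] by blast
  have "a \<in> nodes G" using assms *(1) by (auto simp: is_graph_def)
  then have "N \<subseteq> nodes G" using pth_nodes_graph[OF assms(1) *(2)] assms(3) by blast
  then obtain vs es where "is_path G vs es" "hd vs = a" "last vs = b" "set es = C - {c}"
    using pth_is_path[OF *(2)] assms(3) by blast
  then have "circle_word G (es @ [c])" unfolding circle_word_snoc using * assms(3,4) by auto
  then show ?thesis using \<open>set es = C - {c}\<close> by blast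
qed

lemma is_circle_circ:
  assumes "is_circle G C"
  shows "C \<subseteq> edges G" "circ (ends G) C"
proof -
  obtain es where es: "circle_word G es" "set es = C" using assms by (auto simp: is_circle_def)
  then have "es = butlast es @ [last es]" by (auto simp: circle_word_def)
  then show "C \<subseteq> edges G" "circ (ends G) C" using circle_word_imp_circ es by metis+
qed

lemma is_circle_iff:
  assumes "is_graph G"
  shows "is_circle G C \<longleftrightarrow> C \<subseteq> edges G \<and> circ (ends G) C"
proof
  assume "is_circle G C"
  then show "C \<subseteq> edges G \<and> circ (ends G) C" using is_circle_circ[of G C] by simp
next
  assume *: "C \<subseteq> edges G \<and> circ (ends G) C"
  then obtain c where "c \<in> C" using circ_nonempty by blast
  then obtain es where es: "circle_word G (es @ [c])" "set es = C - {c}"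
    using circ_imp_circle_word[OF assms] * by blast
  then have "set (es @ [c]) = C" using \<open>c \<in> C\<close> by auto
  then show "is_circle G C" unfolding is_circle_def using es(1) by blast
qed

lemma is_theta_iff:
  assumes "is_graph G"
  shows "is_theta G \<Theta> \<longleftrightarrow> (\<exists>x y N1 P1 N2 P2 N3 P3. theta_paths (ends G) x y N1 P1 N2 P2 N3 P3 \<and>
    P1 \<union> P2 \<union> P3 \<subseteq> edges G \<and> \<Theta> = P1 \<union> P2 \<union> P3)"
proof -
  have all3: "(\<forall>i<3. Q i) \<longleftrightarrow> Q 0 \<and> Q 1 \<and> Q (2::nat)" for Q
    by (auto simp: numeral_3_eq_3 numeral_2_eq_2 less_Suc_eq)
  have un3: "(\<Union>i<3. Q i) = Q 0 \<union> Q 1 \<union> Q (2::nat)" for Q :: "nat \<Rightarrow> 'x set"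
    by (auto simp: numeral_3_eq_3 numeral_2_eq_2 less_Suc_eq)
  show ?thesis
  proof
    assume "is_theta G \<Theta>"
    then obtain u v vs es where *: "u \<noteq> v"
        "\<forall>i<3. is_path G (vs i) (es i) \<and> hd (vs i) = u \<and> last (vs i) = v"
        "\<forall>i<3. \<forall>j<3. i \<noteq> j \<longrightarrow> set (vs i) \<inter> set (vs j) = {u, v} \<and> set (es i) \<inter> set (es j) = {}"
        "\<Theta> = (\<Union>i<(3::nat). set (es i))"
      unfolding is_theta_def by blast
    have p: "pth (ends G) u (set (vs i)) (set (es i)) v \<and> set (es i) \<subseteq> edges G" if "i < 3" for i
      using *(2) that is_path_pth[of G "vs i" "es i"] by (auto simp: is_path_def)
    have "theta_paths (ends G) u v (set (vs 0)) (set (es 0)) (set (vs 1)) (set (es 1)) (set (vs 2)) (set (es 2))"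
      unfolding theta_paths_def using *(1,3) p by simp
    moreover have "\<Theta> = set (es 0) \<union> set (es 1) \<union> set (es 2)" using *(4) un3 by metis
    moreover have "set (es 0) \<union> set (es 1) \<union> set (es 2) \<subseteq> edges G" using p by auto
    ultimately show "\<exists>x y N1 P1 N2 P2 N3 P3. theta_paths (ends G) x y N1 P1 N2 P2 N3 P3 \<and>
      P1 \<union> P2 \<union> P3 \<subseteq> edges G \<and> \<Theta> = P1 \<union> P2 \<union> P3" by blast
  next
    assume "\<exists>x y N1 P1 N2 P2 N3 P3. theta_paths (ends G) x y N1 P1 N2 P2 N3 P3 \<and>
      P1 \<union> P2 \<union> P3 \<subseteq> edges G \<and> \<Theta> = P1 \<union> P2 \<union> P3"
    then obtain x y N1 P1 N2 P2 N3 P3 where th: "theta_paths (ends G) x y N1 P1 N2 P2 N3 P3"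
      and sub: "P1 \<union> P2 \<union> P3 \<subseteq> edges G" and \<Theta>: "\<Theta> = P1 \<union> P2 \<union> P3" by blast
    have path: "\<exists>vs es. is_path G vs es \<and> hd vs = x \<and> last vs = y \<and> set vs = N \<and> set es = P"
      if P: "pth (ends G) x N P y" "P \<subseteq> edges G" for N P
    proof (rule pth_is_path[OF P(1) _ P(2)])
      have "x \<noteq> y" using th by (simp add: theta_paths_def)
      then obtain f where "f \<in> P" "x \<in> ends G f" using pth_start_edge[OF P(1)] by metis
      then have "x \<in> nodes G" using assms P(2) by (auto simp: is_graph_def)
      then show "N \<subseteq> nodes G" using pth_nodes_graph[OF assms P] by simp
    qed
    obtain vs0 es0 where 0: "is_path G vs0 es0" "hd vs0 = x" "last vs0 = y" "set vs0 = N1" "set es0 = P1"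
      using path[of N1 P1] th sub unfolding theta_paths_def by auto
    obtain vs1 es1 where 1: "is_path G vs1 es1" "hd vs1 = x" "last vs1 = y" "set vs1 = N2" "set es1 = P2"
      using path[of N2 P2] th sub unfolding theta_paths_def by auto
    obtain vs2 es2 where 2: "is_path G vs2 es2" "hd vs2 = x" "last vs2 = y" "set vs2 = N3" "set es2 = P3"
      using path[of N3 P3] th sub unfolding theta_paths_def by auto
    show "is_theta G \<Theta>"
      unfolding is_theta_def all3 un3
      by (rule exI[of _ x], rule exI[of _ y],
          rule exI[of _ "\<lambda>i. if i = 0 then vs0 else if i = 1 then vs1 else vs2"],
          rule exI[of _ "\<lambda>i. if i = 0 then es0 else if i = 1 then es1 else es2"])
        (use 0 1 2 th \<Theta> in \<open>simp add: theta_paths_def Int_commute\<close>)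
  qed
qed

text \<open>This is the linear class condition: two balanced circles of a theta graph force the
  third. One implication is enough because the three paths may be permuted.\<close>

definition theta_closed :: "('a \<Rightarrow> 'v set) \<Rightarrow> 'a set \<Rightarrow> 'a set set \<Rightarrow> bool" where
  "theta_closed en E B \<longleftrightarrow> (\<forall>x y N1 P1 N2 P2 N3 P3. theta_paths en x y N1 P1 N2 P2 N3 P3 \<longrightarrow>
     P1 \<union> P2 \<union> P3 \<subseteq> E \<longrightarrow> P1 \<union> P2 \<in> B \<longrightarrow> P2 \<union> P3 \<in> B \<longrightarrow> P1 \<union> P3 \<in> B)"

lemma theta_closedD:
  "theta_closed en E B \<Longrightarrow> theta_paths en x y N1 P1 N2 P2 N3 P3 \<Longrightarrow> P1 \<union> P2 \<union> P3 \<subseteq> E \<Longrightarrow>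
     P1 \<union> P2 \<in> B \<Longrightarrow> P2 \<union> P3 \<in> B \<Longrightarrow> P1 \<union> P3 \<in> B"
  unfolding theta_closed_def by blast

text \<open>A theta graph has exactly three circles, and these are distinct. Hence "not exactly two
  balanced" means that any two balanced ones force the third.\<close>

lemma theta_closed_iff:
  assumes G: "is_graph G" and B: "\<And>C. C \<in> B \<Longrightarrow> circ (ends G) C"
  shows "(\<forall>\<Theta>. is_theta G \<Theta> \<longrightarrow> card {C \<in> B. C \<subseteq> \<Theta>} \<noteq> 2) \<longleftrightarrow> theta_closed (ends G) (edges G) B"
proof
  assume L: "\<forall>\<Theta>. is_theta G \<Theta> \<longrightarrow> card {C \<in> B. C \<subseteq> \<Theta>} \<noteq> 2"
  show "theta_closed (ends G) (edges G) B"
    unfolding theta_closed_def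
  proof (intro allI impI)
    fix x y N1 P1 N2 P2 N3 P3
    assume th: "theta_paths (ends G) x y N1 P1 N2 P2 N3 P3" and sub: "P1 \<union> P2 \<union> P3 \<subseteq> edges G"
      and 12: "P1 \<union> P2 \<in> B" and 23: "P2 \<union> P3 \<in> B"
    show "P1 \<union> P3 \<in> B"
    proof (rule ccontr)
      assume 13: "P1 \<union> P3 \<notin> B"
      have "C = P1 \<union> P2 \<or> C = P2 \<union> P3" if "C \<in> B" "C \<subseteq> P1 \<union> P2 \<union> P3" for C
        using circ_in_theta[OF th B[OF that(1)] that(2)] 13 that(1) by blast
      then have "{C \<in> B. C \<subseteq> P1 \<union> P2 \<union> P3} = {P1 \<union> P2, P2 \<union> P3}"
        using 12 23 by blast
      moreover have "P1 \<noteq> {}" "P1 \<inter> P2 = {}" "P1 \<inter> P3 = {}"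
        using th pth_closed[of "ends G" x N1 P1 y] by (auto simp: theta_paths_def)
      then have "P1 \<union> P2 \<noteq> P2 \<union> P3" by blast
      ultimately have "card {C \<in> B. C \<subseteq> P1 \<union> P2 \<union> P3} = 2" by simp
      moreover have "is_theta G (P1 \<union> P2 \<union> P3)"
        unfolding is_theta_iff[OF G] by (intro exI conjI, rule th, rule sub, rule refl)
      ultimately show False using L[rule_format, of "P1 \<union> P2 \<union> P3"] by argo
    qed
  qed
next
  assume R: "theta_closed (ends G) (edges G) B"
  show "\<forall>\<Theta>. is_theta G \<Theta> \<longrightarrow> card {C \<in> B. C \<subseteq> \<Theta>} \<noteq> 2"
  proof (intro allI impI notI)
    fix \<Theta> assume \<Theta>: "is_theta G \<Theta>" and card: "card {C \<in> B. C \<subseteq> \<Theta>} = 2"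
    then obtain x y N1 P1 N2 P2 N3 P3 where th: "theta_paths (ends G) x y N1 P1 N2 P2 N3 P3"
      and sub: "P1 \<union> P2 \<union> P3 \<subseteq> edges G" and \<Theta>: "\<Theta> = P1 \<union> P2 \<union> P3"
      using \<Theta> unfolding is_theta_iff[OF G] by (elim exE conjE) (rule that)
    obtain C D where CD: "{C \<in> B. C \<subseteq> \<Theta>} = {C, D}" "C \<noteq> D" using card card_2_iff by metis
    have C: "C \<in> B" "C \<subseteq> \<Theta>" and D: "D \<in> B" "D \<subseteq> \<Theta>" using CD by auto
    have nonempty: "P1 \<noteq> {}" "P2 \<noteq> {}" "P3 \<noteq> {}" and disj: "P1 \<inter> P2 = {}" "P1 \<inter> P3 = {}" "P2 \<inter> P3 = {}"
      using th pth_closed[of "ends G" x N1 P1 y] pth_closed[of "ends G" x N2 P2 y]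
        pth_closed[of "ends G" x N3 P3 y] by (auto simp: theta_paths_def)
    have distinct: "P1 \<union> P2 \<noteq> P1 \<union> P3" "P1 \<union> P2 \<noteq> P2 \<union> P3" "P1 \<union> P3 \<noteq> P2 \<union> P3"
      using nonempty disj by blast+
    have third: False if "X \<in> B" "X \<subseteq> \<Theta>" "X \<noteq> C" "X \<noteq> D" for X
      using CD(1) that by blast
    have "P1 \<union> P2 \<in> B \<Longrightarrow> P2 \<union> P3 \<in> B \<Longrightarrow> P1 \<union> P3 \<in> B"
      using theta_closedD[OF R th sub] by blast
    moreover have "P2 \<union> P1 \<in> B \<Longrightarrow> P1 \<union> P3 \<in> B \<Longrightarrow> P2 \<union> P3 \<in> B"
      using theta_closedD[OF R theta_paths_swap[OF th]] sub by blast
    moreover have "P2 \<union> P3 \<in> B \<Longrightarrow> P3 \<union> P1 \<in> B \<Longrightarrow> P2 \<union> P1 \<in> B"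
      using theta_closedD[OF R theta_paths_rotate[OF th]] sub by blast
    moreover have "C = P1 \<union> P2 \<or> C = P1 \<union> P3 \<or> C = P2 \<union> P3" "D = P1 \<union> P2 \<or> D = P1 \<union> P3 \<or> D = P2 \<union> P3"
      using circ_in_theta[OF th B] C D unfolding \<Theta> by blast+
    ultimately have "P1 \<union> P2 \<in> B" "P1 \<union> P3 \<in> B" "P2 \<union> P3 \<in> B"
      using C(1) D(1) CD(2) by (auto simp: Un_commute)
    then show False using third[of "P1 \<union> P2"] third[of "P1 \<union> P3"] third[of "P2 \<union> P3"] distinct \<Theta>
      by blast
  qed
qed

text \<open>
  A biased expansion without its nodes: \<open>E, B, en\<close> are the edges, balanced circles and ends of
  \<open>\<Omega>\<close>, and \<open>D, ed\<close> the edges and ends of \<open>\<Delta>\<close>. In contrast to the word form of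
  circle lifting, \<open>lifting\<close> does not single out a last edge.
\<close>

locale expansion =
  fixes E :: "'a set" and B :: "'a set set" and p :: "'a \<Rightarrow> 'd" and en :: "'a \<Rightarrow> 'v set"
    and D :: "'d set" and ed :: "'d \<Rightarrow> 'v set"
  assumes surj: "p ` E = D"
    and ends_proj: "f \<in> E \<Longrightarrow> en f = ed (p f)"
    and bal_edges: "C \<in> B \<Longrightarrow> C \<subseteq> E"
    and bal_circ: "C \<in> B \<Longrightarrow> circ en C"
    and theta: "theta_closed en E B"
    and no_digon: "f \<in> E \<Longrightarrow> g \<in> E \<Longrightarrow> f \<noteq> g \<Longrightarrow> p f = p g \<Longrightarrow> {f, g} \<notin> B"
    and lifting: "circ ed K \<Longrightarrow> K \<subseteq> D \<Longrightarrow> c \<in> K \<Longrightarrow> F \<subseteq> E \<Longrightarrow> bij_betw p F (K - {c}) \<Longrightarrow>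
      \<exists>!f. f \<in> E \<and> p f = c \<and> insert f F \<in> B"

text \<open>A circle word can be rotated so that any given edge comes last. Its other edges are
  distinct, so a word of lifts carries the same information as a set of lifts on which
  \<open>p\<close> is injective.\<close>

lemma circle_lifting_iff:
  assumes D: "is_graph \<Delta>"
  shows "circle_lifting \<Omega> p \<Delta> \<longleftrightarrow> (\<forall>C c F. circ (ends \<Delta>) C \<longrightarrow> C \<subseteq> edges \<Delta> \<longrightarrow> c \<in> C \<longrightarrow>
    F \<subseteq> edges \<Omega> \<longrightarrow> bij_betw p F (C - {c}) \<longrightarrow> (\<exists>!f. f \<in> edges \<Omega> \<and> p f = c \<and> insert f F \<in> balanced \<Omega>))"
proof
  assume L: "circle_lifting \<Omega> p \<Delta>"
  show "\<forall>C c F. circ (ends \<Delta>) C \<longrightarrow> C \<subseteq> edges \<Delta> \<longrightarrow> c \<in> C \<longrightarrow>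
    F \<subseteq> edges \<Omega> \<longrightarrow> bij_betw p F (C - {c}) \<longrightarrow> (\<exists>!f. f \<in> edges \<Omega> \<and> p f = c \<and> insert f F \<in> balanced \<Omega>)"
  proof (intro allI impI)
    fix C c F assume C: "circ (ends \<Delta>) C" "C \<subseteq> edges \<Delta>" "c \<in> C" and F: "F \<subseteq> edges \<Omega>"
      and bij: "bij_betw p F (C - {c})"
    obtain es where es: "circle_word \<Delta> (es @ [c])" "set es = C - {c}"
      using circ_imp_circle_word[OF D C] by blast
    let ?fs = "map (inv_into F p) es"
    have inv: "bij_betw (inv_into F p) (C - {c}) F" using bij by (rule bij_betw_inv_into)
    then have set: "set ?fs = F" using es(2) by (simp add: bij_betw_def)
    have "inv_into F p d \<in> fiber \<Omega> p d" if "d \<in> set es" for d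
    proof -
      have "d \<in> p ` F" using that bij es(2) by (simp add: bij_betw_def)
      then show ?thesis using F by (auto simp: fiber_def f_inv_into_f inv_into_into subset_iff)
    qed
    then have "list_all2 (\<lambda>f e'. f \<in> fiber \<Omega> p e') ?fs es"
      by (simp add: list_all2_map1 list_all2_same)
    then have "\<exists>!f. f \<in> fiber \<Omega> p c \<and> insert f F \<in> balanced \<Omega>"
      using L es(1) set unfolding circle_lifting_def by metis
    then show "\<exists>!f. f \<in> edges \<Omega> \<and> p f = c \<and> insert f F \<in> balanced \<Omega>"
      by (simp add: fiber_def conj_assoc)
  qed
next
  assume R: "\<forall>C c F. circ (ends \<Delta>) C \<longrightarrow> C \<subseteq> edges \<Delta> \<longrightarrow> c \<in> C \<longrightarrow>
    F \<subseteq> edges \<Omega> \<longrightarrow> bij_betw p F (C - {c}) \<longrightarrow> (\<exists>!f. f \<in> edges \<Omega> \<and> p f = c \<and> insert f F \<in> balanced \<Omega>)"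
  show "circle_lifting \<Omega> p \<Delta>"
    unfolding circle_lifting_def
  proof (intro allI impI)
    fix es c fs assume w: "circle_word \<Delta> (es @ [c])" and fs: "list_all2 (\<lambda>f e'. f \<in> fiber \<Omega> p e') fs es"
    note c = circle_word_imp_circ[OF w]
    have "map p fs = es" "set fs \<subseteq> edges \<Omega>" using fs
      by (induction fs es rule: list_all2_induct) (auto simp: fiber_def)
    then have "bij_betw p (set fs) (set es)"
      using c(4) distinct_map[of p fs] by (auto simp: bij_betw_def)
    moreover have "set (es @ [c]) - {c} = set es" using c(3) by auto
    ultimately have bij: "bij_betw p (set fs) (set (es @ [c]) - {c})" by (simp only:)
    have "c \<in> set (es @ [c])" by simp
    from R[rule_format, OF c(1,2) this \<open>set fs \<subseteq> edges \<Omega>\<close> bij]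
    have "\<exists>!f. f \<in> edges \<Omega> \<and> p f = c \<and> insert f (set fs) \<in> balanced \<Omega>" .
    then show "\<exists>!f. f \<in> fiber \<Omega> p c \<and> insert f (set fs) \<in> balanced \<Omega>"
      by (simp add: fiber_def conj_assoc)
  qed
qed

lemma biased_expansion_iff:
  "biased_expansion \<Omega> p \<Delta> \<longleftrightarrow> is_graph \<Delta> \<and> nodes \<Omega> = nodes \<Delta> \<and>
     expansion (edges \<Omega>) (balanced \<Omega>) p (ends \<Omega>) (edges \<Delta>) (ends \<Delta>)"
  (is "?L \<longleftrightarrow> ?R")
proof
  assume L: ?L
  then have G: "is_graph \<Omega>" "is_graph \<Delta>" by (simp_all add: biased_expansion_def is_biased_graph_def)
  have bal: "\<forall>C\<in>balanced \<Omega>. C \<subseteq> edges \<Omega> \<and> circ (ends \<Omega>) C"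
    using L is_circle_iff[OF G(1)] by (simp add: biased_expansion_def is_biased_graph_def)
  then have "theta_closed (ends \<Omega>) (edges \<Omega>) (balanced \<Omega>)"
    using L theta_closed_iff[OF G(1), of "balanced \<Omega>"] by (simp add: biased_expansion_def is_biased_graph_def)
  moreover have "p ` edges \<Omega> = edges \<Delta>" "nodes \<Omega> = nodes \<Delta>"
    "\<forall>f\<in>edges \<Omega>. ends \<Omega> f = ends \<Delta> (p f)"
    "\<forall>f\<in>edges \<Omega>. \<forall>g\<in>edges \<Omega>. f \<noteq> g \<and> p f = p g \<longrightarrow> {f, g} \<notin> balanced \<Omega>"
    "circle_lifting \<Omega> p \<Delta>"
    using L by (simp_all add: biased_expansion_def)
  ultimately show ?R
    using G(2) bal unfolding circle_lifting_iff[OF G(2)] expansion_def by simp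
next
  assume R: ?R
  then have D: "is_graph \<Delta>" by simp
  interpret expansion "edges \<Omega>" "balanced \<Omega>" p "ends \<Omega>" "edges \<Delta>" "ends \<Delta>" using R by simp
  \<comment> \<open>The locale knows no nodes; \<Omega> is a graph because its edges inherit their
    ends from \<Delta> along \<open>p\<close>.\<close>
  have "p f \<in> edges \<Delta>" if "f \<in> edges \<Omega>" for f using that surj by blast
  then have G: "is_graph \<Omega>" using R ends_proj unfolding is_graph_def by simp
  have "is_biased_graph \<Omega>"
    unfolding is_biased_graph_def
    using G bal_circ bal_edges theta theta_closed_iff[OF G, of "balanced \<Omega>"] is_circle_iff[OF G] by blast
  moreover have "circle_lifting \<Omega> p \<Delta>"
    unfolding circle_lifting_iff[OF D] using lifting by blast
  ultimately show ?L
    unfolding biased_expansion_def using R surj ends_proj no_digon D by blast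
qed

context expansion
begin

lemma proj_mem: "f \<in> E \<Longrightarrow> p f \<in> D"
  using surj by blast

lemma pth_proj:
  assumes "pth en x N P y" "P \<subseteq> E"
  shows "pth ed x N (p ` P) y" "inj_on p P"
proof -
  show "pth ed x N (p ` P) y"
    using assms ends_proj by (intro pth_map[OF assms(1)]) auto
  have "inj_on (ed \<circ> p) P"
    using pth_inj_ends[OF assms(1)] assms(2) ends_proj by (auto simp: inj_on_def subset_iff)
  then show "inj_on p P" by (rule inj_on_imageI2)
qed

text \<open>On a path, \<open>p\<close> is injective because the ends of the edges differ. If the
  closing edge \<open>f\<close> had the same image as a path edge \<open>g\<close>, the two would be
  parallel, the path would be \<open>g\<close> alone, and the circle would be a balanced digon in a
  fiber.\<close>

lemma bal_inj:
  assumes "C \<in> B"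
  shows "inj_on p C"
proof -
  obtain f x y N P where C: "en f = {x, y}" "f \<notin> P" "pth en x N P y" "C = insert f P"
    using bal_circ[OF assms] by (auto simp: circ_def)
  have CE: "C \<subseteq> E" using bal_edges[OF assms] .
  have "p f \<noteq> p g" if "g \<in> P" for g
  proof
    assume eq: "p f = p g"
    have fg: "f \<in> E" "g \<in> E" using CE C(4) that by auto
    then have "en g = {x, y}" using ends_proj[OF fg(1)] ends_proj[OF fg(2)] eq C(1) by simp
    then have "P = {g}" using pth_edge_between[OF C(3) that] by simp
    then show False using no_digon[OF fg _ eq] assms C(2,4) by simp
  qed
  then show ?thesis using pth_proj(2)[OF C(3)] CE C(4) by auto
qed

lemma bal_proj:
  assumes "C \<in> B"
  shows "circ ed (p ` C)" "p ` C \<subseteq> D"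
proof -
  show "circ ed (p ` C)"
    using bal_edges[OF assms] ends_proj bal_inj[OF assms] by (intro circ_map[OF bal_circ[OF assms]]) auto
  show "p ` C \<subseteq> D" using bal_edges[OF assms] proj_mem by auto
qed

lemma bal_not_link: "en f = {x, y} \<Longrightarrow> x \<noteq> y \<Longrightarrow> {f} \<notin> B"
  using circ_not_in_pth[OF pth_edge, of en f x y "{f}"] bal_circ[of "{f}"] by auto

lemma lift_exists:
  assumes "circ ed (insert d (p ` F))" "d \<in> D" "F \<subseteq> E" "inj_on p F" "d \<notin> p ` F"
  shows "\<exists>!f. f \<in> E \<and> p f = d \<and> insert f F \<in> B"
proof (rule lifting[OF assms(1)])
  show "insert d (p ` F) \<subseteq> D" using assms proj_mem by auto
  show "bij_betw p F (insert d (p ` F) - {d})" using assms(4,5) by (auto simp: bij_betw_def)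
qed (use assms in auto)

lemma lift_unique:
  assumes "insert f F \<in> B" "insert g F \<in> B" "p f = p g" "f \<notin> F"
  shows "f = g"
proof -
  have inj: "inj_on p (insert f F)" using bal_inj[OF assms(1)] .
  have FE: "insert f F \<subseteq> E" "g \<in> E" using bal_edges assms by auto
  have "\<exists>!h. h \<in> E \<and> p h = p f \<and> insert h F \<in> B"
    using bal_proj[OF assms(1)] FE inj assms(4) by (intro lift_exists) (auto simp: inj_on_def)
  then show ?thesis using assms FE by auto
qed

lemma closing_edge:
  assumes "pth en x N P y" "P \<subseteq> E" "ed d = {x, y}" "d \<in> D" "d \<notin> p ` P"
  shows "\<exists>!f. f \<in> E \<and> p f = d \<and> insert f P \<in> B"
  using circI[OF assms(3,5) pth_proj(1)[OF assms(1,2)]] assms pth_proj(2)[OF assms(1,2)]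
  by (intro lift_exists) auto

end

text \<open>The theta property of a single theta graph, stated for all three pairs of circles, so
  that a path crossing the cut may be assumed to be the third.\<close>

definition tri_closed :: "'a set set \<Rightarrow> 'a set \<Rightarrow> 'a set \<Rightarrow> 'a set \<Rightarrow> bool" where
  "tri_closed B P Q R \<longleftrightarrow> (P \<union> Q \<in> B \<longrightarrow> Q \<union> R \<in> B \<longrightarrow> P \<union> R \<in> B) \<and>
     (Q \<union> P \<in> B \<longrightarrow> P \<union> R \<in> B \<longrightarrow> Q \<union> R \<in> B) \<and> (P \<union> R \<in> B \<longrightarrow> R \<union> Q \<in> B \<longrightarrow> P \<union> Q \<in> B)"

lemma tri_closed_rotate: "tri_closed B P Q R \<Longrightarrow> tri_closed B R P Q"
  unfolding tri_closed_def by (auto simp: Un_commute)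

lemma theta_closed_tri:
  assumes "theta_closed en E B" "theta_paths en x y N1 P1 N2 P2 N3 P3" "P1 \<union> P2 \<union> P3 \<subseteq> E"
  shows "tri_closed B P1 P2 P3"
proof -
  have "P1 \<union> P2 \<in> B \<Longrightarrow> P2 \<union> P3 \<in> B \<Longrightarrow> P1 \<union> P3 \<in> B"
    using theta_closedD[OF assms] .
  moreover have "P2 \<union> P1 \<in> B \<Longrightarrow> P1 \<union> P3 \<in> B \<Longrightarrow> P2 \<union> P3 \<in> B"
    using theta_closedD[OF assms(1) theta_paths_swap[OF assms(2)]] assms(3) by blast
  moreover have "P2 \<union> P3 \<in> B \<Longrightarrow> P3 \<union> P1 \<in> B \<Longrightarrow> P2 \<union> P1 \<in> B"
    using theta_closedD[OF assms(1) theta_paths_rotate[OF assms(2)]] assms(3) by blast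
  ultimately show ?thesis unfolding tri_closed_def by (simp add: Un_commute)
qed

section \<open>Paths and circles across a cut of two nodes\<close>

lemma pth_split2:
  assumes P: "pth en x N P y" and uv: "u \<in> N" "v \<in> N" "u \<noteq> v"
  shows "\<exists>s t N1 P1 N2 P2 N3 P3. {s, t} = {u, v} \<and> pth en x N1 P1 s \<and> pth en s N2 P2 t \<and> pth en t N3 P3 y \<and>
    N = N1 \<union> N2 \<union> N3 \<and> P = P1 \<union> P2 \<union> P3 \<and> N1 \<inter> N2 = {s} \<and> N2 \<inter> N3 = {t} \<and> N1 \<inter> N3 = {}"
proof -
  have *: "\<exists>N1 P1 N2 P2 N3 P3. pth en x N1 P1 s \<and> pth en s N2 P2 t \<and> pth en t N3 P3 y \<and>
    N = N1 \<union> N2 \<union> N3 \<and> P = P1 \<union> P2 \<union> P3 \<and> N1 \<inter> N2 = {s} \<and> N2 \<inter> N3 = {t} \<and> N1 \<inter> N3 = {}"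
    if N1: "pth en x N1 P1 s" and R: "pth en s M R y" and N: "N = N1 \<union> M" and P: "P = P1 \<union> R"
      and int: "N1 \<inter> M = {s}" and t: "t \<in> M" "t \<noteq> s" for s t N1 P1 M R
  proof -
    obtain N2 P2 N3 P3 where 2: "pth en s N2 P2 t" and 3: "pth en t N3 P3 y" and M: "M = N2 \<union> N3"
      and 23: "N2 \<inter> N3 = {t}" and R': "R = P2 \<union> P3" by (rule pth_split[OF R t(1)])
    have s: "s \<in> N2" using pth_endpoints[OF 2] by simp
    have "s \<notin> N3" using s 23 t(2) by (metis IntI singletonD)
    then have "N1 \<inter> N2 = {s}" "N1 \<inter> N3 = {}" using int M s by auto
    moreover have "N = N1 \<union> N2 \<union> N3" "P = P1 \<union> P2 \<union> P3" using N P M R' by auto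
    ultimately show ?thesis using N1 2 3 23 by (intro exI conjI)
  qed
  obtain M1 Q1 M2 Q2 where M: "pth en x M1 Q1 u" "pth en u M2 Q2 y" "N = M1 \<union> M2" "M1 \<inter> M2 = {u}" "P = Q1 \<union> Q2"
    by (rule pth_split[OF P uv(1)])
  show ?thesis
  proof (cases "v \<in> M2")
    case True
    show ?thesis
      by (rule exI[of _ u], rule exI[of _ v])
        (use *[OF M(1,2,3,5,4) True uv(3)[symmetric]] in simp)
  next
    \<comment> \<open>Here the path reaches \<open>v\<close> before \<open>u\<close>. The stretch
      from \<open>v\<close> to \<open>u\<close> is joined to the rest from \<open>u\<close> on,
      which reduces this to the case that the second cut node follows the first.\<close>
    case False
    have "v \<in> M1" using uv False M by auto
    then obtain L1 S1 L2 S2 where L: "pth en x L1 S1 v" "pth en v L2 S2 u" "M1 = L1 \<union> L2" "L1 \<inter> L2 = {v}" "Q1 = S1 \<union> S2"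
      by (rule pth_split[OF M(1)])
    have u: "u \<in> L2" using pth_endpoints[OF L(2)] by simp
    have "L2 \<inter> M2 = {u}" using L(3) M(4) u by auto
    then have "pth en v (L2 \<union> M2) (S2 \<union> Q2) y" using pth_append[OF L(2) M(2)] by simp
    moreover have "L1 \<inter> (L2 \<union> M2) = {v}" using L(3,4) M(4) uv(3) u False by auto
    moreover have "N = L1 \<union> (L2 \<union> M2)" "P = S1 \<union> (S2 \<union> Q2)" using L M by auto
    ultimately have "\<exists>N1 P1 N2 P2 N3 P3. pth en x N1 P1 v \<and> pth en v N2 P2 u \<and> pth en u N3 P3 y \<and>
      N = N1 \<union> N2 \<union> N3 \<and> P = P1 \<union> P2 \<union> P3 \<and> N1 \<inter> N2 = {v} \<and> N2 \<inter> N3 = {u} \<and> N1 \<inter> N3 = {}"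
      using *[OF L(1), of "L2 \<union> M2" "S2 \<union> Q2" u] u uv(3) by simp
    then show ?thesis by (intro exI[of _ v] exI[of _ u]) (simp add: insert_commute)
  qed
qed

text \<open>Used for the base graphs, which share the single edge \<open>e\<close>, and again for
  the expanded graphs, which share a whole fiber; therefore any number of shared edges between
  \<open>u\<close> and \<open>v\<close> is allowed.\<close>

locale two_sum =
  fixes en :: "'a \<Rightarrow> 'v set" and E1 E2 :: "'a set" and V1 V2 :: "'v set" and u v :: 'v
  assumes uv: "u \<noteq> v" and V12: "V1 \<inter> V2 = {u, v}"
    and ends1: "f \<in> E1 \<Longrightarrow> en f \<subseteq> V1" and ends2: "f \<in> E2 \<Longrightarrow> en f \<subseteq> V2"
    and shared: "f \<in> E1 \<Longrightarrow> f \<in> E2 \<Longrightarrow> en f = {u, v}"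
begin

lemma swap: "two_sum en E2 E1 V2 V1 u v"
  using uv V12 ends1 ends2 shared by unfold_locales auto

lemma edge_side: "f \<in> E1 \<union> E2 \<Longrightarrow> x \<in> en f \<Longrightarrow> x \<in> V1 - {u, v} \<Longrightarrow> f \<in> E1 - E2"
  using ends2 V12 by blast

text \<open>A node of side 1 off the cut meets only edges of side 1. So the path stays on side 1
  until it reaches \<open>u\<close> or \<open>v\<close>, and there it has to stop.\<close>

lemma inner_path_side:
  "pth en x N P y \<Longrightarrow> P \<subseteq> E1 \<union> E2 \<Longrightarrow> x \<in> V1 - {u, v} \<Longrightarrow> N \<inter> {u, v} \<subseteq> {y} \<Longrightarrow> P \<subseteq> E1 - E2 \<and> y \<in> V1"
proof (induction rule: pth.induct)
  case (Cons f x w N P y)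
  have f: "f \<in> E1 - E2" using edge_side[of f x] Cons.prems Cons.hyps(1) by auto
  then have w: "w \<in> V1" using ends1[of f] Cons.hyps(1) by auto
  have wN: "w \<in> N" using pth_endpoints[OF Cons.hyps(2)] by simp
  show ?case
  proof (cases "w \<in> {u, v}")
    case True
    then have "w = y" using wN Cons.prems(3) by blast
    then have "P = {}" using pth_closed[OF Cons.hyps(2)] by simp
    then show ?thesis using f w \<open>w = y\<close> by simp
  next
    case False
    then have "P \<subseteq> E1 - E2 \<and> y \<in> V1" using Cons.IH Cons.prems w by auto
    then show ?thesis using f by simp
  qed
qed simp

text \<open>The start may be \<open>u\<close> or \<open>v\<close>, which says nothing about the
  side; the second node decides, because it is either the end \<open>y\<close> or lies off the
  cut.\<close>

lemma arc_side:
  assumes P: "pth en x N P y" and E: "P \<subseteq> E1 \<union> E2" and N: "N \<inter> {u, v} \<subseteq> {x, y}"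
  shows "P \<subseteq> E1 \<or> P \<subseteq> E2"
  using P
proof cases
  case (Cons f w M Q)
  interpret s: two_sum en E2 E1 V2 V1 u v by (rule swap)
  have M: "w \<in> M" "M \<inter> {u, v} \<subseteq> {y}" using pth_endpoints[OF Cons(4)] N Cons by auto
  show ?thesis
  proof (cases "w = y")
    case True
    then have "Q = {}" using pth_closed[OF Cons(4)] by simp
    then show ?thesis using E Cons by auto
  next
    case False
    then have w: "w \<notin> {u, v}" "w \<in> en f" using M Cons by auto
    have f: "f \<in> E1 \<union> E2" "Q \<subseteq> E1 \<union> E2" using E Cons by auto
    then consider "w \<in> V1 - {u, v}" | "w \<in> V2 - {u, v}" using w ends1 ends2 by blast
    then show ?thesis
    proof cases
      case 1
      then show ?thesis using inner_path_side[OF Cons(4) f(2) 1 M(2)] edge_side[OF f(1) w(2) 1] Cons by auto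
    next
      case 2
      then show ?thesis using s.inner_path_side[OF Cons(4) _ 2 M(2)] s.edge_side[OF _ w(2) 2] f Cons by auto
    qed
  qed
qed (use E in simp)

text \<open>A visit to the other side would have to leave through one cut node and return through
  the other. Shared edges are excluded too, since they join \<open>u\<close> to
  \<open>v\<close>.\<close>

lemma uncut_path_side:
  assumes P: "pth en x N P y" and E: "P \<subseteq> E1 \<union> E2" and V: "x \<in> V1" "y \<in> V1" and N: "\<not> {u, v} \<subseteq> N"
  shows "P \<subseteq> E1 - E2"
proof -
  have half: "P \<subseteq> E1 - E2" if P: "pth en x N P w" and "P \<subseteq> E1 \<union> E2" "x \<in> V1" "w \<in> {u, v}" "\<not> {u, v} \<subseteq> N"
    for x N P w
  proof (cases "x = w")
    case True
    then show ?thesis using pth_closed[OF P] by simp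
  next
    case False
    then have "x \<in> V1 - {u, v}" "N \<inter> {u, v} \<subseteq> {w}" using pth_endpoints[OF P] that by auto
    then show ?thesis using inner_path_side[OF P] that by blast
  qed
  show ?thesis
  proof (cases "N \<inter> {u, v} = {}")
    case True
    then have "x \<in> V1 - {u, v}" using pth_endpoints[OF P] V by auto
    then show ?thesis using inner_path_side[OF P E] True by blast
  next
    case False
    then obtain w where w: "w \<in> N" "w \<in> {u, v}" by blast
    obtain M1 Q1 M2 Q2 where *: "pth en x M1 Q1 w" "pth en w M2 Q2 y" "N = M1 \<union> M2" "M1 \<inter> M2 = {w}" "P = Q1 \<union> Q2"
      by (rule pth_split[OF P w(1)])
    show ?thesis using half[OF *(1) _ V(1) w(2)] half[OF pth_rev[OF *(2)] _ V(2) w(2)] * E N by auto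
  qed
qed

lemma crossing_path:
  assumes "pth en x N P y" "P \<subseteq> E1 \<union> E2" "x \<in> V1 - {u, v}" "y \<in> V2 - {u, v}"
  shows "u \<in> N \<or> v \<in> N"
proof (rule ccontr)
  assume "\<not> (u \<in> N \<or> v \<in> N)"
  then have "y \<in> V1" using inner_path_side[OF assms(1-3)] by auto
  then show False using assms(4) V12 by blast
qed

text \<open>If both cut nodes are on the circle, they divide it into two arcs, each on one side.
  Otherwise removing an edge leaves a path that misses a cut node and hence keeps to the side of
  that edge.\<close>

lemma circ_sides:
  assumes C: "circ en C" and E: "C \<subseteq> E1 \<union> E2"
  shows "C \<subseteq> E1 \<or> C \<subseteq> E2 \<or> (\<exists>N1 P1 N2 P2. pth en u N1 P1 v \<and> P1 \<subseteq> E1 - E2 \<and>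
    pth en u N2 P2 v \<and> P2 \<subseteq> E2 - E1 \<and> C = P1 \<union> P2)"
proof (cases "{u, v} \<subseteq> \<Union> (en ` C)")
  case True
  then obtain f where f: "f \<in> C" "u \<in> en f" by auto
  obtain a b N where ab: "en f = {a, b}" "pth en a N (C - {f}) b" using circ_rotate[OF C f(1)] by blast
  have "\<exists>c. en f = {u, c} \<and> pth en u N (C - {f}) c"
    using ab f(2) pth_rev[OF ab(2)] by (auto simp: insert_commute)
  then obtain c where c: "en f = {u, c}" "pth en u N (C - {f}) c" by blast
  have "en g \<subseteq> N" if "g \<in> C" for g
    using pth_ends[OF c(2), of g] pth_endpoints[OF c(2)] c(1) that by (cases "g = f") auto
  then have "v \<in> N" using True by blast
  then obtain N1 P1 M Q where split: "pth en u N1 P1 v" "pth en v M Q c" "N = N1 \<union> M" "N1 \<inter> M = {v}" "C - {f} = P1 \<union> Q"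
    by (rule pth_split[OF c(2)])
  have "u \<notin> M" using split(4) pth_endpoints[OF split(1)] uv by (metis IntI singletonD)
  then have P2: "pth en u (insert u M) (insert f Q) v"
    using pth.Cons[OF c(1) pth_rev[OF split(2)]] by simp
  have CP: "C = P1 \<union> insert f Q" using split(5) f(1) by auto
  have sides: "P1 \<subseteq> E1 \<or> P1 \<subseteq> E2" "insert f Q \<subseteq> E1 \<or> insert f Q \<subseteq> E2"
    using arc_side[OF split(1)] arc_side[OF P2] CP E by auto
  \<comment> \<open>An arc through a shared edge is that edge, so it counts for both sides. Two arcs
    on different sides are therefore either on a common side or both free of shared edges.\<close>
  have shared_arc: "P \<subseteq> E1 \<and> P \<subseteq> E2" if "pth en u N P v" "g \<in> P" "g \<in> E1" "g \<in> E2" for N P g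
    using pth_edge_between[OF that(1,2) shared[OF that(3,4)]] that by auto
  have mixed: "(P \<subseteq> E1 \<and> P' \<subseteq> E1) \<or> (P \<subseteq> E2 \<and> P' \<subseteq> E2) \<or> (P \<subseteq> E1 - E2 \<and> P' \<subseteq> E2 - E1)"
    if P: "pth en u N P v" "pth en u N' P' v" and PE: "P \<subseteq> E1" "P' \<subseteq> E2" for N P N' P'
    using shared_arc[OF P(1)] shared_arc[OF P(2)] PE by blast
  have "P1 \<union> insert f Q \<subseteq> E1 \<or> P1 \<union> insert f Q \<subseteq> E2 \<or> (P1 \<subseteq> E1 - E2 \<and> insert f Q \<subseteq> E2 - E1)
    \<or> (insert f Q \<subseteq> E1 - E2 \<and> P1 \<subseteq> E2 - E1)"
    using sides mixed[OF split(1) P2] mixed[OF P2 split(1)] unfolding Un_subset_iff by satx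
  then show ?thesis
  proof (elim disjE conjE)
    assume "P1 \<subseteq> E1 - E2" "insert f Q \<subseteq> E2 - E1"
    then show ?thesis using split(1) P2 CP by blast
  next
    assume "insert f Q \<subseteq> E1 - E2" "P1 \<subseteq> E2 - E1"
    moreover have "C = insert f Q \<union> P1" using CP by auto
    ultimately show ?thesis using split(1) P2 by blast
  qed (simp_all add: CP)
next
  case False
  interpret s: two_sum en E2 E1 V2 V1 u v by (rule swap)
  obtain f where f: "f \<in> C" using circ_nonempty[OF C] by blast
  obtain a b N where ab: "en f = {a, b}" "pth en a N (C - {f}) b" using circ_rotate[OF C f(1)] by blast
  have "N \<subseteq> \<Union> (en ` C)" using pth_nodes[OF ab(2)] ab(1) f by auto
  then have N: "\<not> {u, v} \<subseteq> N" using False by blast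
  consider "f \<in> E1" | "f \<in> E2" using f E by blast
  then show ?thesis
  proof cases
    case 1
    then have "C - {f} \<subseteq> E1" using uncut_path_side[OF ab(2) _ _ _ N] ends1[OF 1] ab(1) E by blast
    then show ?thesis using 1 by blast
  next
    case 2
    then have "C - {f} \<subseteq> E2" using s.uncut_path_side[OF ab(2) _ _ _ N] ends2[OF 2] ab(1) E by blast
    then show ?thesis using 2 by blast
  qed
qed

end

text \<open>The shared edges are the members of both \<open>C1\<close> and \<open>C2\<close>, so no fiber is mentioned.\<close>

definition glue :: "'a set set \<Rightarrow> 'a set set \<Rightarrow> 'a set set" where
  "glue B1 B2 = B1 \<union> B2 \<union> {(C1 \<union> C2) - {f} | C1 C2 f. C1 \<in> B1 \<and> C2 \<in> B2 \<and> f \<in> C1 \<and> f \<in> C2}"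

lemma glue_commute: "glue B1 B2 = glue B2 B1"
  unfolding glue_def by (auto simp: Un_commute)

section \<open>Gluing two expansions along a fiber\<close>

text \<open>Both expansions live on one edge type and overlap exactly in the fiber over \<open>e\<close>.\<close>

locale amalgam =
  e1: expansion E1 B1 p en D1 ed + e2: expansion E2 B2 p en D2 ed + d: two_sum ed D1 D2 V1 V2 u v
  for E1 :: "'a set" and B1 and E2 and B2 and p :: "'a \<Rightarrow> 'd" and en :: "'a \<Rightarrow> 'v set"
    and D1 and D2 and ed and V1 and V2 and u v +
  fixes e :: 'd
  assumes D12: "D1 \<inter> D2 = {e}"
    and fiber1: "f \<in> E1 \<Longrightarrow> p f = e \<Longrightarrow> f \<in> E2" and fiber2: "f \<in> E2 \<Longrightarrow> p f = e \<Longrightarrow> f \<in> E1"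
begin

lemma swap: "amalgam E2 B2 E1 B1 p en D2 D1 ed V2 V1 u v e"
proof -
  interpret s: two_sum ed D2 D1 V2 V1 u v by (rule d.swap)
  show ?thesis using D12 fiber1 fiber2 by unfold_locales auto
qed

lemma ends_e: "ed e = {u, v}"
  using d.shared[of e] D12 by blast

lemma shared_iff1: "f \<in> E1 \<inter> E2 \<longleftrightarrow> f \<in> E1 \<and> p f = e"
  using e1.proj_mem e2.proj_mem D12 fiber1 by blast

lemma shared_iff2: "f \<in> E1 \<inter> E2 \<longleftrightarrow> f \<in> E2 \<and> p f = e"
  using e1.proj_mem e2.proj_mem D12 fiber2 by blast

lemma proj_sides: "f \<in> E1 \<union> E2 \<Longrightarrow> p f \<in> D1 \<Longrightarrow> f \<in> E1"
  using e2.proj_mem[of f] D12 fiber2[of f] by blast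

lemma ends_proj: "f \<in> E1 \<union> E2 \<Longrightarrow> en f = ed (p f)"
  using e1.ends_proj e2.ends_proj by blast

lemma ends_shared: "f \<in> E1 \<Longrightarrow> f \<in> E2 \<Longrightarrow> en f = {u, v}"
  using shared_iff1[of f] e1.ends_proj[of f] ends_e by simp

sublocale g: two_sum en E1 E2 V1 V2 u v
proof
  show "en f \<subseteq> V1" if "f \<in> E1" for f
    using e1.ends_proj[OF that] d.ends1[OF e1.proj_mem[OF that]] by simp
  show "en f \<subseteq> V2" if "f \<in> E2" for f
    using e2.ends_proj[OF that] d.ends2[OF e2.proj_mem[OF that]] by simp
qed (use ends_shared d.uv d.V12 in auto)

text \<open>All shared edges lie over \<open>e\<close>, and \<open>p\<close> is injective on
  balanced circles. Removing a shared edge from such a circle thus leaves only edges of its own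
  side.\<close>

lemma shared_unique:
  assumes "C \<in> B1" "f \<in> C" "g \<in> C" "f \<in> E2" "g \<in> E2"
  shows "f = g"
proof -
  have "f \<in> E1" "g \<in> E1" using e1.bal_edges assms by auto
  then have "p f = e" "p g = e" using shared_iff1 assms by auto
  then show ?thesis using e1.bal_inj[OF assms(1)] assms(2,3) by (auto simp: inj_on_def)
qed

lemma bal_not_shared:
  assumes "C \<in> B1"
  shows "\<not> C \<subseteq> E2"
proof
  assume C: "C \<subseteq> E2"
  obtain f where f: "f \<in> C" using circ_nonempty[OF e1.bal_circ[OF assms]] by blast
  then have "C = {f}" using shared_unique[OF assms] C by blast
  moreover have "en f = {u, v}" using f e1.bal_edges[OF assms] C ends_shared by blast
  ultimately show False using e1.bal_not_link[of f u v] d.uv assms by simp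
qed

text \<open>Gluing adds no balanced circle within a side: a circle of the third kind inside
  \<open>E1\<close> would need all of \<open>C2\<close> to be shared, but a balanced circle has at
  most one shared edge, and a single link is no circle.\<close>

lemma glue1: "C \<subseteq> E1 \<Longrightarrow> C \<in> glue B1 B2 \<longleftrightarrow> C \<in> B1"
proof
  interpret s: amalgam E2 B2 E1 B1 p en D2 D1 ed V2 V1 u v e by (rule swap)
  assume C: "C \<subseteq> E1" "C \<in> glue B1 B2"
  have "False" if "C2 \<in> B2" "f \<in> C2" "f \<in> E1" "C2 - {f} \<subseteq> E1" for C2 f
    using s.bal_not_shared[OF that(1)] that by blast
  then show "C \<in> B1"
    using C s.bal_not_shared e1.bal_edges unfolding glue_def by blast
qed (simp add: glue_def)

text \<open>\<open>C1\<close> and \<open>C2\<close> can be recovered from the union: each has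
  \<open>f\<close> as its only shared edge, so the edges of the union on side 1 are
  \<open>C1 - {f}\<close> and those on side 2 are \<open>C2 - {f}\<close>.\<close>

lemma glue_mixed:
  assumes A: "A \<subseteq> E1 - E2" "A \<noteq> {}" and R: "R \<subseteq> E2 - E1" "R \<noteq> {}"
  shows "A \<union> R \<in> glue B1 B2 \<longleftrightarrow> (\<exists>f. f \<in> E1 \<and> f \<in> E2 \<and> insert f A \<in> B1 \<and> insert f R \<in> B2)"
proof
  interpret s: amalgam E2 B2 E1 B1 p en D2 D1 ed V2 V1 u v e by (rule swap)
  assume "A \<union> R \<in> glue B1 B2"
  then consider "A \<union> R \<in> B1" | "A \<union> R \<in> B2"
    | C1 C2 f where "A \<union> R = (C1 \<union> C2) - {f}" "C1 \<in> B1" "C2 \<in> B2" "f \<in> C1" "f \<in> C2"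
    unfolding glue_def by blast
  then show "\<exists>f. f \<in> E1 \<and> f \<in> E2 \<and> insert f A \<in> B1 \<and> insert f R \<in> B2"
  proof cases
    case 1
    then show ?thesis using e1.bal_edges[OF 1] R by blast
  next
    case 2
    then show ?thesis using e2.bal_edges[OF 2] A by blast
  next
    case 3
    have f: "f \<in> E1" "f \<in> E2" using e1.bal_edges[OF 3(2)] e2.bal_edges[OF 3(3)] 3(4,5) by auto
    have 1: "C1 - {f} \<subseteq> E1 - E2" using shared_unique[OF 3(2,4) _ f(2)] e1.bal_edges[OF 3(2)] by blast
    have 2: "C2 - {f} \<subseteq> E2 - E1" using s.shared_unique[OF 3(3,5) _ f(1)] e2.bal_edges[OF 3(3)] by blast
    have "A \<union> R = (C1 - {f}) \<union> (C2 - {f})" using 3(1) by auto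
    then have "A = C1 - {f}" "R = C2 - {f}" using 1 2 A R by blast+
    then have "insert f A = C1" "insert f R = C2" using 3(4,5) by auto
    then show ?thesis using f 3(2,3) by auto
  qed
next
  assume "\<exists>f. f \<in> E1 \<and> f \<in> E2 \<and> insert f A \<in> B1 \<and> insert f R \<in> B2"
  then obtain f where f: "f \<in> E1" "f \<in> E2" "insert f A \<in> B1" "insert f R \<in> B2" by blast
  have "A \<union> R = (insert f A \<union> insert f R) - {f}" using f(1,2) A R by auto
  then show "A \<union> R \<in> glue B1 B2" using f unfolding glue_def by blast
qed

lemma glue_cases:
  assumes "C \<in> glue B1 B2"
  obtains "C \<in> B1" | "C \<in> B2"
  | A R f where "C = A \<union> R" "A \<subseteq> E1 - E2" "R \<subseteq> E2 - E1" "f \<in> E1" "f \<in> E2" "insert f A \<in> B1" "insert f R \<in> B2"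
proof -
  interpret s: amalgam E2 B2 E1 B1 p en D2 D1 ed V2 V1 u v e by (rule swap)
  consider "C \<in> B1" | "C \<in> B2"
    | C1 C2 f where "C = (C1 \<union> C2) - {f}" "C1 \<in> B1" "C2 \<in> B2" "f \<in> C1" "f \<in> C2"
    using assms unfolding glue_def by blast
  then show ?thesis
  proof cases
    case 3
    have f: "f \<in> E1" "f \<in> E2" using e1.bal_edges[OF 3(2)] e2.bal_edges[OF 3(3)] 3(4,5) by auto
    show ?thesis
    proof (rule that(3)[of "C1 - {f}" "C2 - {f}" f])
      show "C1 - {f} \<subseteq> E1 - E2" using shared_unique[OF 3(2,4) _ f(2)] e1.bal_edges[OF 3(2)] by blast
      show "C2 - {f} \<subseteq> E2 - E1" using s.shared_unique[OF 3(3,5) _ f(1)] e2.bal_edges[OF 3(3)] by blast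
      show "insert f (C1 - {f}) \<in> B1" "insert f (C2 - {f}) \<in> B2"
        using 3 by (simp_all add: insert_absorb)
    qed (use 3 f in auto)
  qed (use that in blast)+
qed

lemma glue_edges: "C \<in> glue B1 B2 \<Longrightarrow> C \<subseteq> E1 \<union> E2"
  using e1.bal_edges e2.bal_edges unfolding glue_def by blast

lemma pth_of_bal:
  assumes "insert f A \<in> B1" "f \<in> E2" "A \<subseteq> E1 - E2"
  shows "\<exists>N. pth en u N A v \<and> N \<subseteq> V1"
proof -
  have f: "f \<in> E1" using e1.bal_edges[OF assms(1)] by simp
  have fA: "f \<notin> A" using assms by blast
  obtain a b N where ab: "en f = {a, b}" "pth en a N (insert f A - {f}) b"
    using circ_rotate[OF e1.bal_circ[OF assms(1)], of f] by blast
  have A: "insert f A - {f} = A" using fA by auto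
  have "{a, b} = {u, v}" using ab(1) ends_shared f assms(2) by simp
  then have P: "pth en u N A v" using ab(2) pth_rev[OF ab(2)] unfolding A by (auto simp: doubleton_eq_iff)
  have "u \<in> V1" using d.V12 by blast
  then have "N \<subseteq> V1" using pth_nodes[OF P] assms(3) g.ends1 by blast
  then show ?thesis using P by blast
qed

lemma glue_circ:
  assumes "C \<in> glue B1 B2"
  shows "circ en C"
  using assms
proof (cases rule: glue_cases)
  case (3 A R f)
  interpret s: amalgam E2 B2 E1 B1 p en D2 D1 ed V2 V1 u v e by (rule swap)
  obtain N where N: "pth en u N A v" "N \<subseteq> V1" using pth_of_bal 3 by blast
  obtain M where M: "pth en u M R v" "M \<subseteq> V2" using s.pth_of_bal 3 by blast
  have "N \<inter> M = {u, v}" using N M d.V12 pth_endpoints[OF N(1)] pth_endpoints[OF M(1)] by blast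
  moreover have "A \<inter> R = {}" using 3 by blast
  ultimately show ?thesis unfolding 3(1) using circ_join[OF N(1) M(1) _ d.uv] by blast
qed (use e1.bal_circ e2.bal_circ in auto)

text \<open>A shared edge is a path in its own right and counts as closing itself.\<close>

definition closes :: "'a set \<Rightarrow> 'a \<Rightarrow> bool" where
  "closes P f \<longleftrightarrow> f \<in> E1 \<and> f \<in> E2 \<and> (P = {f} \<or> insert f P \<in> glue B1 B2)"

lemma arc_shared: "pth en u N P v \<Longrightarrow> f \<in> P \<Longrightarrow> f \<in> E1 \<Longrightarrow> f \<in> E2 \<Longrightarrow> P = {f}"
  using pth_edge_between ends_shared by metis

text \<open>A second shared edge closing \<open>f\<close> would form a balanced digon with it in the
  fiber over \<open>e\<close>.\<close>

lemma closes_single: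
  assumes "f \<in> E1" "f \<in> E2"
  shows "closes {f} g \<longleftrightarrow> g = f"
proof -
  have False if "insert g {f} \<in> glue B1 B2" "g \<noteq> f" "g \<in> E1" "g \<in> E2"
  proof -
    have "{g, f} \<in> B1" using glue1[of "{g, f}"] that assms by simp
    moreover have "p g = p f" using shared_iff1[of f] shared_iff1[of g] that assms by auto
    ultimately show False using e1.no_digon[OF that(3) assms(1) that(2)] by simp
  qed
  then show ?thesis using assms unfolding closes_def by auto
qed

lemma closes_ex1_side1:
  assumes P: "pth en u N P v" "P \<subseteq> E1"
  shows "\<exists>!f. closes P f"
proof (cases "\<exists>f\<in>P. f \<in> E2")
  case True
  then obtain f where f: "f \<in> P" "f \<in> E2" by blast
  then have "P = {f}" using arc_shared[OF P(1)] P(2) by blast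
  then show ?thesis using closes_single[of f] f P by auto
next
  case False
  have "e \<notin> p ` P" using False P(2) fiber1 by blast
  then have ex: "\<exists>!f. f \<in> E1 \<and> p f = e \<and> insert f P \<in> B1"
    using e1.closing_edge[OF P ends_e] D12 by blast
  have "closes P f \<longleftrightarrow> f \<in> E1 \<and> p f = e \<and> insert f P \<in> B1" for f
    unfolding closes_def using glue1[of "insert f P"] P(2) False shared_iff1[of f] by auto
  then show ?thesis using ex by simp
qed

text \<open>\<open>closes\<close> depends on the two sides symmetrically, so facts about it obtained
  through \<open>swap\<close> can be combined with those of side 1.\<close>

lemma closes_cong: "amalgam.closes E2 B2 E1 B1 = closes"
proof -
  interpret s: amalgam E2 B2 E1 B1 p en D2 D1 ed V2 V1 u v e by (rule swap)
  show ?thesis unfolding s.closes_def closes_def fun_eq_iff by (auto simp: glue_commute)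
qed

lemma closes_ex1:
  assumes P: "pth en u N P v" "P \<subseteq> E1 \<or> P \<subseteq> E2"
  shows "\<exists>!f. closes P f"
proof -
  interpret s: amalgam E2 B2 E1 B1 p en D2 D1 ed V2 V1 u v e by (rule swap)
  show ?thesis using closes_ex1_side1[OF P(1)] s.closes_ex1_side1[OF P(1)] P(2) closes_cong by auto
qed

text \<open>For unshared arcs, the edge \<open>f\<close> closing \<open>P\<close> is the third path
  of a theta graph with \<open>P\<close> and \<open>Q\<close>, so \<open>P \<union> Q\<close> is
  balanced iff \<open>f\<close> closes \<open>Q\<close> too. If one arc is a shared edge, it is its
  own closing edge, and closing the other arc means forming a balanced circle with it.\<close>

lemma arcs_bal_side1:
  assumes P: "pth en u N P v" "P \<subseteq> E1" and Q: "pth en u M Q v" "Q \<subseteq> E1"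
    and disj: "N \<inter> M = {u, v}" "P \<inter> Q = {}"
  shows "P \<union> Q \<in> glue B1 B2 \<longleftrightarrow> (\<exists>f. closes P f \<and> closes Q f)"
proof -
  have single: "P \<union> Q \<in> glue B1 B2 \<longleftrightarrow> (\<exists>f. closes P f \<and> closes Q f)"
    if f: "f \<in> P" "f \<in> E2" and P: "pth en u N P v" "P \<subseteq> E1" and Q: "pth en u M Q v"
      and disj: "P \<inter> Q = {}" for P Q N M f
  proof -
    have P1: "P = {f}" using arc_shared[OF P(1)] f P(2) by blast
    have "Q \<noteq> {f}" using disj f by blast
    have fE: "f \<in> E1" using f P by blast
    have "(\<exists>g. closes P g \<and> closes Q g) \<longleftrightarrow> closes Q f"
      unfolding P1 closes_single[OF fE f(2)] by simp
    also have "\<dots> \<longleftrightarrow> P \<union> Q \<in> glue B1 B2"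
      unfolding closes_def using fE f(2) \<open>Q \<noteq> {f}\<close> P1 by simp
    finally show ?thesis by simp
  qed
  consider f where "f \<in> P" "f \<in> E2" | f where "f \<in> Q" "f \<in> E2" | "P \<inter> E2 = {}" "Q \<inter> E2 = {}"
    by blast
  then show ?thesis
  proof cases
    case 1
    then show ?thesis using single[OF 1 P Q(1) disj(2)] by simp
  next
    case 2
    have "Q \<inter> P = {}" using disj(2) by blast
    then have "Q \<union> P \<in> glue B1 B2 \<longleftrightarrow> (\<exists>f. closes Q f \<and> closes P f)"
      using single[OF 2 Q P(1)] by simp
    then show ?thesis by (simp add: Un_commute conj_commute)
  next
    case 3
    have closes: "closes P f \<longleftrightarrow> f \<in> E1 \<and> f \<in> E2 \<and> P \<union> {f} \<in> B1" if "P \<subseteq> E1" "P \<inter> E2 = {}" for P f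
      unfolding closes_def using glue1[of "insert f P"] that by auto
    have th: "tri_closed B1 P Q {f}" if "f \<in> E1" "f \<in> E2" for f
    proof (rule theta_closed_tri[OF e1.theta])
      have "pth en u {u, v} {f} v" using ends_shared[OF that] d.uv by (rule pth_edge)
      then show "theta_paths en u v N P M Q {u, v} {f}"
        unfolding theta_paths_def using P(1) Q(1) disj d.uv that 3 pth_endpoints[OF P(1)] pth_endpoints[OF Q(1)]
        by auto
    qed (use P Q that in auto)
    obtain f where f: "closes P f" using closes_ex1_side1[OF P] by blast
    have "P \<union> Q \<in> glue B1 B2 \<longleftrightarrow> P \<union> Q \<in> B1" using glue1[of "P \<union> Q"] P Q by simp
    then show ?thesis
      using th f closes[OF P(2) 3(1)] closes[OF Q(2) 3(2)] unfolding tri_closed_def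
      by (metis Un_commute)
  qed
qed

text \<open>An arc that is a shared edge can be counted to the other side, which leaves a pair on
  one side. For two unshared arcs the claim is \<open>glue_mixed\<close>.\<close>

lemma arcs_bal_side12:
  assumes P: "pth en u N P v" "P \<subseteq> E1" and Q: "pth en u M Q v" "Q \<subseteq> E2"
    and disj: "N \<inter> M = {u, v}" "P \<inter> Q = {}"
  shows "P \<union> Q \<in> glue B1 B2 \<longleftrightarrow> (\<exists>f. closes P f \<and> closes Q f)"
proof -
  interpret s: amalgam E2 B2 E1 B1 p en D2 D1 ed V2 V1 u v e by (rule swap)
  consider f where "f \<in> P" "f \<in> E2" | f where "f \<in> Q" "f \<in> E1" | "P \<subseteq> E1 - E2" "Q \<subseteq> E2 - E1"
    using P Q by blast
  then show ?thesis
  proof cases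
    case 1
    then have "P = {f}" using arc_shared[OF P(1)] P(2) by blast
    then have "P \<subseteq> E2" using 1 by simp
    then show ?thesis using s.arcs_bal_side1[OF P(1) _ Q disj] closes_cong by (simp add: glue_commute)
  next
    case 2
    then have "Q = {f}" using arc_shared[OF Q(1)] Q(2) by blast
    then have "Q \<subseteq> E1" using 2 by simp
    then show ?thesis using arcs_bal_side1[OF P Q(1) _ disj] by simp
  next
    case 3
    have "P \<noteq> {}" "Q \<noteq> {}" using pth_closed[OF P(1)] pth_closed[OF Q(1)] d.uv by auto
    then have *: "P \<union> Q \<in> glue B1 B2 \<longleftrightarrow> (\<exists>f. f \<in> E1 \<and> f \<in> E2 \<and> insert f P \<in> B1 \<and> insert f Q \<in> B2)"
      using glue_mixed 3 by blast
    have "closes P f \<longleftrightarrow> f \<in> E1 \<and> f \<in> E2 \<and> insert f P \<in> B1" for f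
      unfolding closes_def using glue1[of "insert f P"] 3 by auto
    moreover have "closes Q f \<longleftrightarrow> f \<in> E1 \<and> f \<in> E2 \<and> insert f Q \<in> B2" for f
      unfolding closes_def using s.glue1[of "insert f Q"] 3 by (auto simp: glue_commute)
    ultimately show ?thesis using * by auto
  qed
qed

lemma arcs_bal:
  assumes P: "pth en u N P v" "P \<subseteq> E1 \<or> P \<subseteq> E2" and Q: "pth en u M Q v" "Q \<subseteq> E1 \<or> Q \<subseteq> E2"
    and disj: "N \<inter> M = {u, v}" "P \<inter> Q = {}"
  shows "P \<union> Q \<in> glue B1 B2 \<longleftrightarrow> (\<exists>f. closes P f \<and> closes Q f)"
proof -
  interpret s: amalgam E2 B2 E1 B1 p en D2 D1 ed V2 V1 u v e by (rule swap)
  consider "P \<subseteq> E1" "Q \<subseteq> E1" | "P \<subseteq> E1" "Q \<subseteq> E2" | "P \<subseteq> E2" "Q \<subseteq> E1" | "P \<subseteq> E2" "Q \<subseteq> E2"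
    using P(2) Q(2) by blast
  then show ?thesis
  proof cases
    case 1 then show ?thesis using arcs_bal_side1[OF P(1) _ Q(1) _ disj] by blast
  next
    case 2 then show ?thesis using arcs_bal_side12[OF P(1) _ Q(1) _ disj] by blast
  next
    case 3 then show ?thesis using s.arcs_bal_side12[OF P(1) _ Q(1) _ disj] closes_cong by (simp add: glue_commute)
  next
    case 4 then show ?thesis using s.arcs_bal_side1[OF P(1) _ Q(1) _ disj] closes_cong by (simp add: glue_commute)
  qed
qed

section \<open>The theta property of the union\<close>

lemma tri_at_cut:
  assumes th: "theta_paths en u v N1 P1 N2 P2 N3 P3" and E: "P1 \<union> P2 \<union> P3 \<subseteq> E1 \<union> E2"
  shows "tri_closed (glue B1 B2) P1 P2 P3"
proof -
  note T = th[unfolded theta_paths_def]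
  have side: "P \<subseteq> E1 \<or> P \<subseteq> E2" if "pth en u N P v" "P \<subseteq> E1 \<union> E2" for N P
    using g.arc_side[OF that] by blast
  have s: "P1 \<subseteq> E1 \<or> P1 \<subseteq> E2" "P2 \<subseteq> E1 \<or> P2 \<subseteq> E2" "P3 \<subseteq> E1 \<or> P3 \<subseteq> E2"
    using side T E by auto
  have p: "pth en u N1 P1 v" "pth en u N2 P2 v" "pth en u N3 P3 v" using T by auto
  have "P1 \<union> P2 \<in> glue B1 B2 \<longleftrightarrow> (\<exists>f. closes P1 f \<and> closes P2 f)"
    "P2 \<union> P3 \<in> glue B1 B2 \<longleftrightarrow> (\<exists>f. closes P2 f \<and> closes P3 f)"
    "P1 \<union> P3 \<in> glue B1 B2 \<longleftrightarrow> (\<exists>f. closes P1 f \<and> closes P3 f)"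
    using arcs_bal[OF p(1) s(1) p(2) s(2)] arcs_bal[OF p(2) s(2) p(3) s(3)] arcs_bal[OF p(1) s(1) p(3) s(3)] T
    by auto
  moreover have "\<exists>!f. closes P1 f" "\<exists>!f. closes P2 f" "\<exists>!f. closes P3 f"
    using closes_ex1 p s by auto
  ultimately show ?thesis unfolding tri_closed_def by (metis Un_commute)
qed

lemma tri_side1:
  assumes "theta_paths en x y N1 P1 N2 P2 N3 P3" and E: "P1 \<union> P2 \<union> P3 \<subseteq> E1"
  shows "tri_closed (glue B1 B2) P1 P2 P3"
proof -
  have "P \<union> Q \<in> glue B1 B2 \<longleftrightarrow> P \<union> Q \<in> B1" if "P \<subseteq> E1" "Q \<subseteq> E1" for P Q
    using glue1[of "P \<union> Q"] that by simp
  then show ?thesis using theta_closed_tri[OF e1.theta assms] E unfolding tri_closed_def by simp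
qed

text \<open>The segment of the third path between the cut nodes is traded for the edge that closes it.\<close>

lemma tri_replace:
  assumes th: "theta_paths en x y N1 P1 N2 P2 N3 P3" and E: "P1 \<union> P2 \<union> P3 \<subseteq> E1 \<union> E2"
    and xy: "x \<in> V1" "y \<in> V1" "{x, y} \<noteq> {u, v}" and N3: "u \<in> N3" "v \<in> N3"
  shows "tri_closed (glue B1 B2) P1 P2 P3"
proof -
  note T = th[unfolded theta_paths_def]
  \<comment> \<open>The paths meet only in the trivalent nodes. If a second one also contained both
    \<open>u\<close> and \<open>v\<close>, these would be the trivalent nodes.\<close>
  have cut: "\<not> {u, v} \<subseteq> N" if "N \<inter> N3 = {x, y}" for N
  proof
    assume "{u, v} \<subseteq> N"
    then have "u \<in> {x, y}" "v \<in> {x, y}" using N3 unfolding that[symmetric] by auto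
    then show False using xy(3) d.uv by auto
  qed
  have no: "\<not> {u, v} \<subseteq> N1" "\<not> {u, v} \<subseteq> N2" using cut T by simp_all
  have P12: "P1 \<subseteq> E1 - E2" "P2 \<subseteq> E1 - E2"
    using g.uncut_path_side[of x N1 P1 y] g.uncut_path_side[of x N2 P2 y] T E xy no by auto
  have p3: "pth en x N3 P3 y" using T by simp
  obtain s t M1 Q1 M2 R M3 Q2 where st: "{s, t} = {u, v}" and Q1: "pth en x M1 Q1 s" and R: "pth en s M2 R t"
    and Q2: "pth en t M3 Q2 y" and N: "N3 = M1 \<union> M2 \<union> M3" and P: "P3 = Q1 \<union> R \<union> Q2"
    and M12: "M1 \<inter> M2 = {s}" and M23: "M2 \<inter> M3 = {t}" and M13: "M1 \<inter> M3 = {}"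
    using pth_split2[OF p3 N3 d.uv] by (elim exE conjE) (rule that)
  have tne: "s \<noteq> t" "s \<in> V1" "t \<in> V1" using st d.uv d.V12 by (auto simp: doubleton_eq_iff)
  have mem: "s \<in> M2" "t \<in> M2" "s \<in> M1" "t \<in> M3" "x \<in> M1" "y \<in> M3"
    using pth_endpoints[OF R] pth_endpoints[OF Q1] pth_endpoints[OF Q2] by auto
  have "t \<notin> M1" "s \<notin> M3" using mem M12 M23 tne(1) by (metis IntI singletonD)+
  then have "\<not> {u, v} \<subseteq> M1" "\<not> {u, v} \<subseteq> M3" using st by auto
  then have Q: "Q1 \<subseteq> E1 - E2" "Q2 \<subseteq> E1 - E2"
    using g.uncut_path_side[OF Q1] g.uncut_path_side[OF Q2] tne xy P E by auto
  have RE: "R \<subseteq> E1 \<or> R \<subseteq> E2" using g.arc_side[OF R] P E st by auto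
  show ?thesis
  proof (cases "R \<subseteq> E1")
    case True
    then have "P1 \<union> P2 \<union> P3 \<subseteq> E1" using P12 Q P by blast
    then show ?thesis by (rule tri_side1[OF th])
  next
    case False
    then have R2: "R \<subseteq> E2" using RE by blast
    have "R = {g}" if "g \<in> R" "g \<in> E1" for g
      using pth_edge_between[OF R that(1)] ends_shared[OF that(2)] that R2 st by auto
    then have RF: "R \<subseteq> E2 - E1" using R2 False by blast
    have "e \<notin> p ` R" using RF R2 fiber2 by blast
    then obtain f where f: "f \<in> E2" "p f = e" "insert f R \<in> B2"
      using e2.closing_edge[OF R R2, of e] ends_e st D12 by blast
    then have f1: "f \<in> E1" using fiber2 by simp
    have f_uniq: "g = f" if "insert g R \<in> B2" "g \<in> E1" "g \<in> E2" for g
      using e2.lift_unique[OF that(1) f(3)] that RF shared_iff1[of g] f(2) by auto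
    have ef: "en f = {s, t}" using ends_shared f1 f(1) st by simp
    define P3' N3' where "P3' = Q1 \<union> ({f} \<union> Q2)" and "N3' = M1 \<union> ({s, t} \<union> M3)"
    have "pth en s {s, t} {f} t" using ef tne(1) by (rule pth_edge)
    then have "pth en s ({s, t} \<union> M3) ({f} \<union> Q2) y"
      by (rule pth_append[OF _ Q2]) (use mem \<open>s \<notin> M3\<close> in auto)
    then have P3': "pth en x N3' P3' y"
      unfolding P3'_def N3'_def
      by (rule pth_append[OF Q1]) (use mem \<open>t \<notin> M1\<close> M13 in auto)
    have N3'sub: "N3' \<subseteq> N3" unfolding N3'_def N using mem by auto
    have disj: "P1 \<inter> P3' = {}" "P2 \<inter> P3' = {}"
      using T P f(1) P12 unfolding P3'_def by auto
    have xyN: "x \<in> N3'" "y \<in> N3'" using pth_endpoints[OF P3'] by auto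
    have "N1 \<inter> N3' = {x, y}" "N2 \<inter> N3' = {x, y}" using T N3'sub xyN by blast+
    then have "theta_paths en x y N1 P1 N2 P2 N3' P3'"
      unfolding theta_paths_def using T P3' disj by auto
    then have tri: "tri_closed B1 P1 P2 P3'"
      by (rule theta_closed_tri[OF e1.theta]) (use P12 Q f1 in \<open>auto simp: P3'_def\<close>)
    have Rne: "R \<noteq> {}" using pth_closed[OF R] tne(1) by simp
    \<comment> \<open>\<open>R\<close> is the only part on side 2, and \<open>f\<close> is the only
      shared edge closing it; so \<open>glue_mixed\<close> asks just for balance of the circle in
      which \<open>f\<close> replaces \<open>R\<close>.\<close>
    have eq: "X \<union> P3 \<in> glue B1 B2 \<longleftrightarrow> X \<union> P3' \<in> B1" if X: "X \<subseteq> E1 - E2" "X \<noteq> {}" for X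
    proof -
      let ?A = "X \<union> Q1 \<union> Q2"
      have "X \<union> P3 = ?A \<union> R" unfolding P by auto
      then have "X \<union> P3 \<in> glue B1 B2 \<longleftrightarrow> (\<exists>f. f \<in> E1 \<and> f \<in> E2 \<and> insert f ?A \<in> B1 \<and> insert f R \<in> B2)"
        using glue_mixed[of ?A R] X Q RF Rne by auto
      also have "\<dots> \<longleftrightarrow> insert f ?A \<in> B1" using f f1 f_uniq by blast
      also have "insert f ?A = X \<union> P3'" unfolding P3'_def by auto
      finally show ?thesis .
    qed
    have "P1 \<noteq> {}" "P2 \<noteq> {}" using T pth_closed[of en x N1 P1 y] pth_closed[of en x N2 P2 y] by auto
    then show ?thesis
      using tri eq[OF P12(1)] eq[OF P12(2)] glue1[of "P1 \<union> P2"] P12 unfolding tri_closed_def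
      by (auto simp: Un_commute)
  qed
qed

text \<open>If some path contains both cut nodes, rotation makes it the third. If none does, no path
  can leave side 1. Trivalent nodes \<open>u\<close> and \<open>v\<close> form the separate case
  decided by closing edges.\<close>

lemma tri_ends1:
  assumes th: "theta_paths en x y N1 P1 N2 P2 N3 P3" and E: "P1 \<union> P2 \<union> P3 \<subseteq> E1 \<union> E2"
    and xy: "x \<in> V1" "y \<in> V1"
  shows "tri_closed (glue B1 B2) P1 P2 P3"
proof (cases "{x, y} = {u, v}")
  case True
  then consider "x = u" "y = v" | "x = v" "y = u" by (auto simp: doubleton_eq_iff)
  then show ?thesis
    using tri_at_cut[OF _ E] th theta_paths_reverse[OF th] by cases simp_all
next
  case False
  note th2 = theta_paths_rotate[OF th]
  note th3 = theta_paths_rotate[OF th2]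
  have E2: "P2 \<union> P3 \<union> P1 \<subseteq> E1 \<union> E2" and E3: "P3 \<union> P1 \<union> P2 \<subseteq> E1 \<union> E2" using E by auto
  consider "{u, v} \<subseteq> N1" | "{u, v} \<subseteq> N2" | "{u, v} \<subseteq> N3"
    | "\<not> {u, v} \<subseteq> N1" "\<not> {u, v} \<subseteq> N2" "\<not> {u, v} \<subseteq> N3" by blast
  then show ?thesis
  proof cases
    case 1
    then have "tri_closed (glue B1 B2) P2 P3 P1" using tri_replace[OF th2 E2 xy False] by simp
    then show ?thesis by (rule tri_closed_rotate)
  next
    case 2
    then have "tri_closed (glue B1 B2) P3 P1 P2" using tri_replace[OF th3 E3 xy False] by simp
    then show ?thesis by (rule tri_closed_rotate[OF tri_closed_rotate])
  next
    case 3
    then show ?thesis using tri_replace[OF th E xy False] by simp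
  next
    case 4
    have "P1 \<subseteq> E1" "P2 \<subseteq> E1" "P3 \<subseteq> E1"
      using g.uncut_path_side[of x N1 P1 y] g.uncut_path_side[of x N2 P2 y] g.uncut_path_side[of x N3 P3 y]
        th E xy 4 unfolding theta_paths_def by auto
    then show ?thesis using tri_side1[OF th] by simp
  qed
qed

text \<open>Pigeonhole: each of the three paths would pass through \<open>u\<close> or
  \<open>v\<close>, so two of them would share a cut node, which is not one of their ends.\<close>

lemma theta_not_across:
  assumes th: "theta_paths en x y N1 P1 N2 P2 N3 P3" and E: "P1 \<union> P2 \<union> P3 \<subseteq> E1 \<union> E2"
  shows "\<not> (x \<in> V1 - {u, v} \<and> y \<in> V2 - {u, v})"
proof
  assume xy: "x \<in> V1 - {u, v} \<and> y \<in> V2 - {u, v}"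
  note T = th[unfolded theta_paths_def]
  have "u \<in> N1 \<or> v \<in> N1" "u \<in> N2 \<or> v \<in> N2" "u \<in> N3 \<or> v \<in> N3"
    using g.crossing_path[of x _ _ y] T E xy by (meson Un_subset_iff)+
  then have "(u \<in> N1 \<inter> N2 \<or> v \<in> N1 \<inter> N2) \<or> (u \<in> N1 \<inter> N3 \<or> v \<in> N1 \<inter> N3) \<or> (u \<in> N2 \<inter> N3 \<or> v \<in> N2 \<inter> N3)"
    by blast
  then have "u \<in> {x, y} \<or> v \<in> {x, y}" using T by blast
  then show False using xy by blast
qed

lemma theta_glue: "theta_closed en (E1 \<union> E2) (glue B1 B2)"
  unfolding theta_closed_def
proof (intro allI impI)
  interpret s: amalgam E2 B2 E1 B1 p en D2 D1 ed V2 V1 u v e by (rule swap)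
  fix x y N1 P1 N2 P2 N3 P3
  assume th: "theta_paths en x y N1 P1 N2 P2 N3 P3" and E: "P1 \<union> P2 \<union> P3 \<subseteq> E1 \<union> E2"
    and bal: "P1 \<union> P2 \<in> glue B1 B2" "P2 \<union> P3 \<in> glue B1 B2"
  have E': "P1 \<union> P2 \<union> P3 \<subseteq> E2 \<union> E1" using E by auto
  have xy: "x \<noteq> y" "pth en x N1 P1 y" using th by (auto simp: theta_paths_def)
  obtain f g where "f \<in> P1" "x \<in> en f" "g \<in> P1" "y \<in> en g"
    using pth_start_edge[OF xy(2,1)] pth_start_edge[OF pth_rev[OF xy(2)] xy(1)[symmetric]] by metis
  then have "x \<in> V1 \<union> V2" "y \<in> V1 \<union> V2" using g.ends1 g.ends2 E by blast+
  moreover have "\<not> (x \<in> V1 - {u, v} \<and> y \<in> V2 - {u, v})" "\<not> (y \<in> V1 - {u, v} \<and> x \<in> V2 - {u, v})"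
    using theta_not_across[OF th E] theta_not_across[OF theta_paths_reverse[OF th] E] by auto
  ultimately consider "x \<in> V1" "y \<in> V1" | "x \<in> V2" "y \<in> V2" using d.V12 by blast
  then have "tri_closed (glue B1 B2) P1 P2 P3"
  proof cases
    case 1 then show ?thesis using tri_ends1[OF th E] by simp
  next
    case 2 then show ?thesis using s.tri_ends1[OF th E'] by (simp add: glue_commute)
  qed
  then show "P1 \<union> P3 \<in> glue B1 B2" using bal unfolding tri_closed_def by blast
qed

section \<open>Circle lifting in the union\<close>

lemma lifting_side1:
  assumes K: "circ ed K" "K \<subseteq> D1" "c \<in> K" and F: "F \<subseteq> E1 \<union> E2" and bij: "bij_betw p F (K - {c})"
  shows "\<exists>!f. f \<in> E1 \<union> E2 \<and> p f = c \<and> insert f F \<in> glue B1 B2"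
proof -
  have F1: "F \<subseteq> E1" using F bij K(2) proj_sides unfolding bij_betw_def by blast
  have "f \<in> E1 \<union> E2 \<and> p f = c \<and> insert f F \<in> glue B1 B2 \<longleftrightarrow> f \<in> E1 \<and> p f = c \<and> insert f F \<in> B1" for f
    using proj_sides[of f] K(2,3) F1 glue1[of "insert f F"] by blast
  then show ?thesis using e1.lifting[OF K F1 bij] by simp
qed

text \<open>The lift is prescribed on all of \<open>K1\<close>, so its closing edge \<open>g\<close>
  over \<open>e\<close> is determined. Prescribing \<open>g\<close> over \<open>e\<close> turns the
  question into circle lifting for \<open>insert e K2\<close> on side 2, where only \<open>c\<close>
  is left open.\<close>

lemma lifting_mixed:
  assumes K: "pth ed u N1 K1 v" "K1 \<subseteq> D1 - D2" "pth ed u N2 K2 v" "K2 \<subseteq> D2 - D1"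
    and c: "c \<in> K2" and F: "F \<subseteq> E1 \<union> E2" and bij: "bij_betw p F (K1 \<union> K2 - {c})"
  shows "\<exists>!f. f \<in> E1 \<union> E2 \<and> p f = c \<and> insert f F \<in> glue B1 B2"
proof -
  interpret s: amalgam E2 B2 E1 B1 p en D2 D1 ed V2 V1 u v e by (rule swap)
  define F1 where "F1 = {f \<in> F. p f \<in> K1}"
  define F2 where "F2 = {f \<in> F. p f \<in> K2}"
  have img: "p ` F = K1 \<union> K2 - {c}" and inj: "inj_on p F" using bij by (auto simp: bij_betw_def)
  have disjK: "K1 \<inter> K2 = {}" and c1: "c \<notin> K1" using K c by blast+
  have restr: "p ` {f \<in> F. p f \<in> K} = p ` F \<inter> K" for K by auto
  have FF: "F = F1 \<union> F2" using img unfolding F1_def F2_def by auto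
  have img1: "p ` F1 = K1" using c1 unfolding F1_def restr img by auto
  have img2: "p ` F2 = K2 - {c}" using disjK unfolding F2_def restr img by auto
  have inj12: "inj_on p F1" "inj_on p F2" using inj unfolding F1_def F2_def by (auto simp: inj_on_def)
  have F1E: "F1 \<subseteq> E1 - E2" using F K(2) proj_sides e2.proj_mem unfolding F1_def by blast
  have F2E: "F2 \<subseteq> E2 - E1" using F K(4) s.proj_sides e1.proj_mem unfolding F2_def by blast
  have e: "e \<in> D1" "e \<in> D2" using D12 by auto
  have e1: "e \<notin> p ` F1" using img1 K(2) e by auto
  have K1: "circ ed (insert e (p ` F1))" unfolding img1
    using circI[OF ends_e _ K(1)] K(2) e by blast
  obtain g where g: "g \<in> E1" "p g = e" "insert g F1 \<in> B1"
    and g_uniq: "\<And>h. h \<in> E1 \<Longrightarrow> p h = e \<Longrightarrow> insert h F1 \<in> B1 \<Longrightarrow> h = g"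
    using e1.lift_exists[OF K1 e(1) _ inj12(1) e1] F1E by blast
  have g2: "g \<in> E2" using g fiber1 by simp
  have "e \<notin> K2" using K(4) e by blast
  have K2: "circ ed (insert e K2)" using circI[OF ends_e \<open>e \<notin> K2\<close> K(3)] .
  have "bij_betw p (insert g F2) (insert e K2 - {c})"
    using inj12(2) img2 g(2) c \<open>e \<notin> K2\<close> unfolding bij_betw_def by auto
  then have ex: "\<exists>!f. f \<in> E2 \<and> p f = c \<and> insert f (insert g F2) \<in> B2"
    using K(4) c e g2 F2E by (intro e2.lifting[OF K2]) auto
  have K1ne: "F1 \<noteq> {}" using img1 pth_closed[OF K(1)] d.uv by auto
  have "f \<in> E1 \<union> E2 \<and> p f = c \<and> insert f F \<in> glue B1 B2 \<longleftrightarrow>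
      f \<in> E2 \<and> p f = c \<and> insert f (insert g F2) \<in> B2" for f
  proof (cases "f \<in> E1 \<union> E2 \<and> p f = c")
    case True
    have fE: "f \<in> E2 - E1" using True c K(4) s.proj_sides[of f] e1.proj_mem[of f] by blast
    have "insert f F = F1 \<union> insert f F2" using FF by auto
    then have "insert f F \<in> glue B1 B2 \<longleftrightarrow> (\<exists>h. h \<in> E1 \<and> h \<in> E2 \<and> insert h F1 \<in> B1 \<and> insert h (insert f F2) \<in> B2)"
      using glue_mixed[OF F1E K1ne, of "insert f F2"] fE F2E by auto
    also have "\<dots> \<longleftrightarrow> insert g (insert f F2) \<in> B2"
      using g g2 g_uniq shared_iff1 by blast
    finally show ?thesis using fE True by (auto simp: insert_commute)
  next
    case False
    then show ?thesis by blast
  qed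
  then show ?thesis using ex by simp
qed

lemma expansion_glue: "expansion (E1 \<union> E2) (glue B1 B2) p en (D1 \<union> D2) ed"
proof
  interpret s: amalgam E2 B2 E1 B1 p en D2 D1 ed V2 V1 u v e by (rule swap)
  show "p ` (E1 \<union> E2) = D1 \<union> D2" using e1.surj e2.surj by auto
  show "{f, g} \<notin> glue B1 B2" if fg: "f \<in> E1 \<union> E2" "g \<in> E1 \<union> E2" "f \<noteq> g" "p f = p g" for f g
  proof -
    have fg': "f \<in> E2 \<union> E1" "g \<in> E2 \<union> E1" using fg(1,2) by auto
    consider "p f \<in> D1" | "p f \<in> D2" using fg(1) e1.proj_mem e2.proj_mem by blast
    then show ?thesis
    proof cases
      case 1
      then have "f \<in> E1" "g \<in> E1" using proj_sides[OF fg(1)] proj_sides[OF fg(2)] fg(4) by simp_all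
      then show ?thesis using glue1[of "{f, g}"] e1.no_digon fg(3,4) by simp
    next
      case 2
      then have "f \<in> E2" "g \<in> E2" using s.proj_sides[OF fg'(1)] s.proj_sides[OF fg'(2)] fg(4) by simp_all
      then show ?thesis using s.glue1[of "{f, g}"] e2.no_digon fg(3,4) by (simp add: glue_commute)
    qed
  qed
  show "\<exists>!f. f \<in> E1 \<union> E2 \<and> p f = c \<and> insert f F \<in> glue B1 B2"
    if K: "circ ed K" "K \<subseteq> D1 \<union> D2" "c \<in> K" and F: "F \<subseteq> E1 \<union> E2" and bij: "bij_betw p F (K - {c})" for K c F
  proof -
    have F': "F \<subseteq> E2 \<union> E1" using F by auto
    consider "K \<subseteq> D1" | "K \<subseteq> D2" | N1 P1 N2 P2 where "pth ed u N1 P1 v" "P1 \<subseteq> D1 - D2"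
      "pth ed u N2 P2 v" "P2 \<subseteq> D2 - D1" "K = P1 \<union> P2"
      using d.circ_sides[OF K(1,2)] by blast
    then show ?thesis
    proof cases
      case 1
      then show ?thesis using lifting_side1[OF K(1) _ K(3) F bij] by simp
    next
      case 2
      then show ?thesis using s.lifting_side1[OF K(1) _ K(3) F' bij] by (simp add: glue_commute Un_commute)
    next
      case 3
      then consider "c \<in> P2" | "c \<in> P1" using K(3) by blast
      then show ?thesis
      proof cases
        case 1
        then show ?thesis using lifting_mixed[OF 3(1-4) _ F] bij 3(5) by simp
      next
        case 2
        have "K = P2 \<union> P1" using 3(5) by auto
        then show ?thesis using s.lifting_mixed[OF 3(3,4,1,2) 2 F'] bij by (simp add: glue_commute Un_commute)
      qed
    qed
  qed
qed (use ends_proj glue_edges glue_circ theta_glue in auto)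

end

section \<open>Transport, deletion and avoiding paths\<close>

lemma pth_joined:
  "pth en x N P y \<Longrightarrow> a \<in> N \<Longrightarrow> (x, a) \<in> {(x, y). \<exists>t\<in>P. en t = {x, y}}\<^sup>*"
proof (induction rule: pth.induct)
  case (Cons f x y N P z)
  show ?case
  proof (cases "a = x")
    case False
    then have "(y, a) \<in> {(x, y). \<exists>t\<in>P. en t = {x, y}}\<^sup>*" using Cons by blast
    then have "(y, a) \<in> {(x, y). \<exists>t\<in>insert f P. en t = {x, y}}\<^sup>*"
      by (rule rtrancl_mono[THEN subsetD, rotated]) auto
    moreover have "(x, y) \<in> {(x, y). \<exists>t\<in>insert f P. en t = {x, y}}" using Cons.hyps by auto
    ultimately show ?thesis by (rule converse_rtrancl_into_rtrancl[rotated])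
  qed simp
qed simp

text \<open>Edges of \<open>P\<close> connect only nodes of \<open>N\<close>, and the path connects
  all of these; hence contraction collapses \<open>N\<close> to one node and leaves every other node
  alone.\<close>

lemma node_class_pth:
  assumes P: "pth (ends G) x N P y" and N: "N \<subseteq> nodes G" and a: "a \<in> nodes G"
  shows "node_class G P a = (if a \<in> N then N else {a})"
proof -
  let ?R = "{(x, y). \<exists>t\<in>P. ends G t = {x, y}}"
  have "sym ?R" by (auto simp: sym_def insert_commute)
  then have sym: "sym (?R\<^sup>*)" by (rule sym_rtrancl)
  have conn: "(a, b) \<in> ?R\<^sup>*" if "a \<in> N" "b \<in> N" for a b
    using symD[OF sym pth_joined[OF P that(1)]] pth_joined[OF P that(2)] by (rule rtrancl_trans)
  have "a = b \<or> (a \<in> N \<and> b \<in> N)" if "(a, b) \<in> ?R\<^sup>*" for b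
    using that
  proof (induction rule: rtrancl_induct)
    case (step b c)
    then have "b \<in> N" "c \<in> N" using pth_ends[OF P] by fastforce+
    then show ?case using step.IH by auto
  qed simp
  then show ?thesis using conn N a unfolding node_class_def joined_def by auto
qed

text \<open>A walk is shortened while it is built: when the new start \<open>x\<close> already lies
  on the path, the part before \<open>x\<close> is dropped.\<close>

lemma joined_imp_pth:
  "(x, y) \<in> {(x, y). \<exists>t\<in>T. en t = {x, y}}\<^sup>* \<Longrightarrow> \<exists>N P. pth en x N P y \<and> P \<subseteq> T"
proof (induction rule: converse_rtrancl_induct)
  case base
  show ?case by (intro exI[of _ "{y}"] exI[of _ "{}"]) (simp add: pth.Nil)
next
  case (step x z)
  then obtain f N P where f: "f \<in> T" "en f = {x, z}" and P: "pth en z N P y" "P \<subseteq> T" by auto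
  show ?case
  proof (cases "x \<in> N")
    case True
    obtain N1 P1 N2 P2 where "pth en z N1 P1 x" "pth en x N2 P2 y" "N = N1 \<union> N2" "N1 \<inter> N2 = {x}" "P = P1 \<union> P2"
      by (rule pth_split[OF P(1) True])
    then show ?thesis using P(2) by blast
  next
    case False
    then have "pth en x (insert x N) (insert f P) y" using pth.Cons[OF f(2) P(1)] by simp
    then show ?thesis using P(2) f(1) by blast
  qed
qed

text \<open>Take a third node \<open>w\<close>. Deleting \<open>v\<close> leaves a walk from
  \<open>u\<close> to \<open>w\<close>, deleting \<open>u\<close> one from \<open>w\<close> to
  \<open>v\<close>, and neither uses \<open>e\<close>, which is incident with both deleted
  nodes.\<close>

lemma two_connected_avoiding_path:
  assumes G: "two_connected G" "at_least_three_nodes G"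
    and e: "ends G e = {u, v}" "u \<noteq> v" "u \<in> nodes G" "v \<in> nodes G"
  shows "\<exists>N P. pth (ends G) u N P v \<and> P \<subseteq> edges G - {e}"
proof -
  have "\<not> nodes G \<subseteq> {u, v}"
  proof
    assume sub: "nodes G \<subseteq> {u, v}"
    have "card (nodes G) \<le> 2" using card_mono[OF _ sub] e(2) by simp
    moreover have "finite (nodes G)" using sub finite_subset by blast
    ultimately show False using G(2) unfolding at_least_three_nodes_def by auto
  qed
  then obtain w where w: "w \<in> nodes G" "w \<noteq> u" "w \<noteq> v" by blast
  let ?R = "{(x, y). \<exists>t\<in>edges G - {e}. ends G t = {x, y}}"
  have "(a, b) \<in> ?R\<^sup>*" if "x \<in> {u, v}" "a \<in> nodes G - {x}" "b \<in> nodes G - {x}" for x a b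
  proof -
    have "connected_graph (delete_node G x)" using G(1) that(1) e unfolding two_connected_def by blast
    then have "(a, b) \<in> {(y, z). \<exists>t\<in>{f \<in> edges G. x \<notin> ends G f}. ends G t = {y, z}}\<^sup>*"
      using that unfolding connected_graph_def delete_node_def joined_def by simp
    then show ?thesis
      by (rule rtrancl_mono[THEN subsetD, rotated]) (use e(1) that(1) in auto)
  qed
  from this[of v u w] this[of u w v] have "(u, v) \<in> ?R\<^sup>*"
    using w e by (auto intro: rtrancl_trans)
  then show ?thesis by (rule joined_imp_pth)
qed

text \<open>The two expansions are given on different edge types and have to be moved into a common
  one; every condition is pulled back along the inverse of \<open>j\<close>. The base ends are
  compared on \<open>D\<close> only, because each side agrees with the amalgamated graph just on its
  own edges.\<close>

lemma expansion_image:
  assumes "expansion E B p en D ed" and j: "inj_on j E"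
    and p': "\<And>f. f \<in> E \<Longrightarrow> p' (j f) = p f" and en': "\<And>f. f \<in> E \<Longrightarrow> en' (j f) = en f"
    and ed': "\<And>d. d \<in> D \<Longrightarrow> ed' d = ed d"
  shows "expansion (j ` E) ((`) j ` B) p' en' D ed'"
proof -
  interpret expansion E B p en D ed by fact
  let ?k = "inv_into E j"
  have k: "?k (j f) = f" if "f \<in> E" for f using inv_into_f_f[OF j that] .
  have kE: "?k f \<in> E" "j (?k f) = f" if "f \<in> j ` E" for f
    using inv_into_into[OF that] f_inv_into_f[OF that] by auto
  have kim: "?k ` j ` X = X" if "X \<subseteq> E" for X using inv_into_image_cancel[OF j that] .
  have jim: "j ` ?k ` X = X" if "X \<subseteq> j ` E" for X using image_inv_into_cancel[OF refl that] .
  have bal: "X \<in> (`) j ` B \<longleftrightarrow> ?k ` X \<in> B" if "X \<subseteq> j ` E" for X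
  proof
    assume "X \<in> (`) j ` B"
    then show "?k ` X \<in> B" using kim bal_edges by auto
  next
    assume "?k ` X \<in> B"
    then show "X \<in> (`) j ` B" using jim[OF that] by (metis imageI)
  qed
  show ?thesis
  proof
    show "p' ` j ` E = D" using p' surj by (auto simp: image_iff)
    show "en' f = ed' (p' f)" if "f \<in> j ` E" for f
      using that p' en' ed' ends_proj proj_mem by auto
    show "C \<subseteq> j ` E" if "C \<in> (`) j ` B" for C using that bal_edges by auto
    show "circ en' C" if C: "C \<in> (`) j ` B" for C
    proof -
      obtain X where X: "X \<in> B" "C = j ` X" using C by auto
      show ?thesis unfolding X(2)
        by (rule circ_map[OF bal_circ[OF X(1)]]) (use bal_edges[OF X(1)] en' j in \<open>auto intro: inj_on_subset\<close>)
    qed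
    show "theta_closed en' (j ` E) ((`) j ` B)"
      unfolding theta_closed_def
    proof (intro allI impI)
      fix x y N1 P1 N2 P2 N3 P3
      assume th: "theta_paths en' x y N1 P1 N2 P2 N3 P3" and sub: "P1 \<union> P2 \<union> P3 \<subseteq> j ` E"
        and b: "P1 \<union> P2 \<in> (`) j ` B" "P2 \<union> P3 \<in> (`) j ` B"
      have enk: "en (?k f) = en' f" if "f \<in> j ` E" for f using en'[OF kE(1)[OF that]] kE(2)[OF that] by simp
      have kp: "pth en x N (?k ` P) y" if "pth en' x N P y" "P \<subseteq> j ` E" for N P
        by (rule pth_map[OF that(1)]) (use that(2) enk in blast)
      have disj: "?k ` P \<inter> ?k ` Q = {}" if "P \<inter> Q = {}" "P \<subseteq> j ` E" "Q \<subseteq> j ` E" for P Q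
        using that inj_on_image_Int[OF inj_on_inv_into[of "j ` E" j E] that(2,3)] by simp
      have "theta_paths en x y N1 (?k ` P1) N2 (?k ` P2) N3 (?k ` P3)"
        using th sub kp disj unfolding theta_paths_def by simp
      moreover have "?k ` P1 \<union> ?k ` P2 \<union> ?k ` P3 \<subseteq> E" using sub kE by auto
      moreover have "?k ` P1 \<union> ?k ` P2 \<in> B" "?k ` P2 \<union> ?k ` P3 \<in> B"
        using b bal[of "P1 \<union> P2"] bal[of "P2 \<union> P3"] sub by (simp_all add: image_Un)
      ultimately have "?k ` P1 \<union> ?k ` P3 \<in> B" by (rule theta_closedD[OF theta])
      then show "P1 \<union> P3 \<in> (`) j ` B" using bal[of "P1 \<union> P3"] sub by (simp add: image_Un)
    qed
    show "{f, g} \<notin> (`) j ` B" if fg: "f \<in> j ` E" "g \<in> j ` E" "f \<noteq> g" "p' f = p' g" for f g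
    proof -
      have "?k f \<noteq> ?k g" using kE fg(1-3) by metis
      moreover have "p (?k f) = p (?k g)" using fg p' kE by metis
      ultimately have "{?k f, ?k g} \<notin> B" using no_digon kE fg by simp
      then show ?thesis using bal[of "{f, g}"] fg by simp
    qed
    show "\<exists>!f. f \<in> j ` E \<and> p' f = c \<and> insert f F \<in> (`) j ` B"
      if K: "circ ed' K" "K \<subseteq> D" "c \<in> K" and F: "F \<subseteq> j ` E" and b: "bij_betw p' F (K - {c})" for K c F
    proof -
      have "circ ed (id ` K)" by (rule circ_map[OF K(1)]) (use K(2) ed' in auto)
      then have K1: "circ ed K" by simp
      have pk: "p (?k f) = p' f" if "f \<in> F" for f using F that kE p' by (metis subsetD)
      have inj: "inj_on ?k F" using F by (rule inj_on_inv_into)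
      have "p ` ?k ` F = p' ` F" using pk by (auto simp: image_iff)
      moreover have "inj_on p (?k ` F)"
        using b pk unfolding bij_betw_def inj_on_def by auto
      ultimately have b': "bij_betw p (?k ` F) (K - {c})" using b unfolding bij_betw_def by simp
      have kF: "?k ` F \<subseteq> E" using F kE by auto
      have "\<exists>!f. f \<in> E \<and> p f = c \<and> insert f (?k ` F) \<in> B" by (rule lifting[OF K1 K(2,3) kF b'])
      then obtain f where f: "f \<in> E" "p f = c" "insert f (?k ` F) \<in> B"
        and uniq: "\<And>g. g \<in> E \<Longrightarrow> p g = c \<Longrightarrow> insert g (?k ` F) \<in> B \<Longrightarrow> g = f" by blast
      show ?thesis
      proof (rule ex1I[of _ "j f"])
        show "j f \<in> j ` E \<and> p' (j f) = c \<and> insert (j f) F \<in> (`) j ` B"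
          using f p' bal[of "insert (j f) F"] F k by simp
        fix g assume g: "g \<in> j ` E \<and> p' g = c \<and> insert g F \<in> (`) j ` B"
        then have "?k g = f" using uniq[of "?k g"] kE[of g] p'[of "?k g"] bal[of "insert g F"] F by simp
        then show "g = j f" using kE(2)[of g] g by simp
      qed
    qed
  qed
qed

text \<open>Whole fibers are deleted, so a circle of the smaller base keeps all its lifts.\<close>

lemma (in expansion) expansion_delete:
  "expansion {f \<in> E. p f \<notin> X} {C \<in> B. C \<subseteq> {f \<in> E. p f \<notin> X}} p en (D - X) ed"
proof
  let ?E = "{f \<in> E. p f \<notin> X}"
  show "p ` ?E = D - X" using surj by auto
  show "theta_closed en ?E {C \<in> B. C \<subseteq> ?E}"
    using theta unfolding theta_closed_def by (simp add: Ball_def) blast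
  show "\<exists>!f. f \<in> ?E \<and> p f = c \<and> insert f F \<in> {C \<in> B. C \<subseteq> ?E}"
    if K: "circ ed K" "K \<subseteq> D - X" "c \<in> K" and F: "F \<subseteq> ?E" and b: "bij_betw p F (K - {c})" for K c F
  proof -
    have "\<exists>!f. f \<in> E \<and> p f = c \<and> insert f F \<in> B" by (rule lifting[OF K(1) _ K(3) _ b]) (use K F in auto)
    moreover have "f \<in> ?E \<and> p f = c \<and> insert f F \<in> {C \<in> B. C \<subseteq> ?E} \<longleftrightarrow> f \<in> E \<and> p f = c \<and> insert f F \<in> B" for f
      using K(2,3) F by blast
    ultimately show ?thesis by simp
  qed
qed (use ends_proj bal_circ no_digon in auto)

section \<open>Contracting a path on one side\<close>

text \<open>
  The edge \<open>e0\<close> followed by the projection of \<open>T\<close> is a path from \<open>u\<close> to \<open>v\<close> through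
  \<open>w\<close> that avoids \<open>e\<close>.
\<close>

locale contraction = amalgam E1 B1 E2 B2 p en D1 D2 ed V1 V2 u v e
  for E1 :: "'a set" and B1 and E2 and B2 and p :: "'a \<Rightarrow> 'd" and en :: "'a \<Rightarrow> 'v set"
    and D1 and D2 and ed and V1 and V2 and u v and e +
  fixes T :: "'a set" and e0 :: 'd and w :: 'v and N :: "'v set"
  assumes e0: "e0 \<in> D2" "e0 \<noteq> e" "ed e0 = {u, w}"
    and T: "pth en w N T v" "T \<subseteq> E2" "inj_on p T" "e \<notin> p ` T" "e0 \<notin> p ` T" and u_notin: "u \<notin> N"
begin

interpretation s: amalgam E2 B2 E1 B1 p en D2 D1 ed V2 V1 u v e by (rule swap)

lemma e0_notin: "e0 \<notin> D1"
  using e0 D12 by blast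

lemma T_side: "T \<subseteq> E2 - E1"
proof
  fix t assume "t \<in> T"
  then show "t \<in> E2 - E1" using T(2,4) shared_iff2[of t] by auto
qed

lemma T_edges: "t \<in> T \<Longrightarrow> p t \<noteq> e" "t \<in> T \<Longrightarrow> p t \<noteq> e0"
  using T(4,5) by auto

lemma w_mem: "w \<in> N" "v \<in> N" "w \<noteq> u"
  using pth_endpoints[OF T(1)] u_notin by auto

lemma N_sub: "N \<subseteq> V2"
proof -
  have "w \<in> V2" using d.ends2[OF e0(1)] e0(3) by auto
  then show ?thesis using pth_nodes[OF T(1)] T(2) g.ends2 by blast
qed

lemma base_path: "pth ed u (insert u N) (insert e0 (p ` T)) v"
  using pth.Cons[OF e0(3) e2.pth_proj(1)[OF T(1,2)] u_notin] .

lemma base_circ: "circ ed (insert e (insert e0 (p ` T)))"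
  using circI[OF ends_e _ base_path] T(4) e0(2) by auto

lemma base_circ_sub: "insert e (insert e0 (p ` T)) \<subseteq> D2"
  using T(2) e2.proj_mem e0 D12 by blast

lemma lift_e0:
  assumes "f \<in> E2" "p f = e"
  shows "\<exists>!h. h \<in> E2 \<and> p h = e0 \<and> insert h (insert f T) \<in> B2"
proof (rule e2.lifting[OF base_circ base_circ_sub])
  show "bij_betw p (insert f T) (insert e (insert e0 (p ` T)) - {e0})"
    using assms T e0(2) by (auto simp: bij_betw_def)
qed (use assms T in auto)

text \<open>Converse of \<open>lift_e0\<close>, with the edge over \<open>e0\<close> given: it is
  what makes \<open>shift\<close> injective on the fiber over \<open>e\<close> and onto the fiber
  over \<open>e0\<close>.\<close>

lemma lift_e:
  assumes "h \<in> E2" "p h = e0"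
  shows "\<exists>!f. f \<in> E2 \<and> p f = e \<and> insert h (insert f T) \<in> B2"
proof -
  have "\<exists>!f. f \<in> E2 \<and> p f = e \<and> insert f (insert h T) \<in> B2"
  proof (rule e2.lifting[OF base_circ base_circ_sub])
    show "bij_betw p (insert h T) (insert e (insert e0 (p ` T)) - {e})"
      using assms T e0(2) by (auto simp: bij_betw_def)
  qed (use assms T in auto)
  then show ?thesis by (simp add: insert_commute)
qed

text \<open>
  An edge over \<open>e\<close> is sent to the edge over \<open>e0\<close> that balances the circle through \<open>T\<close>;
  the choice is well-defined by circle lifting (only on the fiber over \<open>e\<close>).
\<close>

definition shift :: "'a \<Rightarrow> 'a" where
  "shift f = (if p f = e then THE h. h \<in> E2 \<and> p h = e0 \<and> insert h (insert f T) \<in> B2 else f)"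

lemma shift_fixed: "p f \<noteq> e \<Longrightarrow> shift f = f"
  by (simp add: shift_def)

lemma shift_fiber:
  assumes "f \<in> E1" "p f = e"
  shows "shift f \<in> E2" "p (shift f) = e0" "insert (shift f) (insert f T) \<in> B2"
  using theI'[OF lift_e0[OF fiber1[OF assms] assms(2)]] assms(2) unfolding shift_def by auto

lemma shift_fiber_unique:
  assumes "f \<in> E1" "p f = e" "h \<in> E2" "p h = e0" "insert h (insert f T) \<in> B2"
  shows "h = shift f"
  using lift_e0[OF fiber1[OF assms(1,2)] assms(2)] shift_fiber[OF assms(1,2)] assms by blast

lemma proj_shift: "f \<in> E1 \<Longrightarrow> p (shift f) = (if p f = e then e0 else p f)"
  using shift_fixed shift_fiber by simp

lemma proj_shift_iff: "f \<in> E1 \<Longrightarrow> g \<in> E1 \<Longrightarrow> p (shift f) = p (shift g) \<longleftrightarrow> p f = p g"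
  using proj_shift[of f] proj_shift[of g] e1.proj_mem[of f] e1.proj_mem[of g] e0_notin by auto

lemma shift_cases:
  assumes "f \<in> E1"
  obtains "p f \<noteq> e" "shift f = f" "f \<in> E1 - E2"
  | "p f = e" "shift f \<in> E2 - E1" "p (shift f) = e0"
proof (cases "p f = e")
  case True
  have "shift f \<notin> E1" using e1.proj_mem[of "shift f"] shift_fiber(2)[OF assms True] e0_notin by auto
  then show ?thesis using that(2) shift_fiber[OF assms True] True by simp
next
  case False
  then show ?thesis using that(1) shift_fixed shared_iff1[of f] assms by blast
qed

lemma shift_inj: "inj_on shift E1"
proof (rule inj_onI)
  fix f g assume fg: "f \<in> E1" "g \<in> E1" "shift f = shift g"
  then have eq: "p f = p g" using proj_shift_iff by metis
  show "f = g"
  proof (cases "p f = e")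
    case True
    have g: "p g = e" using eq True by simp
    show ?thesis
      using lift_e[OF shift_fiber(1,2)[OF fg(1) True]] shift_fiber(3)[OF fg(1) True] shift_fiber(3)[OF fg(2) g]
        fiber1[OF fg(1) True] fiber1[OF fg(2) g] True g fg(3) by auto
  next
    case False
    then show ?thesis using fg eq shift_fixed by simp
  qed
qed

text \<open>The right-hand side is the edge set that survives when the fibers over
  \<open>D1 - {e}\<close> and over \<open>e0\<close> are kept, so \<open>shift\<close> can serve as
  the edge part of the isomorphism.\<close>

lemma shift_image: "shift ` E1 = {f \<in> E1 \<union> E2. p f \<noteq> e \<and> p f \<in> insert e0 (D1 - {e})}" (is "_ = ?S")
proof (rule equalityI; rule subsetI)
  fix h assume "h \<in> shift ` E1"
  then obtain f where f: "f \<in> E1" "h = shift f" by blast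
  show "h \<in> ?S"
    using f(1) by (cases rule: shift_cases) (use f e1.proj_mem e0 in auto)
next
  fix h assume h: "h \<in> ?S"
  show "h \<in> shift ` E1"
  proof (cases "p h = e0")
    case True
    then have h2: "h \<in> E2" using h e1.proj_mem e0_notin by blast
    obtain f where f: "f \<in> E2" "p f = e" "insert h (insert f T) \<in> B2" using lift_e[OF h2 True] by blast
    have "h = shift f" using shift_fiber_unique[OF fiber2[OF f(1,2)] f(2) h2 True f(3)] .
    then show ?thesis using fiber2[OF f(1,2)] by blast
  next
    case False
    then have "h \<in> E1" "p h \<noteq> e" using h proj_sides by auto
    then show ?thesis using shift_fixed by force
  qed
qed

text \<open>The node class of \<open>x\<close> when \<open>T\<close> is contracted.\<close>

definition cls :: "'v \<Rightarrow> 'v set" where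
  "cls x = (if x \<in> N then N else {x})"

text \<open>\<open>N\<close> lies on side 2 and misses \<open>u\<close>, so it meets side 1 in
  \<open>v\<close> alone; contracting \<open>T\<close> therefore merges no two nodes of side
  1.\<close>

lemma cls_inj: "inj_on cls V1"
proof (rule inj_onI)
  fix x y assume xy: "x \<in> V1" "y \<in> V1" "cls x = cls y"
  have *: "z = v" if "z \<in> V1" "z \<in> N" for z
  proof -
    have "z \<in> V1 \<inter> V2" using that N_sub by blast
    then show ?thesis using that(2) u_notin d.V12 by auto
  qed
  show "x = y"
  proof (cases "x \<in> N \<or> y \<in> N")
    case True
    then have "x \<in> N" "y \<in> N" using xy(3) unfolding cls_def by (auto split: if_splits)
    then show ?thesis using *[of x] *[of y] xy by simp
  qed (use xy in \<open>simp add: cls_def\<close>)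
qed

text \<open>Only edges over \<open>e\<close> move. Their images run from \<open>u\<close> to
  \<open>w\<close> instead of from \<open>u\<close> to \<open>v\<close>, and \<open>w\<close> and
  \<open>v\<close> fall into the same class.\<close>

lemma cls_shift:
  assumes "f \<in> E1"
  shows "cls ` en (shift f) = cls ` en f"
  using assms
proof (cases rule: shift_cases)
  case 2
  have "en (shift f) = {u, w}" using e2.ends_proj[of "shift f"] 2 e0 by simp
  moreover have "en f = {u, v}" using e1.ends_proj[OF assms] 2(1) ends_e by simp
  moreover have "cls w = cls v" using w_mem by (simp add: cls_def)
  ultimately show ?thesis by simp
qed simp

text \<open>A circle \<open>C\<close> without an edge over \<open>e\<close> is its own witness. If
  it has such an edge \<open>f\<close>, trade \<open>f\<close> for the arc consisting of
  \<open>shift f\<close> and \<open>T\<close>, which \<open>f\<close> closes.\<close>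

lemma shift_bal_forward:
  assumes C: "C \<in> B1"
  shows "\<exists>A\<in>glue B1 B2. A \<subseteq> {f \<in> E1 \<union> E2. p f \<noteq> e} \<and> A \<subseteq> shift ` C \<union> T \<and> A - T = shift ` C"
proof (cases "\<exists>f\<in>C. p f = e")
  case False
  have CE: "C \<subseteq> E1" using e1.bal_edges[OF C] .
  then have "shift ` C = C" using False shift_fixed by (auto simp: image_iff)
  moreover have "C \<inter> T = {}" using CE T_side by blast
  moreover have "C \<in> glue B1 B2" using C by (simp add: glue_def)
  ultimately show ?thesis using CE False by (intro bexI[of _ C]) auto
next
  case True
  have CE: "C \<subseteq> E1" using e1.bal_edges[OF C] .
  obtain f where f: "f \<in> C" "p f = e" using True by blast
  have f1: "f \<in> E1" "f \<in> E2" using f CE fiber1 by auto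
  define A where "A = C - {f}"
  have CA: "C = insert f A" using f by (auto simp: A_def)
  have A: "A \<subseteq> E1 - E2" using shared_unique[OF C f(1) _ f1(2)] CE unfolding A_def by blast
  have Ane: "A \<noteq> {}" using bal_not_shared[OF C] f1 CA by auto
  have Afix: "shift ` A = A"
  proof -
    have "p a \<noteq> e" if "a \<in> A" for a using that A fiber1 by blast
    then show ?thesis using shift_fixed by (auto simp: image_iff)
  qed
  note h = shift_fiber[OF f1(1) f(2)]
  have hE: "shift f \<notin> E1" using e1.proj_mem[of "shift f"] h(2) e0_notin by auto
  have R: "insert (shift f) T \<subseteq> E2 - E1" using T_side h(1) hE by blast
  have "insert f (insert (shift f) T) \<in> B2" using h(3) by (simp add: insert_commute)
  then have bal: "A \<union> insert (shift f) T \<in> glue B1 B2"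
    using glue_mixed[OF A Ane R] f1 C unfolding CA by blast
  have img: "shift ` C = insert (shift f) A" unfolding CA using Afix by simp
  have disj: "A \<inter> T = {}" "shift f \<notin> T" using A T_side T_edges h(2) by auto
  have "p a \<noteq> e" if a: "a \<in> A \<union> insert (shift f) T" for a
  proof -
    consider "a \<in> A" | "a = shift f" | "a \<in> T" using a by blast
    then show ?thesis using A fiber1[of a] h(2) e0(2) T_edges(1)[of a] by cases auto
  qed
  then show ?thesis
    using bal img disj A R by (intro bexI[of _ "A \<union> insert (shift f) T"]) auto
qed

text \<open>A witness \<open>A\<close> on side 1 is \<open>C\<close> itself, and none lies on side
  2, where \<open>A\<close> would project into a path. If \<open>A\<close> crosses the cut, its arc
  \<open>R\<close> on side 2 must be \<open>T\<close> with one edge over \<open>e0\<close>, and by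
  \<open>lift_e\<close> the closing edge of \<open>R\<close> is the edge of \<open>C\<close> that
  \<open>shift\<close> moved there.\<close>

lemma shift_bal_backward:
  assumes C: "C \<subseteq> E1" "C \<noteq> {}"
    and A: "A \<in> glue B1 B2" "A \<subseteq> shift ` C \<union> T" "A - T = shift ` C"
  shows "C \<in> B1"
proof -
  have img: "p a = e0" if a: "a \<in> shift ` C" "a \<in> E2" for a
  proof -
    obtain c where c: "c \<in> C" "a = shift c" using a(1) by blast
    have "c \<in> E1" using c C by blast
    then show ?thesis by (cases rule: shift_cases) (use a c in auto)
  qed
  have proj: "p a \<in> insert e0 (p ` T)" if "a \<in> A" "a \<in> E2" for a
    using that img[of a] A(2) by blast
  show ?thesis
    using A(1)
  proof (cases rule: glue_cases)
    case 1
    have A1: "A \<subseteq> E1" using e1.bal_edges[OF 1] .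
    then have "A = shift ` C" using A(3) T_side by blast
    moreover have "shift c = c" if "c \<in> C" for c
    proof -
      have c: "c \<in> E1" "shift c \<in> E1" using that C A1 \<open>A = shift ` C\<close> by auto
      show ?thesis using c(1) by (cases rule: shift_cases) (use c in auto)
    qed
    ultimately have "A = C" by (simp add: image_iff)
    then show ?thesis using 1 by simp
  next
    case 2
    have "p ` A \<subseteq> insert e0 (p ` T)" using proj e2.bal_edges[OF 2] by blast
    then show ?thesis using circ_not_in_pth[OF base_path e2.bal_proj(1)[OF 2]] by blast
  next
    case (3 X R f)
    have f: "p f = e" using shared_iff1[of f] 3 by simp
    have "R \<subseteq> E2" using 3 by blast
    then have "p ` insert f R \<subseteq> insert e (insert e0 (p ` T))" using proj 3(1) f by auto
    \<comment> \<open>A circle contained in another is equal to it, so \<open>R\<close> has an edge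
      over \<open>e0\<close> and an edge over every edge of the projection of
      \<open>T\<close>.\<close>
    then have eq: "p ` insert f R = insert e (insert e0 (p ` T))"
      using circ_nested[OF e2.bal_proj(1)[OF 3(7)] base_circ] by simp
    have inj: "inj_on p (insert f R)" using e2.bal_inj[OF 3(7)] .
    obtain r where r: "r \<in> R" "p r = e0" using eq f e0(2) by (auto simp: set_eq_iff image_iff)
    have "r \<notin> T" using r T_edges by blast
    then have "r \<in> shift ` C" using r A(2) 3(1) by blast
    then obtain c where c: "c \<in> C" "r = shift c" by blast
    have c1: "c \<in> E1" using c C by blast
    have ce: "p c = e" using r c(2) proj_shift[OF c1] e1.proj_mem[OF c1] e0_notin by (auto split: if_splits)
    have RT: "R \<subseteq> insert r T"
    proof
      fix a assume a: "a \<in> R"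
      show "a \<in> insert r T"
      proof (cases "a \<in> T")
        case False
        then have "a \<in> shift ` C" using a A(2) 3(1) by blast
        then have "p a = p r" using img a 3(3) r by auto
        then show ?thesis using inj a r unfolding inj_on_def by blast
      qed simp
    qed
    have TR: "T \<subseteq> R"
    proof
      fix t assume t: "t \<in> T"
      then have "p t \<in> p ` insert f R" using eq by blast
      then obtain a where a: "a \<in> insert f R" "p a = p t" by (metis imageE)
      have "a \<in> T" using a RT f r T_edges[OF t] by auto
      then have "a = t" using T(3) t a(2) by (auto dest: inj_onD)
      then show "t \<in> R" using a f T_edges[OF t] by auto
    qed
    have "R = insert r T" using RT TR r by auto
    then have "insert r (insert f T) \<in> B2" using 3(7) by (simp add: insert_commute)
    moreover have "insert r (insert c T) \<in> B2" using shift_fiber(3)[OF c1 ce] c(2) by simp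
    ultimately have fc: "f = c"
      using lift_e[OF _ r(2)] r(1) \<open>R \<subseteq> E2\<close> 3(5) f ce fiber1[OF c1 ce] by blast
    have "A - T = insert r X"
      using 3(1,2) \<open>R = insert r T\<close> T_side \<open>r \<notin> T\<close> by auto
    then have X: "shift ` C = insert r X" using A(3) by simp
    have Xe: "p a \<noteq> e" if "a \<in> X" for a using that 3(2) fiber1 by blast
    \<comment> \<open>Injectivity of \<open>shift\<close> leaves \<open>f\<close> as the only edge
      of \<open>C\<close> over \<open>e\<close>; all other edges of \<open>C\<close> are fixed by
      \<open>shift\<close>.\<close>
    have "C = insert f X"
    proof (rule equalityI; rule subsetI)
      fix a assume a: "a \<in> C"
      then have a1: "a \<in> E1" and sa: "shift a \<in> insert r X" using C X by auto
      show "a \<in> insert f X"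
      proof (cases "p a = e")
        case True
        have "shift a \<notin> E1" using shift_cases[OF a1] True by blast
        then have "shift a = shift c" using sa 3(2) c(2) by blast
        then show ?thesis using shift_inj a1 c1 fc by (auto dest: inj_onD)
      next
        case False
        then have "shift a = a" "a \<noteq> r" using shift_fixed a1 r(1) 3(3) by auto
        then show ?thesis using sa by simp
      qed
    next
      fix a assume a: "a \<in> insert f X"
      show "a \<in> C"
      proof (cases "a = f")
        case True
        then show ?thesis using c fc by simp
      next
        case False
        then have aX: "a \<in> X" using a by simp
        then obtain b where b: "b \<in> C" "a = shift b" using X by blast
        have "b \<in> E1" using b C by blast
        then show ?thesis by (cases rule: shift_cases) (use b aX 3(2) in auto)
      qed
    qed
    then show ?thesis using 3(6) by simp
  qed
qed

lemma expansion_minor_exists: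
  fixes \<Omega> \<Omega>1 :: "('v, 'a) biased_graph" and \<Delta> :: "('v, 'd) mgraph"
  assumes card: "\<And>d. d \<in> D1 \<Longrightarrow> card (ed d) = 1 \<or> card (ed d) = 2"
    and O: "nodes \<Omega> = V1 \<union> V2" "edges \<Omega> = {f \<in> E1 \<union> E2. p f \<noteq> e}" "ends \<Omega> = en"
      "balanced \<Omega> = {C \<in> glue B1 B2. C \<subseteq> edges \<Omega>}"
    and D: "edges \<Delta> = D1 \<union> D2 - {e}"
    and O1: "nodes \<Omega>1 = V1" "edges \<Omega>1 = E1" "ends \<Omega>1 = en" "balanced \<Omega>1 = B1"
  shows "\<exists>M. expansion_minor \<Omega> p \<Delta> M \<and> expansion_isomorphic \<Omega>1 p M p"
proof -
  \<comment> \<open>\<open>e0\<close> takes the place of the deleted \<open>e\<close>: its fiber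
    plays the part of the fiber over \<open>e\<close> in the recovered expansion.\<close>
  define S where "S = insert e0 (D1 - {e})"
  define G where "G = contract_onto \<Omega> T {f \<in> edges \<Omega>. p f \<in> S}"
  \<comment> \<open>Classes of nodes of side 2 that are neither \<open>u\<close> nor on the
    contracted path; all edges at them are deleted, so they are isolated.\<close>
  define W where "W = nodes G - cls ` V1"
  define M where "M = \<lparr>nodes = nodes G - W, edges = edges G, ends = ends G,
    balanced = {C. is_circle G C \<and> (\<exists>A\<in>balanced \<Omega>. A \<subseteq> C \<union> T \<and> A - T = C)}\<rparr>"
  have ncls: "node_class \<Omega> T x = cls x" if "x \<in> V1 \<union> V2" for x
    unfolding cls_def
    by (rule node_class_pth[of \<Omega> w N T v]) (use that O T N_sub in auto)
  have Gedges: "edges G = shift ` E1"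
    unfolding shift_image G_def contract_onto_def S_def using O(2) by auto
  have Gends: "ends G (shift f) = cls ` en f" if f: "f \<in> E1" for f
  proof -
    have "shift f \<in> E1 \<union> E2" using f by (cases rule: shift_cases) auto
    then have "en (shift f) \<subseteq> V1 \<union> V2" using g.ends1 g.ends2 by blast
    then have "node_class \<Omega> T ` en (shift f) = cls ` en (shift f)" using ncls by (intro image_cong) auto
    then show ?thesis unfolding cls_shift[OF f, symmetric] by (simp add: G_def contract_onto_def O(3))
  qed
  have Gnodes: "nodes G = cls ` (V1 \<union> V2)"
    unfolding G_def contract_onto_def using ncls O(1) by (auto simp: image_iff)
  have en1: "en f \<subseteq> V1" if "f \<in> E1" for f using g.ends1 that .
  have G: "is_graph G"
    unfolding is_graph_def
  proof
    fix h assume "h \<in> edges G"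
    then obtain f where f: "f \<in> E1" "h = shift f" using Gedges by auto
    \<comment> \<open>\<open>cls\<close> is injective on side 1, so contraction turns no link into a
      loop.\<close>
    have "card (cls ` en f) = card (en f)" using cls_inj en1[OF f(1)] by (intro card_image) (rule inj_on_subset)
    moreover have "card (en f) = 1 \<or> card (en f) = 2"
      using card[OF e1.proj_mem[OF f(1)]] e1.ends_proj[OF f(1)] by simp
    ultimately show "ends G h \<subseteq> nodes G \<and> (card (ends G h) = 1 \<or> card (ends G h) = 2)"
      using Gends[OF f(1)] f(2) Gnodes en1[OF f(1)] by auto
  qed
  have "ends G h \<subseteq> cls ` V1" if "h \<in> edges G" for h
    using that Gends en1 unfolding Gedges by fastforce
  then have "W \<subseteq> isolated_nodes G"
    unfolding W_def isolated_nodes_def by auto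
  moreover have "edges \<Delta> = S \<union> p ` T \<union> (edges \<Delta> - S - p ` T)"
    unfolding S_def D using e0 T_edges(1) T(2) e2.proj_mem by blast
  moreover have "S \<inter> p ` T = {}" unfolding S_def using T(5) T_edges T(2) e2.proj_mem D12 by blast
  \<comment> \<open>A lifted path contains no circle, so there is nothing to be balanced.\<close>
  moreover have "balanced_lift \<Omega> p (p ` T) T"
    unfolding balanced_lift_def
  proof (intro conjI allI impI)
    show "T \<subseteq> edges \<Omega>" using O(2) T(2) T_edges by auto
    show "bij_betw p T (p ` T)" using T(3) by (simp add: bij_betw_def)
    show "C \<in> balanced \<Omega>" if "is_circle \<Omega> C \<and> C \<subseteq> T" for C
      using circ_not_in_pth[OF T(1)] is_circle_circ[of \<Omega> C] that O(3) by auto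
  qed
  ultimately have minor: "expansion_minor \<Omega> p \<Delta> M"
    unfolding expansion_minor_def Let_def M_def G_def
    by (intro exI[of _ S] exI[of _ "p ` T"] exI[of _ "edges \<Delta> - S - p ` T"] exI[of _ T] exI[of _ W] conjI) auto
  have circle: "is_circle G (shift ` C)" if "C \<in> B1" for C
    unfolding is_circle_iff[OF G]
  proof
    have CE: "C \<subseteq> E1" using e1.bal_edges[OF that] .
    then show "shift ` C \<subseteq> edges G" using Gedges by auto
    show "circ (ends G) (shift ` C)"
    proof (rule circ_image[OF e1.bal_circ[OF that]])
      show "ends G (shift f) = cls ` en f" if "f \<in> C" for f using Gends that CE by blast
      show "inj_on cls (\<Union> (en ` C))" using cls_inj by (rule inj_on_subset) (use CE en1 in blast)
      show "inj_on shift C" using shift_inj CE by (rule inj_on_subset)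
    qed
  qed
  have "C \<in> B1 \<longleftrightarrow> shift ` C \<in> balanced M" if C: "C \<subseteq> E1" for C
  proof
    assume C1: "C \<in> B1"
    then show "shift ` C \<in> balanced M"
      using circle[OF C1] shift_bal_forward[OF C1] unfolding M_def O(2,4) by auto
  next
    assume "shift ` C \<in> balanced M"
    then obtain A where A: "is_circle G (shift ` C)" "A \<in> glue B1 B2" "A \<subseteq> shift ` C \<union> T" "A - T = shift ` C"
      unfolding M_def O(4) by auto
    have "C \<noteq> {}" using circ_nonempty[OF is_circle_circ(2)[OF A(1)]] by auto
    then show "C \<in> B1" using shift_bal_backward[OF C _ A(2-4)] by simp
  qed
  moreover have "bij_betw cls V1 (nodes M)"
    using cls_inj unfolding M_def W_def Gnodes bij_betw_def by auto
  moreover have "bij_betw shift E1 (edges M)"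
    using shift_inj Gedges unfolding M_def bij_betw_def by auto
  moreover have "ends M (shift f) = cls ` en f" if "f \<in> E1" for f
    using Gends[OF that] unfolding M_def by simp
  ultimately have "expansion_isomorphic \<Omega>1 p M p"
    unfolding expansion_isomorphic_def O1 using proj_shift_iff by (intro exI[of _ cls] exI[of _ shift]) auto
  then show ?thesis using minor by blast
qed

end

lemma (in amalgam) minor_of_sum:
  fixes \<Omega> \<Omega>1 :: "('v, 'a) biased_graph" and \<Delta> :: "('v, 'd) mgraph"
  assumes path: "pth ed u N K v" "K \<subseteq> D2 - {e}"
    and card: "\<And>d. d \<in> D1 \<Longrightarrow> card (ed d) = 1 \<or> card (ed d) = 2"
    and O: "nodes \<Omega> = V1 \<union> V2" "edges \<Omega> = {f \<in> E1 \<union> E2. p f \<noteq> e}" "ends \<Omega> = en"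
      "balanced \<Omega> = {C \<in> glue B1 B2. C \<subseteq> edges \<Omega>}"
    and D: "edges \<Delta> = D1 \<union> D2 - {e}"
    and O1: "nodes \<Omega>1 = V1" "edges \<Omega>1 = E1" "ends \<Omega>1 = en" "balanced \<Omega>1 = B1"
  shows "\<exists>M. expansion_minor \<Omega> p \<Delta> M \<and> expansion_isomorphic \<Omega>1 p M p"
  using path(1)
proof cases
  case (Cons e0 w N' L)
  \<comment> \<open>The first edge of the path becomes \<open>e0\<close>; the rest is lifted by an
    arbitrary choice, since every lift of a path is a balanced lift.\<close>
  let ?s = "inv_into E2 p"
  have L: "L \<subseteq> D2" using path(2) Cons by auto
  have s: "?s d \<in> E2" "p (?s d) = d" if "d \<in> L" for d
    using that L e2.surj inv_into_into[of d p E2] f_inv_into_f[of d p E2] by auto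
  then have ps: "p ` ?s ` L = L" by (force simp: image_iff)
  have "pth en w N' (?s ` L) v"
    by (rule pth_map[OF Cons(4)]) (use s e2.ends_proj in auto)
  moreover have "inj_on p (?s ` L)" using s by (auto simp: inj_on_def)
  moreover have "e0 \<notin> L" using pth_ends[OF Cons(4), of e0] Cons by auto
  ultimately interpret contraction E1 B1 E2 B2 p en D1 D2 ed V1 V2 u v e "?s ` L" e0 w N'
    using Cons path(2) s by unfold_locales (auto simp: ps)
  show ?thesis by (rule expansion_minor_exists[OF card O D O1])
qed (use d.uv in simp)

section \<open>Expanded edge amalgamations and sums\<close>

text \<open>The minor is found for a copy of the expansion on the common edge type; the isomorphism
  is pulled back along \<open>j\<close>, which respects the projections.\<close>

lemma expansion_isomorphic_image:
  assumes j: "inj_on j (edges \<Omega>)" and bal: "\<And>C. C \<in> balanced \<Omega> \<Longrightarrow> C \<subseteq> edges \<Omega>"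
    and O': "nodes \<Omega>' = nodes \<Omega>" "edges \<Omega>' = j ` edges \<Omega>" "balanced \<Omega>' = (`) j ` balanced \<Omega>"
      "\<And>f. f \<in> edges \<Omega> \<Longrightarrow> ends \<Omega>' (j f) = ends \<Omega> f"
    and p': "\<And>f. f \<in> edges \<Omega> \<Longrightarrow> p' (j f) = p f"
    and iso: "expansion_isomorphic \<Omega>' p' M q"
  shows "expansion_isomorphic \<Omega> p M q"
proof -
  obtain \<phi> \<psi> where *: "bij_betw \<phi> (nodes \<Omega>') (nodes M)" "bij_betw \<psi> (edges \<Omega>') (edges M)"
    "\<forall>f\<in>edges \<Omega>'. ends M (\<psi> f) = \<phi> ` ends \<Omega>' f"
    "\<forall>C. C \<subseteq> edges \<Omega>' \<longrightarrow> (C \<in> balanced \<Omega>' \<longleftrightarrow> \<psi> ` C \<in> balanced M)"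
    "\<forall>f\<in>edges \<Omega>'. \<forall>g\<in>edges \<Omega>'. p' f = p' g \<longleftrightarrow> q (\<psi> f) = q (\<psi> g)"
    using iso unfolding expansion_isomorphic_def by (elim exE conjE) (rule that)
  have "bij_betw (\<psi> \<circ> j) (edges \<Omega>) (edges M)"
    using *(2) inj_on_imp_bij_betw[OF j] unfolding O'(2) by (intro bij_betw_trans)
  moreover have "C \<in> balanced \<Omega> \<longleftrightarrow> (\<psi> \<circ> j) ` C \<in> balanced M" if C: "C \<subseteq> edges \<Omega>" for C
  proof -
    have "C \<in> balanced \<Omega> \<longleftrightarrow> j ` C \<in> balanced \<Omega>'"
      unfolding O'(3) using inj_on_image_mem_iff[OF inj_on_image_Pow[OF j], of C "balanced \<Omega>"] C bal by auto
    also have "\<dots> \<longleftrightarrow> (\<psi> \<circ> j) ` C \<in> balanced M"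
      using *(4)[rule_format, of "j ` C"] C O'(2) by (auto simp: image_comp)
    finally show ?thesis .
  qed
  moreover have "ends M ((\<psi> \<circ> j) f) = \<phi> ` ends \<Omega> f" if "f \<in> edges \<Omega>" for f
    using *(3)[rule_format, of "j f"] O' that by simp
  moreover have "p f = p g \<longleftrightarrow> q ((\<psi> \<circ> j) f) = q ((\<psi> \<circ> j) g)" if "f \<in> edges \<Omega>" "g \<in> edges \<Omega>" for f g
    using *(5)[rule_format, of "j f" "j g"] O'(2) p' that by simp
  ultimately show ?thesis
    unfolding expansion_isomorphic_def using *(1) O'(1)
    by (intro exI[of _ \<phi>] exI[of _ "\<psi> \<circ> j"]) auto
qed

locale gluing =
  fixes \<Delta>1 \<Delta>2 :: "('v, 'e) mgraph" and e :: 'e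
    and \<Omega>1 :: "('v, 'f) biased_graph" and p1 :: "'f \<Rightarrow> 'e"
    and \<Omega>2 :: "('v, 'g) biased_graph" and p2 :: "'g \<Rightarrow> 'e"
    and \<beta> :: "'f \<Rightarrow> 'g" and u v :: 'v
  assumes share: "share_exactly_link \<Delta>1 \<Delta>2 e"
    and exp1: "biased_expansion \<Omega>1 p1 \<Delta>1" and exp2: "biased_expansion \<Omega>2 p2 \<Delta>2"
    and bij: "bij_betw \<beta> (fiber \<Omega>1 p1 e) (fiber \<Omega>2 p2 e)"
    and uv: "ends \<Delta>1 e = {u, v}" "u \<noteq> v"
begin

abbreviation "j \<equiv> glue2 \<Omega>1 p1 \<Omega>2 p2 e \<beta>"
abbreviation "p \<equiv> case_sum p1 p2"
abbreviation "en \<equiv> case_sum (ends \<Omega>1) (ends \<Omega>2)"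
abbreviation "ed \<equiv> ends (edge_amalgamation \<Delta>1 \<Delta>2)"
abbreviation "am \<equiv> expanded_edge_amalgamation \<Omega>1 p1 \<Omega>2 p2 e \<beta>"

sublocale x1: expansion "edges \<Omega>1" "balanced \<Omega>1" p1 "ends \<Omega>1" "edges \<Delta>1" "ends \<Delta>1"
  using exp1 by (simp add: biased_expansion_iff)

sublocale x2: expansion "edges \<Omega>2" "balanced \<Omega>2" p2 "ends \<Omega>2" "edges \<Delta>2" "ends \<Delta>2"
  using exp2 by (simp add: biased_expansion_iff)

lemma graphs: "is_graph \<Delta>1" "is_graph \<Delta>2" "nodes \<Omega>1 = nodes \<Delta>1" "nodes \<Omega>2 = nodes \<Delta>2"
  using exp1 exp2 by (simp_all add: biased_expansion_iff)

lemma shared: "ends \<Delta>2 e = {u, v}" "edges \<Delta>1 \<inter> edges \<Delta>2 = {e}" "nodes \<Delta>1 \<inter> nodes \<Delta>2 = {u, v}"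
  using share uv by (simp_all add: share_exactly_link_def)

lemma ed1: "d \<in> edges \<Delta>1 \<Longrightarrow> ed d = ends \<Delta>1 d"
  by (simp add: edge_amalgamation_def)

text \<open>The amalgamation reads the ends of the shared edge from \<Delta>1; they agree with those
  in \<Delta>2.\<close>

lemma ed2: "d \<in> edges \<Delta>2 \<Longrightarrow> ed d = ends \<Delta>2 d"
proof (cases "d = e")
  case True
  then show ?thesis using uv shared by (simp add: edge_amalgamation_def)
next
  case False
  then show "d \<in> edges \<Delta>2 \<Longrightarrow> ed d = ends \<Delta>2 d" using shared(2) by (auto simp: edge_amalgamation_def)
qed

lemma glue_fiber: "f \<in> fiber \<Omega>1 p1 e \<Longrightarrow> j (\<beta> f) = Inl f"
  using bij unfolding glue2_def by (auto simp: bij_betw_def)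

lemma glue_cases2:
  assumes "g \<in> edges \<Omega>2"
  obtains f where "f \<in> fiber \<Omega>1 p1 e" "g = \<beta> f" "p2 g = e" "j g = Inl f"
  | "p2 g \<noteq> e" "j g = Inr g"
proof (cases "p2 g = e")
  case True
  then have "g \<in> \<beta> ` fiber \<Omega>1 p1 e" using assms bij by (simp add: bij_betw_def fiber_def)
  then show ?thesis using that(1) glue_fiber True by blast
next
  case False
  then show ?thesis using that(2) by (simp add: glue2_def fiber_def)
qed

lemma glue_inj: "inj_on j (edges \<Omega>2)"
proof (rule inj_onI)
  fix g h assume "g \<in> edges \<Omega>2" "h \<in> edges \<Omega>2" "j g = j h"
  then show "g = h" by (elim glue_cases2) auto
qed

lemma glue_eq_InlD: "g \<in> edges \<Omega>2 \<Longrightarrow> j g = Inl f \<Longrightarrow> f \<in> fiber \<Omega>1 p1 e \<and> g = \<beta> f"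
  by (elim glue_cases2) auto

lemma p_j: "g \<in> edges \<Omega>2 \<Longrightarrow> p (j g) = p2 g"
  by (elim glue_cases2) (auto simp: fiber_def)

lemma en_j:
  assumes "g \<in> edges \<Omega>2"
  shows "en (j g) = ends \<Omega>2 g"
  using assms
proof (cases rule: glue_cases2)
  case (1 f)
  then show ?thesis
    using x1.ends_proj[of f] x2.ends_proj[OF assms] uv shared by (simp add: fiber_def)
qed simp

sublocale amalgam "Inl ` edges \<Omega>1" "(`) Inl ` balanced \<Omega>1" "j ` edges \<Omega>2" "(`) j ` balanced \<Omega>2"
  p en "edges \<Delta>1" "edges \<Delta>2" ed "nodes \<Delta>1" "nodes \<Delta>2" u v e
proof (intro amalgam.intro amalgam_axioms.intro)
  show "expansion (Inl ` edges \<Omega>1) ((`) Inl ` balanced \<Omega>1) p en (edges \<Delta>1) ed"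
    by (rule expansion_image[OF x1.expansion_axioms]) (auto simp: ed1)
  show "expansion (j ` edges \<Omega>2) ((`) j ` balanced \<Omega>2) p en (edges \<Delta>2) ed"
    by (rule expansion_image[OF x2.expansion_axioms glue_inj]) (auto simp: ed2 p_j en_j)
  show "two_sum ed (edges \<Delta>1) (edges \<Delta>2) (nodes \<Delta>1) (nodes \<Delta>2) u v"
  proof
    show "ed f = {u, v}" if "f \<in> edges \<Delta>1" "f \<in> edges \<Delta>2" for f
      using that shared uv ed1[of f] by auto
    show "ed f \<subseteq> nodes \<Delta>1" if "f \<in> edges \<Delta>1" for f
      using ed1[OF that] graphs(1) that by (simp add: is_graph_def)
    show "ed f \<subseteq> nodes \<Delta>2" if "f \<in> edges \<Delta>2" for f
      using ed2[OF that] graphs(2) that by (simp add: is_graph_def)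
  qed (use uv shared in auto)
  show "f \<in> j ` edges \<Omega>2" if f: "f \<in> Inl ` edges \<Omega>1" "p f = e" for f
  proof -
    obtain x where x: "x \<in> fiber \<Omega>1 p1 e" "f = Inl x" using f by (auto simp: fiber_def)
    have "\<beta> x \<in> edges \<Omega>2" using bij x(1) by (auto simp: bij_betw_def fiber_def)
    then show ?thesis using glue_fiber[OF x(1)] x(2) by (metis imageI)
  qed
  show "f \<in> Inl ` edges \<Omega>1" if f: "f \<in> j ` edges \<Omega>2" "p f = e" for f
  proof -
    obtain g where g: "g \<in> edges \<Omega>2" "f = j g" using f(1) by blast
    show ?thesis using g(1) by (cases rule: glue_cases2) (use g f p_j in \<open>auto simp: fiber_def\<close>)
  qed
qed (rule shared(2))

section \<open>The concrete constructions as instances of the gluing\<close>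

lemma am_sel: "nodes am = nodes \<Delta>1 \<union> nodes \<Delta>2" "edges am = Inl ` edges \<Omega>1 \<union> j ` edges \<Omega>2" "ends am = en"
  by (simp_all add: expanded_edge_amalgamation_def Let_def graphs)

text \<open>An identified edge is an \<open>Inl f\<close> that also lies in the image of
  \<open>j\<close>. By \<open>glue_eq_InlD\<close> this happens only for \<open>f\<close> in the
  fiber over \<open>e\<close> and only through \<open>\<beta> f\<close>, so naming the fiber and
  sharing an edge describe the same circles.\<close>

lemma am_balanced: "balanced am = glue ((`) Inl ` balanced \<Omega>1) ((`) j ` balanced \<Omega>2)"
proof -
  have "(\<exists>C1 C2 f. X = (Inl ` C1 \<union> j ` C2) - {Inl f} \<and> C1 \<in> balanced \<Omega>1 \<and> C2 \<in> balanced \<Omega>2 \<and>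
      f \<in> fiber \<Omega>1 p1 e \<and> f \<in> C1 \<and> \<beta> f \<in> C2) \<longleftrightarrow>
    (\<exists>C1 C2 f. X = (C1 \<union> C2) - {f} \<and> C1 \<in> (`) Inl ` balanced \<Omega>1 \<and> C2 \<in> (`) j ` balanced \<Omega>2 \<and>
      f \<in> C1 \<and> f \<in> C2)" (is "?L \<longleftrightarrow> ?R") for X
  proof
    assume ?L
    then obtain C1 C2 f where *: "X = (Inl ` C1 \<union> j ` C2) - {Inl f}" "C1 \<in> balanced \<Omega>1" "C2 \<in> balanced \<Omega>2"
      "f \<in> fiber \<Omega>1 p1 e" "f \<in> C1" "\<beta> f \<in> C2" by blast
    then have "Inl f \<in> j ` C2" using glue_fiber by (metis imageI)
    then show ?R using * by blast
  next
    assume ?R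
    then obtain C1 C2 h where *: "X = (Inl ` C1 \<union> j ` C2) - {h}" "C1 \<in> balanced \<Omega>1" "C2 \<in> balanced \<Omega>2"
      "h \<in> Inl ` C1" "h \<in> j ` C2" by blast
    obtain f where f: "f \<in> C1" "h = Inl f" using *(4) by blast
    obtain g where g: "g \<in> C2" "h = j g" using *(5) by blast
    have "g \<in> edges \<Omega>2" using x2.bal_edges *(3) g by blast
    then have "f \<in> fiber \<Omega>1 p1 e" "g = \<beta> f" using glue_eq_InlD[of g f] f g by auto
    then show ?L using *(1-3) f g by (intro exI[of _ C1] exI[of _ C2] exI[of _ f]) simp
  qed
  then show ?thesis
    by (simp add: expanded_edge_amalgamation_def Let_def glue_def)
qed

lemma graph_amalgamation: "is_graph (edge_amalgamation \<Delta>1 \<Delta>2)"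
  using graphs(1,2) unfolding is_graph_def edge_amalgamation_def by auto

lemma amalgamation_expansion: "biased_expansion am p (edge_amalgamation \<Delta>1 \<Delta>2)"
  unfolding biased_expansion_iff am_sel am_balanced
  using graph_amalgamation expansion_glue by (simp add: edge_amalgamation_def)

lemma sum_sel:
  defines "sm \<equiv> expanded_edge_sum \<Omega>1 p1 \<Omega>2 p2 e \<beta>"
  shows "nodes sm = nodes \<Delta>1 \<union> nodes \<Delta>2" "edges sm = {f \<in> Inl ` edges \<Omega>1 \<union> j ` edges \<Omega>2. p f \<noteq> e}"
    "ends sm = en"
    "balanced sm = {C \<in> glue ((`) Inl ` balanced \<Omega>1) ((`) j ` balanced \<Omega>2). C \<subseteq> edges sm}"
proof -
  show E: "edges sm = {f \<in> Inl ` edges \<Omega>1 \<union> j ` edges \<Omega>2. p f \<noteq> e}"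
    unfolding sm_def expanded_edge_sum_def delete_edges_def Let_def
    by (simp add: am_sel fiber_def) blast
  show "nodes sm = nodes \<Delta>1 \<union> nodes \<Delta>2" "ends sm = en"
    unfolding sm_def expanded_edge_sum_def delete_edges_def Let_def by (simp_all add: am_sel)
  have "C \<inter> fiber am p e = {} \<longleftrightarrow> C \<subseteq> edges sm" if "C \<in> balanced am" for C
    using glue_edges[of C] that unfolding am_balanced fiber_def am_sel E by blast
  then show "balanced sm = {C \<in> glue ((`) Inl ` balanced \<Omega>1) ((`) j ` balanced \<Omega>2). C \<subseteq> edges sm}"
    unfolding sm_def expanded_edge_sum_def delete_edges_def Let_def
    by (auto simp: am_balanced)
qed

lemma edge_sum_sel: "nodes (edge_sum \<Delta>1 \<Delta>2 e) = nodes \<Delta>1 \<union> nodes \<Delta>2"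
  "edges (edge_sum \<Delta>1 \<Delta>2 e) = edges \<Delta>1 \<union> edges \<Delta>2 - {e}" "ends (edge_sum \<Delta>1 \<Delta>2 e) = ed"
  by (simp_all add: edge_sum_def edge_amalgamation_def)

lemma sum_expansion:
  "biased_expansion (expanded_edge_sum \<Omega>1 p1 \<Omega>2 p2 e \<beta>) p (edge_sum \<Delta>1 \<Delta>2 e)"
proof -
  interpret G: expansion "Inl ` edges \<Omega>1 \<union> j ` edges \<Omega>2" "glue ((`) Inl ` balanced \<Omega>1) ((`) j ` balanced \<Omega>2)"
    p en "edges \<Delta>1 \<union> edges \<Delta>2" ed by (rule expansion_glue)
  have "is_graph (edge_sum \<Delta>1 \<Delta>2 e)"
    using graph_amalgamation unfolding is_graph_def edge_sum_def by (simp add: edge_amalgamation_def)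
  then show ?thesis
    unfolding biased_expansion_iff sum_sel edge_sum_sel
    using G.expansion_delete[of "{e}"] by simp
qed

lemma amalgamation_subgraph1: "biased_subgraph_via Inl \<Omega>1 am"
proof -
  have "C \<in> balanced \<Omega>1 \<longleftrightarrow> Inl ` C \<in> balanced am" if C: "C \<subseteq> edges \<Omega>1" for C
  proof -
    have "Inl ` C \<in> (`) (Inl :: 'f \<Rightarrow> 'f + 'g) ` balanced \<Omega>1 \<longleftrightarrow> C \<in> balanced \<Omega>1"
      by (simp add: inj_image_eq_iff image_iff)
    moreover have "Inl ` C \<subseteq> (Inl :: 'f \<Rightarrow> 'f + 'g) ` edges \<Omega>1" using C by (rule image_mono)
    ultimately show ?thesis using glue1 unfolding am_balanced by simp
  qed
  then show ?thesis
    unfolding biased_subgraph_via_def am_sel by (auto simp: graphs)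
qed

lemma amalgamation_subgraph2: "biased_subgraph_via j \<Omega>2 am"
proof -
  interpret s: amalgam "j ` edges \<Omega>2" "(`) j ` balanced \<Omega>2" "Inl ` edges \<Omega>1" "(`) Inl ` balanced \<Omega>1"
    p en "edges \<Delta>2" "edges \<Delta>1" ed "nodes \<Delta>2" "nodes \<Delta>1" u v e by (rule swap)
  have "C \<in> balanced \<Omega>2 \<longleftrightarrow> j ` C \<in> balanced am" if C: "C \<subseteq> edges \<Omega>2" for C
  proof -
    have "C \<in> balanced \<Omega>2 \<longleftrightarrow> j ` C \<in> (`) j ` balanced \<Omega>2"
      using inj_on_image_mem_iff[OF inj_on_image_Pow[OF glue_inj], of C "balanced \<Omega>2"] C x2.bal_edges by auto
    also have "\<dots> \<longleftrightarrow> j ` C \<in> balanced am"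
      unfolding am_balanced glue_commute[of "(`) Inl ` balanced \<Omega>1"]
      by (rule s.glue1[symmetric]) (use C in blast)
    finally show ?thesis .
  qed
  then show ?thesis
    unfolding biased_subgraph_via_def am_sel using glue_inj en_j by (auto simp: graphs)
qed

text \<open>The path to be contracted lies in the other base graph, hence the conditions on
  \<Delta>2 for recovering \<Omega>1. The copy \<open>\<Omega>'\<close> of \<Omega>1 has the edge
  type of the sum, as \<open>minor_of_sum\<close> demands.\<close>

lemma sum_minor1:
  assumes "two_connected \<Delta>2" "at_least_three_nodes \<Delta>2"
  shows "\<exists>M. expansion_minor (expanded_edge_sum \<Omega>1 p1 \<Omega>2 p2 e \<beta>) p (edge_sum \<Delta>1 \<Delta>2 e) M \<and>
    expansion_isomorphic \<Omega>1 p1 M p"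
proof -
  have "u \<in> nodes \<Delta>2" "v \<in> nodes \<Delta>2" using shared(3) by auto
  then obtain N K where K: "pth (ends \<Delta>2) u N K v" "K \<subseteq> edges \<Delta>2 - {e}"
    using two_connected_avoiding_path[OF assms shared(1) uv(2)] by blast
  have "pth ed u N K v" by (rule pth_cong[OF K(1)]) (use K(2) ed2 in blast)
  moreover have "card (ed d) = 1 \<or> card (ed d) = 2" if "d \<in> edges \<Delta>1" for d
    using graphs(1) that ed1 by (simp add: is_graph_def)
  moreover define \<Omega>' :: "('v, 'f + 'g) biased_graph" where "\<Omega>' = \<lparr>nodes = nodes \<Delta>1, edges = Inl ` edges \<Omega>1, ends = en, balanced = (`) Inl ` balanced \<Omega>1\<rparr>"
  ultimately obtain M where M: "expansion_minor (expanded_edge_sum \<Omega>1 p1 \<Omega>2 p2 e \<beta>) p (edge_sum \<Delta>1 \<Delta>2 e) M"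
      "expansion_isomorphic \<Omega>' p M p"
    using minor_of_sum[OF _ K(2) _ sum_sel edge_sum_sel(2), of N \<Omega>'] by auto
  have "expansion_isomorphic \<Omega>1 p1 M p"
    by (rule expansion_isomorphic_image[OF _ x1.bal_edges _ _ _ _ _ M(2), of Inl])
      (auto simp: \<Omega>'_def graphs)
  then show ?thesis using M(1) by blast
qed

lemma sum_minor2:
  assumes "two_connected \<Delta>1" "at_least_three_nodes \<Delta>1"
  shows "\<exists>M. expansion_minor (expanded_edge_sum \<Omega>1 p1 \<Omega>2 p2 e \<beta>) p (edge_sum \<Delta>1 \<Delta>2 e) M \<and>
    expansion_isomorphic \<Omega>2 p2 M p"
proof -
  interpret s: amalgam "j ` edges \<Omega>2" "(`) j ` balanced \<Omega>2" "Inl ` edges \<Omega>1" "(`) Inl ` balanced \<Omega>1"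
    p en "edges \<Delta>2" "edges \<Delta>1" ed "nodes \<Delta>2" "nodes \<Delta>1" u v e by (rule swap)
  have "u \<in> nodes \<Delta>1" "v \<in> nodes \<Delta>1" using shared(3) by auto
  then obtain N K where K: "pth (ends \<Delta>1) u N K v" "K \<subseteq> edges \<Delta>1 - {e}"
    using two_connected_avoiding_path[OF assms uv] by blast
  have "pth ed u N K v" by (rule pth_cong[OF K(1)]) (use K(2) ed1 in blast)
  moreover have "card (ed d) = 1 \<or> card (ed d) = 2" if "d \<in> edges \<Delta>2" for d
    using graphs(2) that ed2 by (simp add: is_graph_def)
  moreover define \<Omega>' :: "('v, 'f + 'g) biased_graph" where "\<Omega>' = \<lparr>nodes = nodes \<Delta>2, edges = j ` edges \<Omega>2, ends = en, balanced = (`) j ` balanced \<Omega>2\<rparr>"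
  ultimately obtain M where M: "expansion_minor (expanded_edge_sum \<Omega>1 p1 \<Omega>2 p2 e \<beta>) p (edge_sum \<Delta>1 \<Delta>2 e) M"
      "expansion_isomorphic \<Omega>' p M p"
    using s.minor_of_sum[OF _ K(2) _ _ _ sum_sel(3), of N "edge_sum \<Delta>1 \<Delta>2 e" \<Omega>'] sum_sel edge_sum_sel(2)
    by (auto simp: Un_commute glue_commute)
  have "expansion_isomorphic \<Omega>2 p2 M p"
    by (rule expansion_isomorphic_image[OF glue_inj x2.bal_edges _ _ _ _ _ M(2)])
      (auto simp: \<Omega>'_def graphs p_j en_j)
  then show ?thesis using M(1) by blast
qed

end

theorem theorem5p1:
  fixes \<Delta>1 \<Delta>2 :: "('v, 'e) mgraph" and e :: 'e
    and \<Omega>1 :: "('v, 'f) biased_graph" and p1 :: "'f \<Rightarrow> 'e"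
    and \<Omega>2 :: "('v, 'g) biased_graph" and p2 :: "'g \<Rightarrow> 'e"
    and \<beta> :: "'f \<Rightarrow> 'g"
  assumes "is_graph \<Delta>1" and "is_graph \<Delta>2"
    and "share_exactly_link \<Delta>1 \<Delta>2 e"
    and "biased_expansion \<Omega>1 p1 \<Delta>1" and "biased_expansion \<Omega>2 p2 \<Delta>2"
    and "fiber \<Omega>1 p1 e \<approx> fiber \<Omega>2 p2 e"
    and "bij_betw \<beta> (fiber \<Omega>1 p1 e) (fiber \<Omega>2 p2 e)"
  shows
    "biased_expansion (expanded_edge_amalgamation \<Omega>1 p1 \<Omega>2 p2 e \<beta>) (case_sum p1 p2)
       (edge_amalgamation \<Delta>1 \<Delta>2) \<and>
     biased_expansion (expanded_edge_sum \<Omega>1 p1 \<Omega>2 p2 e \<beta>) (case_sum p1 p2)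
       (edge_sum \<Delta>1 \<Delta>2 e) \<and>
     biased_subgraph_via Inl \<Omega>1 (expanded_edge_amalgamation \<Omega>1 p1 \<Omega>2 p2 e \<beta>) \<and>
     biased_subgraph_via (glue2 \<Omega>1 p1 \<Omega>2 p2 e \<beta>) \<Omega>2
       (expanded_edge_amalgamation \<Omega>1 p1 \<Omega>2 p2 e \<beta>) \<and>
     (two_connected \<Delta>1 \<and> at_least_three_nodes \<Delta>1 \<and>
      two_connected \<Delta>2 \<and> at_least_three_nodes \<Delta>2 \<longrightarrow>
        (\<exists>M. expansion_minor (expanded_edge_sum \<Omega>1 p1 \<Omega>2 p2 e \<beta>) (case_sum p1 p2)
               (edge_sum \<Delta>1 \<Delta>2 e) M \<and>
             expansion_isomorphic \<Omega>1 p1 M (case_sum p1 p2)) \<and>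
        (\<exists>M. expansion_minor (expanded_edge_sum \<Omega>1 p1 \<Omega>2 p2 e \<beta>) (case_sum p1 p2)
               (edge_sum \<Delta>1 \<Delta>2 e) M \<and>
             expansion_isomorphic \<Omega>2 p2 M (case_sum p1 p2)))"
proof -
  obtain u v where uv: "ends \<Delta>1 e = {u, v}" "u \<noteq> v"
    using assms(3) by (auto simp: share_exactly_link_def is_link_def card_2_iff)
  interpret gluing \<Delta>1 \<Delta>2 e \<Omega>1 p1 \<Omega>2 p2 \<beta> u v
    using assms(3-5,7) uv by unfold_locales
  show ?thesis
    using amalgamation_expansion sum_expansion amalgamation_subgraph1 amalgamation_subgraph2
      sum_minor1 sum_minor2 by blast
qed

end
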